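(* The rooted graph $M^2_2$ is the complete binary tree with rows of ranks $0,1,2,3$ (a root; two nodes in row 1, one starting the left branch and one starting the right branch; every node of rank less than $3$ has exactly two neighbours in the next row). Each of the four nodes of rank $2$ has exactly one one-dimensional neighbour in the top row (rank $3$); these four one-dimensional nodes (two in the left branch and two in the right branch) are also hooks, and the remaining four nodes in the top row are not hooks. Moreover, for every $k\ge 2$, $M^2_{k+1}$ is obtained from $M^2_k$ as follows. (1) $M^2_{k+1}$ is obtained from $M^2_k$ by attaching two copies of $M^2_k$ to each hook in the top row of $M^2_k$, each copy being attached by an edge joining the hook to the root of the copy. (That is: a node $v$ in the top row of $M^2_k$ that is not a hook has no neighbour of rank $2^k$ in $M^2_{k+1}$; if $v$ is a hook it has exactly two neighbours of rank $2^k$; and for each such neighbour $u$ the subgraph of $M^2_{k+1}$ consisting of $u$ and the nodes of $M^2_{k+1}$ lying above $u$ is a copy of $M^2_k$ with root $u$, these copies together with $M^2_k$ accounting for all nodes and edges of $M^2_{k+1}$.) Further, the identifications of these copies with $M^2_k$ can be chosen so that, marking each node of a copy as a hook, as one-dimensional, or as lying in the left/right branch of the copy according to the node of $M^2_k$ it corresponds to, the following hold. (2) The hooks in the top row of the left (respectively, right) branch of $M^2_{k+1}$ are exactly the nodes obtained by taking, for each one-dimensional node $v$ in the top row of the left (respectively, right) branch of $M^2_k$, the hooks in the top row of the left (respectively, right) branch of one of the two copies of $M^2_k$ attached to $v$. (3) The one-dimensional nodes in the top row of the left (respectively, right) branch of $M^2_{k+1}$ are exactly the nodes obtained by taking, for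 each one-dimensional node $v$ in the top row of the left (respectively, right) branch of $M^2_k$, one of the two one-dimensional nodes in the top row of the left (respectively, right) branch of one copy of $M^2_k$ attached to $v$.
   Context: For a partition $\lambda$, $f_\lambda$ denotes the number of standard Young tableaux of shape $\lambda$ (equivalently the dimension of the irreducible representation of the symmetric group $S_{|\lambda|}$ indexed by $\lambda$); $\lambda$ is odd if $f_\lambda$ is odd. A partition is a hook if it has the form $(j,1^{m-j})$ with $1\le j\le m$. A bipartition of $n$ is an ordered pair $(\alpha,\beta)$ of partitions with $|\alpha|+|\beta|=n$; $n$ is called its rank (or weight). Put $$f_{\alpha\beta}=\frac{n!}{|\alpha|!\,|\beta|!}f_\alpha f_\beta,$$ which is the dimension of the irreducible representation $\rho_{\alpha\beta}$ of the hyperoctahedral group $\mathbb B_n=S_2\wr S_n$ indexed by $(\alpha,\beta)$. The bipartition $(\alpha,\beta)$ is odd if $f_{\alpha\beta}$ is odd, and one-dimensional if $f_{\alpha\beta}=1$. It is called a hook if one of $\alpha,\beta$ is empty and the non-empty component is a hook partition. Let $Y^2$ be the Hasse diagram of the poset of all bipartitions ordered by componentwise containment of Young diagrams; thus $(\alpha,\beta)$ covers $(\gamma,\delta)$ iff either $\gamma$ is obtained from $\alpha$ by removing one corner box and $\delta=\beta$, or $\gamma=\alpha$ and $\delta$ is obtained from $\beta$ by removing one corner box. ($Y^2$ is the Bratteli diagram of the family $\mathbb B_n$.) Let $M^2$ be the subgraph of $Y^2$ induced by the odd bipartitions, rooted at $(\emptyset,\emptyset)$, and let $M^2_k$ be the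 subgraph formed by its first $2^k$ rows, i.e. the odd bipartitions of ranks $0$ through $2^k-1$. The top row of $M^2_k$ is the set of its nodes of rank $2^k-1$. A node lies above $u$ if it is joined to $u$ by a rank-increasing path in $M^2_{k+1}$ starting at $u$. The left branch consists of $((1),\emptyset)$ and the nodes lying above it in $M^2$, and the right branch of $(\emptyset,(1))$ and the nodes lying above it. A copy of $M^2_k$ means a rooted graph isomorphic to $M^2_k$ as a rooted graph; its left and right branches are those corresponding to the left and right branches of $M^2_k$. *)

theory Defs
  imports Main
begin

type_synonym partition = "nat list"

definition is_partition :: "partition \<Rightarrow> bool" where
  "is_partition \<alpha> \<longleftrightarrow> sorted_wrt (\<ge>) \<alpha> \<and> (\<forall>a\<in>set \<alpha>. 0 < a)"

text \<open>English convention with indices starting at 0: \<open>(i, j)\<close> is the box in row \<open>i\<close>, column \<open>j\<close>.\<close>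

definition young_diagram :: "partition \<Rightarrow> (nat \<times> nat) set" where
  "young_diagram \<alpha> = {(i, j). i < length \<alpha> \<and> j < \<alpha> ! i}"

text \<open>Tableaux are set to 0 outside the diagram, so that each filling is represented exactly once
  and \<open>card\<close> counts fillings.\<close>

definition standard_young_tableaux :: "partition \<Rightarrow> (nat \<times> nat \<Rightarrow> nat) set" where
  "standard_young_tableaux \<alpha> =
     {T. bij_betw T (young_diagram \<alpha>) {1..sum_list \<alpha>} \<and>
         (\<forall>c. c \<notin> young_diagram \<alpha> \<longrightarrow> T c = 0) \<and>
         (\<forall>i j. (i, Suc j) \<in> young_diagram \<alpha> \<longrightarrow> T (i, j) < T (i, Suc j)) \<and>
         (\<forall>i j. (Suc i, j) \<in> young_diagram \<alpha> \<longrightarrow> T (i, j) < T (Suc i, j))}"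

definition f_part :: "partition \<Rightarrow> nat" where
  "f_part \<alpha> = card (standard_young_tableaux \<alpha>)"

definition is_hook_partition :: "partition \<Rightarrow> bool" where
  "is_hook_partition \<alpha> \<longleftrightarrow> (\<exists>j m. 1 \<le> j \<and> j \<le> m \<and> \<alpha> = j # replicate (m - j) 1)"

type_synonym bipartition = "partition \<times> partition"

definition bipartitions :: "bipartition set" where
  "bipartitions = {(\<alpha>, \<beta>). is_partition \<alpha> \<and> is_partition \<beta>}"

fun bip_rank :: "bipartition \<Rightarrow> nat" where
  "bip_rank (\<alpha>, \<beta>) = sum_list \<alpha> + sum_list \<beta>"

text \<open>The natural number division is exact: the quotient is a binomial coefficient.\<close>

fun f_bip :: "bipartition \<Rightarrow> nat" where
  "f_bip (\<alpha>, \<beta>) =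
     fact (sum_list \<alpha> + sum_list \<beta>) div (fact (sum_list \<alpha>) * fact (sum_list \<beta>))
       * f_part \<alpha> * f_part \<beta>"

definition one_dimensional :: "bipartition \<Rightarrow> bool" where
  "one_dimensional p \<longleftrightarrow> f_bip p = 1"

fun is_hook :: "bipartition \<Rightarrow> bool" where
  "is_hook (\<alpha>, \<beta>) \<longleftrightarrow>
     (\<beta> = [] \<and> is_hook_partition \<alpha>) \<or> (\<alpha> = [] \<and> is_hook_partition \<beta>)"

fun bip_le :: "bipartition \<Rightarrow> bipartition \<Rightarrow> bool" where
  "bip_le (\<gamma>, \<delta>) (\<alpha>, \<beta>) \<longleftrightarrow>
     young_diagram \<gamma> \<subseteq> young_diagram \<alpha> \<and> young_diagram \<delta> \<subseteq> young_diagram \<beta>"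

definition bip_less :: "bipartition \<Rightarrow> bipartition \<Rightarrow> bool" where
  "bip_less p q \<longleftrightarrow> bip_le p q \<and> p \<noteq> q"

definition bip_covers :: "bipartition \<Rightarrow> bipartition \<Rightarrow> bool" where
  "bip_covers q p \<longleftrightarrow>
     bip_less p q \<and> \<not> (\<exists>r\<in>bipartitions. bip_less p r \<and> bip_less r q)"

text \<open>Simple undirected graphs, an edge being the set of its two end points.\<close>

record 'a rooted_graph =
  nodes :: "'a set"
  edges :: "'a set set"
  root_node :: 'a

definition induced :: "'a rooted_graph \<Rightarrow> 'a set \<Rightarrow> 'a \<Rightarrow> 'a rooted_graph" where
  "induced G U r =
     \<lparr>nodes = nodes G \<inter> U, edges = {e \<in> edges G. e \<subseteq> U}, root_node = r\<rparr>"

definition rooted_iso :: "('a \<Rightarrow> 'b) \<Rightarrow> 'a rooted_graph \<Rightarrow> 'b rooted_graph \<Rightarrow> bool" where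
  "rooted_iso \<phi> G H \<longleftrightarrow>
     bij_betw \<phi> (nodes G) (nodes H) \<and>
     (\<forall>x\<in>nodes G. \<forall>y\<in>nodes G. {x, y} \<in> edges G \<longleftrightarrow> {\<phi> x, \<phi> y} \<in> edges H) \<and>
     \<phi> (root_node G) = root_node H"

definition complete_binary_tree :: "nat \<Rightarrow> bool list rooted_graph" where
  "complete_binary_tree d =
     \<lparr>nodes = {w. length w \<le> d}, edges = {{w, b # w} | w b. length w < d}, root_node = []\<rparr>"

definition Y2 :: "bipartition rooted_graph" where
  "Y2 = \<lparr>nodes = bipartitions,
         edges = {{p, q} | p q. p \<in> bipartitions \<and> q \<in> bipartitions \<and> bip_covers q p},
         root_node = ([], [])\<rparr>"

definition M2 :: "bipartition rooted_graph" where
  "M2 = induced Y2 {p. odd (f_bip p)} ([], [])"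

definition M2k :: "nat \<Rightarrow> bipartition rooted_graph" where
  "M2k k = induced M2 {p. bip_rank p \<le> 2 ^ k - 1} ([], [])"

definition up_neighbours :: "bipartition rooted_graph \<Rightarrow> bipartition \<Rightarrow> bipartition set" where
  "up_neighbours G p = {q \<in> nodes G. {p, q} \<in> edges G \<and> bip_rank q = bip_rank p + 1}"

definition lies_above ::
    "bipartition rooted_graph \<Rightarrow> bipartition \<Rightarrow> bipartition \<Rightarrow> bool" where
  "lies_above G = (\<lambda>p q. {p, q} \<in> edges G \<and> bip_rank p < bip_rank q)\<^sup>+\<^sup>+"

definition branch_at :: "bipartition rooted_graph \<Rightarrow> bipartition \<Rightarrow> bipartition set" where
  "branch_at G u = insert u {w. lies_above G u w}"

definition left_branch :: "nat \<Rightarrow> bipartition set" where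
  "left_branch k = branch_at M2 ([1], []) \<inter> nodes (M2k k)"

definition right_branch :: "nat \<Rightarrow> bipartition set" where
  "right_branch k = branch_at M2 ([], [1]) \<inter> nodes (M2k k)"

definition top_row :: "nat \<Rightarrow> bipartition set" where
  "top_row k = {p \<in> nodes (M2k k). bip_rank p = 2 ^ k - 1}"

definition top_hooks :: "nat \<Rightarrow> bipartition set" where
  "top_hooks k = {p \<in> top_row k. is_hook p}"

definition top_one_dim :: "nat \<Rightarrow> bipartition set" where
  "top_one_dim k = {p \<in> top_row k. one_dimensional p}"

text \<open>For \<open>v\<close> in the top row of \<open>M2k k\<close>, the roots of what is attached to \<open>v\<close> in \<open>M2k (k + 1)\<close>,
  and the subgraph growing from such a root.\<close>

definition attached :: "nat \<Rightarrow> bipartition \<Rightarrow> bipartition set" where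
  "attached k v = {u \<in> nodes (M2k (k + 1)). {v, u} \<in> edges (M2k (k + 1)) \<and> bip_rank u = 2 ^ k}"

definition grown_at :: "nat \<Rightarrow> bipartition \<Rightarrow> bipartition rooted_graph" where
  "grown_at k u = induced (M2k (k + 1)) (branch_at (M2k (k + 1)) u) u"

definition attachments :: "nat \<Rightarrow> (bipartition \<times> bipartition) set" where
  "attachments k = {(v, u). v \<in> top_hooks k \<and> u \<in> attached k v}"

end

theory Submission
  imports Defs "HOL-Library.Multiset"
begin

text \<open>
  A bipartition is encoded by a set of beads: the beta-numbers of its first component sit at even
  positions, those of its second component at odd positions. Removing a box moves one bead down by 2,
  and \<open>f_bip\<close> counts the descending paths to the vacuum \<open>{..<2 * N}\<close>. Modulo 2, the operator summing
  over all moves by \<open>r\<close> squares to the operator summing over all moves by \<open>2 * r\<close>, so \<open>2 ^ k\<close> box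
  removals amount to a single move by \<open>2 * 2 ^ k\<close>. Hence for \<open>m < 2 ^ k\<close> a bipartition of rank
  \<open>2 ^ k + m\<close> is odd iff one such move leads to an odd bipartition of rank \<open>m\<close>, its core, and the core
  is unique.

  If two odd bipartitions of rank at least \<open>2 ^ k\<close> differ by a box, then so do their cores; conversely a
  box relating two cores relates the bipartitions lying over them bijectively. By induction every odd
  bipartition has exactly one odd parent, and passing to the core identifies whatever grows above a
  node of rank \<open>2 ^ k\<close> with \<open>M2k k\<close>. The nodes of rank \<open>2 ^ k\<close> have empty core, so they are the hooks,
  in which a single bead of the vacuum has moved. In the copy above a single row (column) of length
  \<open>2 ^ k\<close>, each hook is obtained from the corresponding hook of \<open>M2k k\<close> by lengthening its arm (leg)
  by \<open>2 ^ k\<close>.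
\<close>

section \<open>Beads modulo 2\<close>

text \<open>Interleaving both components by parity turns the binomial factor of \<open>f_bip\<close>
  into plain path counting, so one operator serves both components. It is the adjoint of
  multiplication by the power sum p_1, and the squaring rule reflects that p_r^2 and p_(2r) agree
  modulo 2, where the signs of border strips disappear. Uniqueness of the core is an energy
  argument: the sum of the positions exceeds that of the vacuum by twice the rank, and two
  independent drops by \<open>2 * 2 ^ k\<close> would need rank at least \<open>2 * 2 ^ k\<close>.
  The obstacle is that a short move and a long move can interfere: one bead may make both, or one
  move may need a position that the other vacates or fills. Such squares of moves are completed by
  other beads, which exist because enough low positions are filled; this is why bead sets with many
  beads are used. Rank exactly \<open>2 ^ k\<close> is exceptional, since the parent then lies below
  the threshold and has no core at that level. There the two removable boxes of a hook decide by
  parity. The copies are identified through cores, so a single choice of identifications serves all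
  claims about hooks and one-dimensional nodes.\<close>

definition bead_move :: "nat \<Rightarrow> nat set \<Rightarrow> nat set \<Rightarrow> bool" where
  "bead_move r C S \<longleftrightarrow> (\<exists>c. c \<in> C \<and> c + r \<notin> C \<and> S = insert (c + r) (C - {c}))"

definition holes :: "nat \<Rightarrow> nat set \<Rightarrow> nat set" where
  "holes r S = {c. c \<notin> S \<and> c + r \<in> S}"

definition drop_bead :: "nat \<Rightarrow> nat set \<Rightarrow> nat \<Rightarrow> nat set" where
  "drop_bead r S c = insert c (S - {c + r})"

definition down_sum :: "nat \<Rightarrow> (nat set \<Rightarrow> nat) \<Rightarrow> nat set \<Rightarrow> nat" where
  "down_sum r g S = (\<Sum>c\<in>holes r S. g (drop_bead r S c))"

definition paths :: "nat \<Rightarrow> nat \<Rightarrow> nat set \<Rightarrow> nat" where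
  "paths N n = (down_sum 2 ^^ n) (\<lambda>S. of_bool (S = {..<2 * N}))"

lemma bead_move_iff_holes:
  assumes "0 < r"
  shows "bead_move r C S \<longleftrightarrow> (\<exists>c\<in>holes r S. C = drop_bead r S c)"
proof
  assume "bead_move r C S"
  then obtain c where c: "c \<in> C" "c + r \<notin> C" "S = insert (c + r) (C - {c})"
    by (auto simp: bead_move_def)
  have "c \<in> holes r S" "C = drop_bead r S c"
    using c assms by (auto simp: holes_def drop_bead_def)
  then show "\<exists>c\<in>holes r S. C = drop_bead r S c" by blast
next
  assume "\<exists>c\<in>holes r S. C = drop_bead r S c"
  then obtain c where c: "c \<notin> S" "c + r \<in> S" "C = drop_bead r S c" by (auto simp: holes_def)
  then have "c \<in> C" "c + r \<notin> C" "S = insert (c + r) (C - {c})"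
    using assms by (auto simp: drop_bead_def)
  then show "bead_move r C S" by (auto simp: bead_move_def)
qed

lemma finite_holes [simp]: "finite S \<Longrightarrow> finite (holes r S)"
  by (rule finite_subset[of _ "(\<lambda>x. x - r) ` S"]) (force simp: holes_def image_iff)+

lemma finite_drop_bead [simp]: "finite S \<Longrightarrow> finite (drop_bead r S c)"
  by (simp add: drop_bead_def)

lemma inj_on_drop_bead: "inj_on (drop_bead r S) (holes r S)"
  by (auto simp: inj_on_def drop_bead_def holes_def)

lemma bead_move_finite: "bead_move r C S \<Longrightarrow> finite C \<longleftrightarrow> finite S"
  by (auto simp: bead_move_def)

lemma bead_move_card_sum:
  assumes "bead_move r C S" "finite S"
  shows "card S = card C" "\<Sum>S = \<Sum>C + r"
proof -
  obtain c where c: "c \<in> C" "c + r \<notin> C" "S = insert (c + r) (C - {c})"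
    using assms by (auto simp: bead_move_def)
  have f: "finite C" using assms bead_move_finite by blast
  show "card S = card C" using c f card_Suc_Diff1[OF f c(1)] by simp
  show "\<Sum>S = \<Sum>C + r" using c f by (simp add: sum.remove[of C c])
qed

text \<open>The ordered pairs \<open>(x, y)\<close> and \<open>(y, x)\<close> contribute equally, so
  everything off the diagonal counts twice.\<close>

lemma even_sum_off_diagonal:
  fixes h :: "'a \<Rightarrow> 'a \<Rightarrow> nat"
  assumes "finite H" and "\<And>x y. h x y = h y x"
  shows "even (\<Sum>x\<in>H. \<Sum>y\<in>H - {x}. h x y)"
  using assms(1)
proof induction
  case (insert a H)
  have "(\<Sum>x\<in>insert a H. \<Sum>y\<in>insert a H - {x}. h x y)
      = (\<Sum>y\<in>H. h a y) + (\<Sum>x\<in>H. \<Sum>y\<in>insert a H - {x}. h x y)"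
    using insert.hyps by simp
  also have "(\<Sum>x\<in>H. \<Sum>y\<in>insert a H - {x}. h x y) = (\<Sum>x\<in>H. h x a + (\<Sum>y\<in>H - {x}. h x y))"
  proof (rule sum.cong)
    fix x assume "x \<in> H"
    then have "insert a H - {x} = insert a (H - {x})" using insert.hyps by auto
    then show "(\<Sum>y\<in>insert a H - {x}. h x y) = h x a + (\<Sum>y\<in>H - {x}. h x y)"
      using insert.hyps by simp
  qed simp
  also have "\<dots> = (\<Sum>y\<in>H. h a y) + (\<Sum>x\<in>H. \<Sum>y\<in>H - {x}. h x y)"
    by (simp add: sum.distrib assms(2)[of _ a])
  finally show ?case using insert.IH by simp
qed simp

text \<open>Moves of two different beads commute, so they cancel in pairs modulo 2; what remains are the two
  ways of covering the distance \<open>2 * r\<close>, depending on whether the position half way is occupied.\<close>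

lemma down_sum_double:
  assumes "finite S" "0 < r"
  shows "even (down_sum r (down_sum r g) S) \<longleftrightarrow> even (down_sum (2 * r) g S)"
proof -
  let ?H = "holes r S"
  define h where "h c d = g (drop_bead r (drop_bead r S c) d)" for c d
  \<comment> \<open>After a bead has dropped to \<open>c\<close>, two new drops can open up.
    \<open>A\<close>: the bead at \<open>c + 2 * r\<close> follows into the vacated place
    \<open>c + r\<close>. \<open>B\<close>: the dropped bead falls on to \<open>c - r\<close>.
    Either way the net effect is a drop by \<open>2 * r\<close>.\<close>
  define A where "A = {c\<in>?H. c + 2 * r \<in> S}"
  define B where "B = {c\<in>?H. \<exists>d. c = d + r \<and> d \<notin> S}"
  have fin: "finite ?H" "finite A" "finite B" using assms(1) by (auto simp: A_def B_def)
  have holes: "holes r (drop_bead r S c) = (?H - {c})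
      \<union> (if c \<in> A then {c + r} else {}) \<union> (if c \<in> B then {c - r} else {})" if "c \<in> ?H" for c
    unfolding A_def B_def holes_def drop_bead_def
    using that assms(2) by (auto simp: holes_def mult_2 add.assoc)
  have "down_sum r (down_sum r g) S = (\<Sum>c\<in>?H. \<Sum>d\<in>holes r (drop_bead r S c). h c d)"
    by (simp add: down_sum_def h_def)
  also have "\<dots> = (\<Sum>c\<in>?H. (\<Sum>d\<in>?H - {c}. h c d) + (if c \<in> A then h c (c + r) else 0)
                     + (if c \<in> B then h c (c - r) else 0))"
  proof (rule sum.cong)
    fix c assume c: "c \<in> ?H"
    have "c + r \<notin> ?H" "c - r \<notin> ?H \<or> c < r" "c + r \<noteq> c - r"
      using c assms(2) by (auto simp: holes_def)
    moreover have "c \<in> B \<Longrightarrow> r \<le> c" by (auto simp: B_def)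
    ultimately show "(\<Sum>d\<in>holes r (drop_bead r S c). h c d) = (\<Sum>d\<in>?H - {c}. h c d)
        + (if c \<in> A then h c (c + r) else 0) + (if c \<in> B then h c (c - r) else 0)"
      unfolding holes[OF c] using fin(1) by (auto simp: sum.insert_if)
  qed simp
  also have "\<dots> = (\<Sum>c\<in>?H. \<Sum>d\<in>?H - {c}. h c d) + ((\<Sum>c\<in>A. h c (c + r)) + (\<Sum>c\<in>B. h c (c - r)))"
  proof -
    have "?H \<inter> A = A" "?H \<inter> B = B" by (auto simp: A_def B_def)
    then show ?thesis using fin(1) by (simp add: sum.distrib flip: sum.inter_restrict)
  qed
  also have "even \<dots> \<longleftrightarrow> even ((\<Sum>c\<in>A. h c (c + r)) + (\<Sum>c\<in>B. h c (c - r)))"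
  proof -
    have "even (\<Sum>c\<in>?H. \<Sum>d\<in>?H - {c}. h c d)"
    proof -
      \<comment> \<open>The two drops commute for distinct holes only, so \<open>h\<close> is cut
        off elsewhere to obtain the symmetry that \<open>even_sum_off_diagonal\<close> asks
        for.\<close>
      define h' where "h' c d = (if c \<in> ?H \<and> d \<in> ?H \<and> c \<noteq> d then h c d else 0)" for c d
      have "h' c d = h' d c" for c d
      proof -
        have "drop_bead r (drop_bead r S c) d = drop_bead r (drop_bead r S d) c"
          if "c \<in> ?H" "d \<in> ?H" "c \<noteq> d"
          using that by (auto simp: drop_bead_def holes_def)
        then show ?thesis by (auto simp: h'_def h_def)
      qed
      then have "even (\<Sum>c\<in>?H. \<Sum>d\<in>?H - {c}. h' c d)"
        by (rule even_sum_off_diagonal[OF fin(1)])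
      also have "(\<Sum>c\<in>?H. \<Sum>d\<in>?H - {c}. h' c d) = (\<Sum>c\<in>?H. \<Sum>d\<in>?H - {c}. h c d)"
        by (intro sum.cong refl) (auto simp: h'_def)
      finally show ?thesis .
    qed
    then show ?thesis by simp
  qed
  also have "(\<Sum>c\<in>A. h c (c + r)) + (\<Sum>c\<in>B. h c (c - r)) = down_sum (2 * r) g S"
  proof -
    define g' where "g' e = g (drop_bead (2 * r) S e)" for e
    define B' where "B' = (\<lambda>c. c - r) ` B"
    have inj: "inj_on (\<lambda>c. c - r) B" by (auto simp: inj_on_def B_def)
    have "(\<Sum>c\<in>A. h c (c + r)) = (\<Sum>c\<in>A. g' c)"
    proof (rule sum.cong)
      fix c assume "c \<in> A"
      then have "drop_bead r (drop_bead r S c) (c + r) = drop_bead (2 * r) S c"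
        using assms(2) by (auto simp: A_def drop_bead_def holes_def)
      then show "h c (c + r) = g' c" by (simp add: h_def g'_def)
    qed simp
    moreover have "(\<Sum>c\<in>B. h c (c - r)) = (\<Sum>c\<in>B'. g' c)"
      unfolding B'_def sum.reindex[OF inj]
    proof (rule sum.cong)
      fix c assume c: "c \<in> B"
      then obtain d where "c = d + r" "d \<notin> S" "c \<notin> S" "c + r \<in> S" by (auto simp: B_def holes_def)
      then have "drop_bead r (drop_bead r S c) (c - r) = drop_bead (2 * r) S (c - r)"
        using assms(2) by (auto simp: drop_bead_def)
      then show "h c (c - r) = (g' \<circ> (\<lambda>c. c - r)) c" by (simp add: h_def g'_def)
    qed simp
    moreover have "holes (2 * r) S = A \<union> B'"
    proof -
      have "B' = {d. d \<notin> S \<and> d + r \<notin> S \<and> d + r + r \<in> S}"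
        unfolding B'_def B_def holes_def by force
      then show ?thesis by (auto simp: A_def holes_def add.assoc mult_2)
    qed
    moreover have "A \<inter> B' = {}" by (auto simp: A_def B'_def B_def holes_def)
    ultimately show ?thesis using fin by (simp add: down_sum_def g'_def[symmetric] sum.union_disjoint B'_def)
  qed
  finally show ?thesis .
qed

lemma down_sum_cong_parity:
  assumes "finite S" "\<And>C. finite C \<Longrightarrow> even (g C) \<longleftrightarrow> even (g' C)"
  shows "even (down_sum r g S) \<longleftrightarrow> even (down_sum r g' S)"
proof -
  have "even (\<Sum>c\<in>H. g (drop_bead r S c)) \<longleftrightarrow> even (\<Sum>c\<in>H. g' (drop_bead r S c))" if "finite H" for H
    using that by induction (use assms in auto)
  then show ?thesis using assms(1) by (simp add: down_sum_def)
qed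

lemma down_sum_power_two:
  assumes "finite S" "0 < r"
  shows "even ((down_sum r ^^ (2 ^ k)) g S) \<longleftrightarrow> even (down_sum (r * 2 ^ k) g S)"
  using assms(1)
proof (induction k arbitrary: g S)
  case (Suc k)
  let ?q = "2 ^ k :: nat"
  have "(down_sum r ^^ (2 ^ Suc k)) g S = (down_sum r ^^ ?q) ((down_sum r ^^ ?q) g) S"
    by (simp add: mult_2 funpow_add)
  also have "even \<dots> \<longleftrightarrow> even (down_sum (r * ?q) ((down_sum r ^^ ?q) g) S)"
    by (rule Suc.IH[OF Suc.prems])
  \<comment> \<open>The inner iterate is replaced under the outer sum, which takes its parity on all
    finite sets; hence the induction keeps \<open>g\<close> and \<open>S\<close> arbitrary.\<close>
  also have "\<dots> \<longleftrightarrow> even (down_sum (r * ?q) (down_sum (r * ?q) g) S)"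
    by (rule down_sum_cong_parity[OF Suc.prems Suc.IH])
  also have "\<dots> \<longleftrightarrow> even (down_sum (r * 2 ^ Suc k) g S)"
    using down_sum_double[OF Suc.prems, of "r * ?q" g] assms(2) by (simp add: ac_simps)
  finally show ?case .
qed simp

section \<open>Path counts and bounds on bead sums\<close>

lemma paths_0 [simp]: "paths N 0 S = of_bool (S = {..<2 * N})"
  by (simp add: paths_def)

lemma paths_Suc: "paths N (Suc n) S = (\<Sum>c\<in>holes 2 S. paths N n (drop_bead 2 S c))"
  by (simp add: paths_def down_sum_def)

lemma odd_sum_nat_ex: "odd (\<Sum>x\<in>A. f x :: nat) \<Longrightarrow> \<exists>x\<in>A. odd (f x)"
  using dvd_sum[of A 2 f] by blast

definition odd_beads :: "nat \<Rightarrow> nat \<Rightarrow> nat set \<Rightarrow> bool" where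
  "odd_beads N n S \<longleftrightarrow> finite S \<and> odd (paths N n S)"

lemma paths_card_sum:
  "finite S \<Longrightarrow> paths N n S \<noteq> 0 \<Longrightarrow> card S = 2 * N \<and> \<Sum>S = \<Sum>{..<2 * N} + 2 * n"
proof (induction n arbitrary: S)
  case (Suc n)
  then obtain c where c: "c \<in> holes 2 S" "paths N n (drop_bead 2 S c) \<noteq> 0"
    by (auto simp: paths_Suc)
  then have "bead_move 2 (drop_bead 2 S c) S" by (auto simp: bead_move_iff_holes)
  from bead_move_card_sum[OF this Suc.prems(1)] Suc.IH[OF _ c(2)] Suc.prems(1)
  show ?case by simp
qed auto

lemma odd_beads_finite: "odd_beads N n S \<Longrightarrow> finite S"
  by (simp add: odd_beads_def)

lemma odd_beads_card: "odd_beads N n S \<Longrightarrow> card S = 2 * N"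
  and odd_beads_sum: "odd_beads N n S \<Longrightarrow> \<Sum>S = \<Sum>{..<2 * N} + 2 * n"
  unfolding odd_beads_def using paths_card_sum[of S N n] by (auto elim: oddE)

text \<open>Induction by removing the largest element. The vacuum thus has the least sum for its
  size, and the excess over it bounds how far beads can still descend.\<close>

lemma sum_ge_sum_lessThan_card:
  fixes S :: "nat set"
  assumes "finite S" shows "\<Sum>{..<card S} \<le> \<Sum>S"
  using assms
proof (induction "card S" arbitrary: S)
  case (Suc n)
  let ?m = "Max S"
  have m: "?m \<in> S" using Suc by (intro Max_in) auto
  have "S \<subseteq> {..?m}" using Suc by auto
  then have "card S \<le> card {..?m}" by (intro card_mono) auto
  then have "n \<le> ?m" using Suc.hyps(2) by simp
  moreover have "\<Sum>{..<n} \<le> \<Sum>(S - {?m})"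
    using Suc.hyps(1)[of "S - {?m}"] Suc.hyps(2) Suc.prems m
    by (metis card_Diff_singleton diff_Suc_1 finite_Diff)
  moreover have "\<Sum>S = ?m + \<Sum>(S - {?m})" using sum.remove[OF Suc.prems m, of id] by simp
  moreover have "\<Sum>{..<card S} = \<Sum>{..<n} + n" using Suc.hyps(2)[symmetric] by simp
  ultimately show ?case by linarith
qed simp

text \<open>Filling the gap \<open>g\<close> gives a set with one more bead, to which the least-sum
  bound applies: a gap far down costs a large sum.\<close>

lemma bead_low:
  fixes S :: "nat set"
  assumes "finite S" "g \<notin> S"
  shows "\<Sum>{..<card S} + card S \<le> \<Sum>S + g"
  using sum_ge_sum_lessThan_card[of "insert g S"] assms by simp

lemma odd_beads_low:
  assumes "odd_beads N n S" "g < 2 * N - 2 * n"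
  shows "g \<in> S"
  using bead_low[of S g] assms odd_beads_card[OF assms(1)] odd_beads_sum[OF assms(1)]
    odd_beads_finite[OF assms(1)] by fastforce

lemma bead_move_sum_ge:
  assumes "finite S" "bead_move r C S" "card S = n"
  shows "\<Sum>{..<n} + r \<le> \<Sum>S"
  using sum_ge_sum_lessThan_card[of C] bead_move_card_sum[OF assms(2,1)] bead_move_finite[OF assms(2)]
    assms(1,3) by simp

text \<open>A gap at \<open>x\<close> would let the bead at \<open>x + r\<close> drop by
  \<open>r\<close>, to a sum below the least possible one.\<close>

lemma beads_closed:
  assumes "finite C" "card C = n" "\<Sum>C < \<Sum>{..<n} + r" "x + r \<in> C"
  shows "x \<in> C"
proof (rule ccontr)
  assume "x \<notin> C"
  then have "bead_move r (drop_bead r C x) C"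
    using assms(4) by (cases "r = 0") (auto simp: bead_move_iff_holes holes_def)
  from bead_move_sum_ge[OF assms(1) this assms(2)] assms(3) show False by simp
qed

text \<open>Two different drops by \<open>r\<close> have different holes and beads, so the second is
  still possible after the first; together they need an excess of \<open>2 * r\<close>.\<close>

lemma bead_move_unique:
  assumes "finite S" "card S = n" "\<Sum>S < \<Sum>{..<n} + 2 * r" "bead_move r C S" "bead_move r C' S"
  shows "C = C'"
proof (rule ccontr)
  assume ne: "C \<noteq> C'"
  have r: "0 < r" using assms(3) sum_ge_sum_lessThan_card[OF assms(1)] assms(2) by (cases r) auto
  obtain c where c: "c \<in> holes r S" "C = drop_bead r S c"
    using assms(4) r by (auto simp: bead_move_iff_holes)
  obtain d where d: "d \<in> holes r S" "C' = drop_bead r S d"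
    using assms(5) r by (auto simp: bead_move_iff_holes)
  have "d \<in> holes r C" using c d ne by (auto simp: holes_def drop_bead_def)
  then have "bead_move r (drop_bead r C d) C" using r by (auto simp: bead_move_iff_holes)
  from bead_move_sum_ge[OF _ this] bead_move_card_sum[OF assms(4,1)] assms(1-3)
    bead_move_finite[OF assms(4)]
  show False by auto
qed

lemma odd_beads_core_iff:
  assumes "m < 2 ^ k"
  shows "odd_beads N (2 ^ k + m) S \<longleftrightarrow> (\<exists>C. bead_move (2 * 2 ^ k) C S \<and> odd_beads N m C)"
proof -
  let ?r = "2 * 2 ^ k :: nat"
  have eq: "even (paths N (2 ^ k + m) S) \<longleftrightarrow> even (\<Sum>c\<in>holes ?r S. paths N m (drop_bead ?r S c))"
    if "finite S"
  proof -
    have "paths N (2 ^ k + m) = (down_sum 2 ^^ (2 ^ k)) (paths N m)"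
      by (simp add: paths_def funpow_add)
    then show ?thesis using down_sum_power_two[OF that, of 2 k "paths N m"]
      by (simp add: down_sum_def)
  qed
  show ?thesis
  proof
    assume o: "odd_beads N (2 ^ k + m) S"
    then obtain c where "c \<in> holes ?r S" "odd (paths N m (drop_bead ?r S c))"
      using eq odd_sum_nat_ex[of "\<lambda>c. paths N m (drop_bead ?r S c)" "holes ?r S"]
      by (auto simp: odd_beads_def)
    then show "\<exists>C. bead_move ?r C S \<and> odd_beads N m C"
      using o by (auto simp: bead_move_iff_holes odd_beads_def intro!: exI[of _ "drop_bead ?r S c"])
  next
    assume "\<exists>C. bead_move ?r C S \<and> odd_beads N m C"
    then obtain C where C: "bead_move ?r C S" "odd_beads N m C" by blast
    then have fin: "finite S" using bead_move_finite odd_beads_finite by blast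
    obtain c where c: "c \<in> holes ?r S" "C = drop_bead ?r S c"
      using C(1) by (auto simp: bead_move_iff_holes)
    \<comment> \<open>\<open>m < 2 ^ k\<close> leaves too little excess for a second drop, so the
      sum over the holes has a single term and nothing can cancel modulo 2.\<close>
    have "holes ?r S = {c}"
    proof -
      have "d = c" if "d \<in> holes ?r S" for d
      proof -
        have "bead_move ?r (drop_bead ?r S d) S" using that by (auto simp: bead_move_iff_holes)
        moreover have "\<Sum>S < \<Sum>{..<2 * N} + 2 * ?r"
          using bead_move_card_sum(2)[OF C(1) fin] odd_beads_sum[OF C(2)] assms by simp
        moreover have "card S = 2 * N"
          using bead_move_card_sum(1)[OF C(1) fin] odd_beads_card[OF C(2)] by simp
        ultimately have "drop_bead ?r S d = C" using C(1) bead_move_unique[OF fin] by blast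
        then show "d = c" using inj_on_drop_bead[of ?r S] that c by (auto simp: inj_on_def)
      qed
      then show ?thesis using c(1) by blast
    qed
    then show "odd_beads N (2 ^ k + m) S"
      using eq fin C(2) c by (auto simp: odd_beads_def)
  qed
qed

section \<open>Cores\<close>

text \<open>Here \<open>C\<close> is the core of \<open>S\<close> and \<open>C'\<close> the core of a parent \<open>S'\<close> of \<open>S\<close>.\<close>

lemma core_parent:
  assumes closed: "\<And>x. x + 2 * p \<in> C \<Longrightarrow> x \<in> C"
    and CS: "bead_move (2 * p) C S" and S'S: "bead_move 2 S' S" and CS': "bead_move (2 * p) C' S'"
    and uniq: "\<And>X. bead_move (2 * p) X S' \<Longrightarrow> X = C'" and p: "2 \<le> p"
  shows "bead_move 2 C' C"
proof -
  obtain c where c: "c \<in> C" "c + 2 * p \<notin> C" "S = insert (c + 2 * p) (C - {c})"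
    using CS by (auto simp: bead_move_def)
  obtain x where x: "x \<notin> S" "x + 2 \<in> S" "S' = insert x (S - {x + 2})"
    using S'S by (auto simp: bead_move_iff_holes holes_def drop_bead_def)
  obtain y where y: "y \<notin> S'" "y + 2 * p \<in> S'" "C' = insert y (S' - {y + 2 * p})"
    using CS' p by (auto simp: bead_move_iff_holes holes_def drop_bead_def)
  \<comment> \<open>The removed box can interfere with the long move from \<open>c\<close> to
    \<open>c + 2 * p\<close> in two ways: the raised bead itself steps down, or the bead at
    \<open>c + 2\<close> steps into the vacated place \<open>c\<close>. In the latter event the core
    loses its box higher up, at \<open>c + 2 * p\<close>, because in \<open>S'\<close> it is the
    place \<open>c + 2\<close> that a bead can drop into.\<close>
  consider "x + 2 = c + 2 * p" | "x + 2 \<noteq> c + 2 * p" "x \<noteq> c" | "x = c" by blast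
  then show ?thesis
  proof cases
    case 1
    then have S': "S' = insert x (C - {c})" using c x p by auto
    have "y + 2 * p = x"
    proof (rule ccontr)
      assume "y + 2 * p \<noteq> x"
      then have "y + 2 * p \<in> C" using y(2) S' by auto
      with closed[OF this] y(1) S' c show False by auto
    qed
    then have "c = y + 2" using 1 by simp
    moreover have "C' = insert y (C - {c})" using y S' \<open>y + 2 * p = x\<close> x c 1 by auto
    moreover have "y \<notin> C" using y(1) S' \<open>c = y + 2\<close> by auto
    ultimately show ?thesis using c(1) by (auto simp: bead_move_iff_holes holes_def drop_bead_def)
  next
    case 2
    have "bead_move (2 * p) (insert c (S' - {c + 2 * p})) S'"
      unfolding bead_move_iff_holes[OF mult_pos_pos, OF zero_less_numeral order.strict_trans2[OF zero_less_numeral p]]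
      using 2 c x by (intro bexI[of _ c]) (auto simp: holes_def drop_bead_def)
    then have "C' = insert c (S' - {c + 2 * p})" using uniq by blast
    also have "\<dots> = insert x (C - {x + 2})" using 2 c x by auto
    finally show ?thesis using 2 c x by (auto simp: bead_move_iff_holes holes_def drop_bead_def)
  next
    case 3
    have S': "S' = insert (c + 2 * p) (C - {c + 2})" using 3 c x p by auto
    have "y \<noteq> c" using y S' c by auto
    then have "y + 2 * p \<in> C" using y(2) S' by auto
    with closed[OF this] y(1) S' have y2: "y = c + 2" by auto
    have "C' = insert (c + 2 * p) (C - {c + 2 * p + 2})"
    proof -
      have "c + 2 \<in> C" "c + 2 * p \<noteq> c + 2 * p + 2" "c + 2 \<noteq> c + 2 * p + 2" "c + 2 + 2 * p = c + 2 * p + 2"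
        using x 3 c p by auto
      then show ?thesis unfolding y(3) S' y2 by auto
    qed
    then show ?thesis using y2 \<open>y + 2 * p \<in> C\<close> c
      by (auto simp: bead_move_iff_holes holes_def drop_bead_def algebra_simps)
  qed
qed

text \<open>Completes the square with the corners \<open>C'\<close>, \<open>C\<close>,
  \<open>S\<close>. Moves of unrelated beads are exchanged. If one bead makes both moves
  (\<open>c = b + 2\<close>), it makes them in the other order; if the long move ends on the place
  that the short one vacated (\<open>c + 2 * p = b\<close>), the bead at \<open>c + 2\<close> takes
  the long move instead.\<close>

lemma lift_parent_exists:
  assumes closed: "\<And>x. x + 2 * p \<in> C \<Longrightarrow> x \<in> C"
    and C'C: "bead_move 2 C' C" and CS: "bead_move (2 * p) C S" and p: "2 \<le> p"
  shows "\<exists>S'. bead_move (2 * p) C' S' \<and> bead_move 2 S' S"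
proof -
  obtain c where c: "c \<in> C" "c + 2 * p \<notin> C" "S = insert (c + 2 * p) (C - {c})"
    using CS by (auto simp: bead_move_def)
  obtain b where b: "b \<notin> C" "b + 2 \<in> C" "C' = insert b (C - {b + 2})"
    using C'C by (auto simp: bead_move_iff_holes holes_def drop_bead_def)
  have p0: "0 < 2 * p" using p by simp
  consider "c = b + 2" | "c + 2 * p = b" | "c \<noteq> b + 2" "c + 2 * p \<noteq> b" by blast
  then show ?thesis
  proof cases
    case 1
    have "b + 2 * p \<notin> C" using closed b by blast
    then have "bead_move (2 * p) C' (insert (b + 2 * p) (C' - {b}))"
      unfolding bead_move_def using b p by (intro exI[of _ b]) auto
    moreover have "bead_move 2 (insert (b + 2 * p) (C' - {b})) S"
      unfolding bead_move_iff_holes[OF zero_less_numeral]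
      using 1 b c p \<open>b + 2 * p \<notin> C\<close>
      by (intro bexI[of _ "b + 2 * p"]) (auto simp: holes_def drop_bead_def)
    ultimately show ?thesis by blast
  next
    case 2
    have c2: "c + 2 \<in> C" using closed[of "c + 2"] b 2 by (simp add: algebra_simps)
    have "bead_move (2 * p) C' (insert (c + 2 + 2 * p) (C' - {c + 2}))"
      unfolding bead_move_def using 2 b c c2 p by (intro exI[of _ "c + 2"]) auto
    moreover have "bead_move 2 (insert (c + 2 + 2 * p) (C' - {c + 2})) S"
      unfolding bead_move_iff_holes[OF zero_less_numeral]
      using 2 b c c2 p by (intro bexI[of _ c]) (auto simp: holes_def drop_bead_def)
    ultimately show ?thesis by blast
  next
    case 3
    have "bead_move (2 * p) C' (insert (c + 2 * p) (C' - {c}))"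
      unfolding bead_move_def using 3 b c by (intro exI[of _ c]) auto
    moreover have "bead_move 2 (insert (c + 2 * p) (C' - {c})) S"
      unfolding bead_move_iff_holes[OF zero_less_numeral]
      using 3 b c by (intro bexI[of _ b]) (auto simp: holes_def drop_bead_def)
    ultimately show ?thesis by blast
  qed
qed

text \<open>Completes the square at the opposite corner. The delicate case is that both moves out of
  \<open>C'\<close> end at \<open>b + 2\<close>; then the bead \<open>2 * p\<close> below
  \<open>b\<close> takes the long move, and \<open>low\<close> guarantees that \<open>b\<close> lies
  high enough for it.\<close>

lemma lift_child_exists:
  assumes closed: "\<And>x. x + 2 * p \<in> C' \<Longrightarrow> x \<in> C'" and low: "{..<2 * p + 2} \<subseteq> C'"
    and C'C: "bead_move 2 C' C" and CS': "bead_move (2 * p) C' S'" and p: "2 \<le> p"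
  shows "\<exists>S. bead_move (2 * p) C S \<and> bead_move 2 S' S"
proof -
  obtain d where d: "d \<in> C'" "d + 2 * p \<notin> C'" "S' = insert (d + 2 * p) (C' - {d})"
    using CS' by (auto simp: bead_move_def)
  obtain b where b: "b \<in> C'" "b + 2 \<notin> C'" "C = insert (b + 2) (C' - {b})"
    using C'C by (auto simp: bead_move_def)
  consider "d = b" | "d + 2 * p = b + 2" | "d \<noteq> b" "d + 2 * p \<noteq> b + 2" by blast
  then show ?thesis
  proof cases
    case 1
    have n: "b + 2 + 2 * p \<notin> C'" using closed b by blast
    have "bead_move (2 * p) C (insert (b + 2 + 2 * p) (C - {b + 2}))"
      unfolding bead_move_def using b n p by (intro exI[of _ "b + 2"]) auto
    moreover have "bead_move 2 S' (insert (b + 2 + 2 * p) (C - {b + 2}))"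
      unfolding bead_move_def
      using 1 b d n p by (intro exI[of _ "b + 2 * p"]) auto
    ultimately show ?thesis by blast
  next
    case 2
    have "b + 2 \<notin> {..<2 * p + 2}" using low b(2) by blast
    then obtain e where e: "b = e + 2 * p" by (metis add.commute add_less_cancel_right le_Suc_ex lessThan_iff not_less)
    have eC: "e \<in> C'" using closed b e by blast
    have de: "d = e + 2" using 2 e by simp
    have "bead_move (2 * p) C (insert b (C - {e}))"
      unfolding bead_move_def using e eC b p by (intro exI[of _ e]) auto
    moreover have "bead_move 2 S' (insert b (C - {e}))"
      unfolding bead_move_def using e eC b d de p by (intro exI[of _ e]) auto
    ultimately show ?thesis by blast
  next
    case 3
    have "bead_move (2 * p) C (insert (d + 2 * p) (C - {d}))"
      unfolding bead_move_def using 3 b d by (intro exI[of _ d]) auto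
    moreover have "bead_move 2 S' (insert (d + 2 * p) (C - {d}))"
      unfolding bead_move_def using 3 b d by (intro exI[of _ b]) auto
    ultimately show ?thesis by blast
  qed
qed

section \<open>Uniqueness of the fourth corner of a square of moves\<close>

lemma mset_set_exchange:
  assumes "finite C" "z \<in> C" "w \<notin> C"
  shows "add_mset z (mset_set (insert w (C - {z}))) = add_mset w (mset_set C)"
  using assms by (simp add: mset_set.remove)

text \<open>Going once round the square returns to the same bead set, so the vacated and the
  occupied positions agree as multisets. Multisets allow entries to be cancelled one at a time;
  matching \<open>c\<close> against the occupied positions leaves the three configurations.\<close>

lemma square_positions:
  assumes fin: "finite C"
    and C'C: "C' = insert b (C - {b + 2})" "b \<notin> C" "b + 2 \<in> C"
    and CS: "S = insert (c + 2 * p) (C - {c})" "c \<in> C" "c + 2 * p \<notin> C"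
    and CS': "S' = insert (d + 2 * p) (C' - {d})" "d \<in> C'" "d + 2 * p \<notin> C'"
    and S'S: "bead_move 2 S' S" and p: "2 \<le> p"
  shows "c = b + 2 \<and> d = b \<or> c + 2 * p = b \<and> d = c + 2 \<or> d = c"
proof -
  obtain x where x: "x \<notin> S" "x + 2 \<in> S" "S' = insert x (S - {x + 2})"
    using S'S by (auto simp: bead_move_iff_holes holes_def drop_bead_def)
  have f: "finite C'" "finite S" using C'C CS fin by auto
  have "add_mset (b + 2) (mset_set C') = add_mset b (mset_set C)"
    unfolding C'C(1) using C'C fin by (intro mset_set_exchange)
  moreover have "add_mset c (mset_set S) = add_mset (c + 2 * p) (mset_set C)"
    unfolding CS(1) using CS fin by (intro mset_set_exchange)
  moreover have "add_mset d (mset_set S') = add_mset (d + 2 * p) (mset_set C')"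
    unfolding CS'(1) using CS' f by (intro mset_set_exchange)
  moreover have "add_mset (x + 2) (mset_set S') = add_mset x (mset_set S)"
    unfolding x(3) using x f by (intro mset_set_exchange)
  ultimately have "mset_set C + {#c, x + 2, b, d + 2 * p#} = mset_set C + {#c + 2 * p, x, b + 2, d#}"
    by (metis (no_types, opaque_lifting) add_mset_commute add_mset_add_single union_mset_add_mset_right add.commute)
  then have eq: "{#c, x + 2, b, d + 2 * p#} = {#c + 2 * p, x, b + 2, d#}"
    by (simp add: add_mset_commute)
  have ne: "c \<noteq> b" "d \<noteq> b + 2" "c + 2 * p \<noteq> b + 2" "d + 2 * p \<noteq> b"
    using C'C CS CS' by auto
  have "c \<in># {#c + 2 * p, x, b + 2, d#}" unfolding eq[symmetric] by simp
  then consider "c = d" | "c = b + 2" "c \<noteq> d" | "c = x" "c \<noteq> d" "c \<noteq> b + 2" using p by auto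
  then show ?thesis
  proof cases
    case 1
    then show ?thesis using ne by auto
  next
    case 2
    have eq': "{#x + 2, b, d + 2 * p#} = {#c + 2 * p, x, d#}"
      using eq 2 by (simp add: add_mset_commute)
    have "b \<in># {#c + 2 * p, x, d#}" unfolding eq'[symmetric] by simp
    then consider "b = x" | "b = d" using 2 by auto
    then show ?thesis
    proof cases
      case 1
      then have eq'': "{#b + 2, d + 2 * p#} = {#c + 2 * p, d#}"
        using eq' by (simp add: add_mset_commute)
      have "d \<in># {#b + 2, d + 2 * p#}" unfolding eq'' by simp
      then show ?thesis using p 2 by auto
    qed (use 2 in simp)
  next
    case 3
    have eq': "{#c + 2, b, d + 2 * p#} = {#c + 2 * p, b + 2, d#}"
      using eq 3 by (simp add: add_mset_commute)
    have "d \<in># {#c + 2, b, d + 2 * p#}" unfolding eq' by simp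
    then consider "d = c + 2" | "d = b" using p by auto
    then show ?thesis
    proof cases
      case 1
      then have eq'': "{#b, d + 2 * p#} = {#c + 2 * p, b + 2#}"
        using eq' by (simp add: add_mset_commute)
      have "b \<in># {#c + 2 * p, b + 2#}" unfolding eq''[symmetric] by simp
      then show ?thesis using 1 3 by auto
    next
      case 2
      then have eq'': "{#c + 2, d + 2 * p#} = {#c + 2 * p, b + 2#}"
        using eq' by (simp add: add_mset_commute)
      have "c + 2 \<in># {#c + 2 * p, b + 2#}" unfolding eq''[symmetric] by simp
      then show ?thesis using ne p by auto
    qed
  qed
qed

text \<open>\<open>square_positions\<close> determines \<open>d\<close> from \<open>b\<close> and
  \<open>c\<close>: in the two special configurations the generic answer \<open>d = c\<close> would
  give \<open>d = b + 2\<close> or \<open>d + 2 * p = b\<close>, but \<open>C'\<close> lacks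
  \<open>b + 2\<close> and contains \<open>b\<close>.\<close>

lemma lift_parent_unique:
  assumes "finite C" "bead_move 2 C' C" "bead_move (2 * p) C S" "2 \<le> p"
    and "bead_move (2 * p) C' S1" "bead_move 2 S1 S" "bead_move (2 * p) C' S2" "bead_move 2 S2 S"
  shows "S1 = S2"
proof -
  obtain b where b: "b \<notin> C" "b + 2 \<in> C" "C' = insert b (C - {b + 2})"
    using assms(2) by (auto simp: bead_move_iff_holes holes_def drop_bead_def)
  obtain c where c: "c \<in> C" "c + 2 * p \<notin> C" "S = insert (c + 2 * p) (C - {c})"
    using assms(3) by (auto simp: bead_move_def)
  obtain d where d: "d \<in> C'" "d + 2 * p \<notin> C'" "S1 = insert (d + 2 * p) (C' - {d})"
    using assms(5) by (auto simp: bead_move_def)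
  obtain e where e: "e \<in> C'" "e + 2 * p \<notin> C'" "S2 = insert (e + 2 * p) (C' - {e})"
    using assms(7) by (auto simp: bead_move_def)
  have "b + 2 \<notin> C'" "b \<in> C'" using b by auto
  then have "d \<noteq> b + 2" "e \<noteq> b + 2" "d + 2 * p \<noteq> b" "e + 2 * p \<noteq> b" using d(1,2) e(1,2) by metis+
  then have "d = e"
    using square_positions[OF assms(1) b(3,1,2) c(3,1,2) d(3,1,2) assms(6,4)]
      square_positions[OF assms(1) b(3,1,2) c(3,1,2) e(3,1,2) assms(8,4)] assms(4) by (elim disjE conjE; presburger)
  then show ?thesis using d e by simp
qed

lemma lift_child_unique:
  assumes "finite C" "bead_move 2 C' C" "bead_move (2 * p) C' S'" "2 \<le> p"
    and "bead_move (2 * p) C S1" "bead_move 2 S' S1" "bead_move (2 * p) C S2" "bead_move 2 S' S2"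
  shows "S1 = S2"
proof -
  obtain b where b: "b \<notin> C" "b + 2 \<in> C" "C' = insert b (C - {b + 2})"
    using assms(2) by (auto simp: bead_move_iff_holes holes_def drop_bead_def)
  obtain d where d: "d \<in> C'" "d + 2 * p \<notin> C'" "S' = insert (d + 2 * p) (C' - {d})"
    using assms(3) by (auto simp: bead_move_def)
  obtain c where c: "c \<in> C" "c + 2 * p \<notin> C" "S1 = insert (c + 2 * p) (C - {c})"
    using assms(5) by (auto simp: bead_move_def)
  obtain e where e: "e \<in> C" "e + 2 * p \<notin> C" "S2 = insert (e + 2 * p) (C - {e})"
    using assms(7) by (auto simp: bead_move_def)
  have "c = e"
  proof (rule ccontr)
    assume ne: "c \<noteq> e"
    have "c \<noteq> b" "e \<noteq> b" "c + 2 * p \<noteq> b + 2" "e + 2 * p \<noteq> b + 2" using b c e by metis+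
    then show False
      using ne assms(4) square_positions[OF assms(1) b(3,1,2) c(3,1,2) d(3,1,2) assms(6,4)]
        square_positions[OF assms(1) b(3,1,2) e(3,1,2) d(3,1,2) assms(8,4)]
      by (elim disjE conjE; presburger)
  qed
  then show ?thesis using c e by simp
qed

section \<open>Hooks and one-dimensional bead sets\<close>

text \<open>For \<open>c < 2 * N\<close> and \<open>2 * N \<le> c + 2 * n\<close> these are the
  beads of a hook with \<open>n\<close> boxes: the parity of \<open>c\<close> selects the component,
  and the leg has length \<open>N - 1 - c div 2\<close>.\<close>

definition hook_beads :: "nat \<Rightarrow> nat \<Rightarrow> nat \<Rightarrow> nat set" where
  "hook_beads N c n = insert (c + 2 * n) ({..<2 * N} - {c})"

lemma odd_beads_0 [simp]: "odd_beads N 0 S \<longleftrightarrow> S = {..<2 * N}"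
  by (auto simp: odd_beads_def)

lemma bead_move_vacuum_iff:
  "bead_move (2 * n) {..<2 * N} S \<longleftrightarrow> (\<exists>c. c < 2 * N \<and> 2 * N \<le> c + 2 * n \<and> S = hook_beads N c n)"
  by (auto simp: bead_move_def hook_beads_def not_less)

lemma odd_beads_power_two_iff:
  "odd_beads N (2 ^ k) S \<longleftrightarrow> (\<exists>c. c < 2 * N \<and> 2 * N \<le> c + 2 * 2 ^ k \<and> S = hook_beads N c (2 ^ k))"
  using odd_beads_core_iff[of 0 k N S] by (simp add: bead_move_vacuum_iff)

lemma hook_beads_inj:
  assumes "c < 2 * N" "2 * N \<le> c + 2 * n" "c' < 2 * N" "2 * N \<le> c' + 2 * n'"
    and "hook_beads N c n = hook_beads N c' n'"
  shows "c = c'" "n = n'"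
proof -
  have "{..<2 * N} - hook_beads N c n = {c}" "{..<2 * N} - hook_beads N c' n' = {c'}"
    using assms(1-4) by (auto simp: hook_beads_def)
  then show c: "c = c'" using assms(5) by (metis singleton_inject)
  have "hook_beads N c n - {..<2 * N} = {c + 2 * n}" "hook_beads N c' n' - {..<2 * N} = {c' + 2 * n'}"
    using assms(1-4) by (auto simp: hook_beads_def)
  then have "c + 2 * n = c' + 2 * n'" using assms(5) by (metis singleton_inject)
  then show "n = n'" using c by simp
qed

lemma hook_beads_arm:
  assumes "c < 2 * N" "2 * N \<le> c + 2 * n"
  shows "bead_move 2 (hook_beads N c n) (hook_beads N c (Suc n))"
  unfolding bead_move_def hook_beads_def using assms by (intro exI[of _ "c + 2 * n"]) auto

lemma hook_beads_leg:
  assumes "c + 2 < 2 * N" "2 * N \<le> c + 2 * Suc n"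
  shows "bead_move 2 (hook_beads N (c + 2) n) (hook_beads N c (Suc n))"
proof -
  have "c \<in> hook_beads N (c + 2) n" "c + 2 \<notin> hook_beads N (c + 2) n"
    "hook_beads N c (Suc n) = insert (c + 2) (hook_beads N (c + 2) n - {c})"
    using assms by (auto simp: hook_beads_def)
  then show ?thesis unfolding bead_move_def by blast
qed

lemma holes_hook_beads:
  assumes "c < 2 * N" "2 * N \<le> c + 2 * Suc n"
  shows "holes 2 (hook_beads N c (Suc n)) \<subseteq> {c, c + 2 * n}"
  using assms by (auto simp: holes_def hook_beads_def)

text \<open>The removable boxes are the end of the arm (the raised bead drops) and the end of the
  leg (the bead at \<open>c + 2\<close> fills the gap). The last alternative is the single box, for
  which both coincide.\<close>

lemma bead_move_hook_beads:
  assumes "c < 2 * N" "2 * N \<le> c + 2 * Suc n" "bead_move 2 S (hook_beads N c (Suc n))"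
  shows "(S = hook_beads N c n \<and> 2 * N \<le> c + 2 * n) \<or> (S = hook_beads N (c + 2) n \<and> c + 2 < 2 * N)
    \<or> (n = 0 \<and> S = {..<2 * N})"
proof -
  obtain x where x: "x \<notin> hook_beads N c (Suc n)" "x + 2 \<in> hook_beads N c (Suc n)"
    "S = insert x (hook_beads N c (Suc n) - {x + 2})"
    using assms(3) by (auto simp: bead_move_iff_holes holes_def drop_bead_def)
  then have "x = c \<or> x = c + 2 * n" using holes_hook_beads[OF assms(1,2)] by (auto simp: holes_def)
  then consider "n = 0" "x = c" | "n > 0" "x = c" | "n > 0" "x = c + 2 * n"
    by (cases "n = 0") auto
  then show ?thesis
  proof cases
    case 1
    then have "S = {..<2 * N}" unfolding x(3) using assms by (auto simp: hook_beads_def)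
    then show ?thesis using 1 by simp
  next
    case 2
    then have "c + 2 < 2 * N" using x(2) by (auto simp: hook_beads_def)
    moreover have "S = hook_beads N (c + 2) n" unfolding x(3) using 2 assms calculation
      by (auto simp: hook_beads_def)
    ultimately show ?thesis by simp
  next
    case 3
    then have "2 * N \<le> c + 2 * n" using x(1) by (auto simp: hook_beads_def)
    moreover have "S = hook_beads N c n" unfolding x(3) using 3 assms calculation
      by (auto simp: hook_beads_def)
    ultimately show ?thesis by simp
  qed
qed

lemma bead_move_onto_hook_beads:
  assumes "c < 2 * N" "2 * N \<le> c + 2 * n" "bead_move 2 (hook_beads N c n) (hook_beads N d (Suc n))"
    "d < 2 * N" "2 * N \<le> d + 2 * Suc n" "0 < n"
  shows "d = c \<or> d + 2 = c"
  using bead_move_hook_beads[OF assms(4,5,3)] hook_beads_inj[of c N n d n]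
    hook_beads_inj[of c N n "d + 2" n] assms by auto

lemma odd_beads_parent_exists:
  assumes "odd_beads N (Suc n) S"
  shows "\<exists>S'. bead_move 2 S' S \<and> odd_beads N n S'"
proof -
  obtain c where "c \<in> holes 2 S" "odd (paths N n (drop_bead 2 S c))"
    using assms odd_sum_nat_ex[of "\<lambda>c. paths N n (drop_bead 2 S c)" "holes 2 S"]
    by (auto simp: odd_beads_def paths_Suc)
  then show ?thesis using assms
    by (auto simp: odd_beads_def bead_move_iff_holes intro!: exI[of _ "drop_bead 2 S c"])
qed

text \<open>Two odd parents would use up both removable boxes of the hook, making its path count a
  sum of two odd numbers.\<close>

lemma odd_beads_hook_parent_unique:
  assumes "odd_beads N (Suc n) S" "S = hook_beads N c (Suc n)" "c < 2 * N" "2 * N \<le> c + 2 * Suc n"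
    and "bead_move 2 S1 S" "odd_beads N n S1" "bead_move 2 S2 S" "odd_beads N n S2"
  shows "S1 = S2"
proof (rule ccontr)
  assume ne: "S1 \<noteq> S2"
  obtain x where x: "x \<in> holes 2 S" "S1 = drop_bead 2 S x" using assms(5) by (auto simp: bead_move_iff_holes)
  obtain y where y: "y \<in> holes 2 S" "S2 = drop_bead 2 S y" using assms(7) by (auto simp: bead_move_iff_holes)
  have "x \<noteq> y" using ne x y by auto
  then have "holes 2 S = {x, y}" using holes_hook_beads[OF assms(3,4)] x(1) y(1) assms(2) by auto
  then have "paths N (Suc n) S = paths N n S1 + paths N n S2"
    using x y \<open>x \<noteq> y\<close> by (simp add: paths_Suc)
  then show False using assms(1,6,8) by (simp add: odd_beads_def)
qed

lemma odd_beads_closed: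
  assumes "odd_beads N m C" "m < p" "x + 2 * p \<in> C"
  shows "x \<in> C"
  using beads_closed[OF odd_beads_finite[OF assms(1)] odd_beads_card[OF assms(1)] _ assms(3)]
    odd_beads_sum[OF assms(1)] assms(2) by simp

lemma odd_beads_bead_move_unique:
  assumes "odd_beads N (p + m) S" "m < p" "bead_move (2 * p) C S" "bead_move (2 * p) C' S"
  shows "C = C'"
  by (rule bead_move_unique[OF odd_beads_finite[OF assms(1)] odd_beads_card[OF assms(1)] _ assms(3,4)])
    (use odd_beads_sum[OF assms(1)] assms(2) in simp)

lemma odd_beads_core_parent:
  assumes "odd_beads N m' C" "m' < p" "odd_beads N (p + m) S'" "m < p" "2 \<le> p"
    and "bead_move (2 * p) C S" "bead_move 2 S' S" "bead_move (2 * p) C' S'"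
  shows "bead_move 2 C' C"
  using core_parent[OF odd_beads_closed[OF assms(1,2)] assms(6-8)
      odd_beads_bead_move_unique[OF assms(3,4) _ assms(8)] assms(5)] .

lemma odd_beads_lift_parent:
  assumes "odd_beads N m C" "m < p" "2 \<le> p" "bead_move 2 C' C" "bead_move (2 * p) C S"
  shows "\<exists>!S'. bead_move (2 * p) C' S' \<and> bead_move 2 S' S"
  using lift_parent_exists[OF odd_beads_closed[OF assms(1,2)] assms(4,5,3)]
    lift_parent_unique[OF odd_beads_finite[OF assms(1)] assms(4,5,3)] by blast

lemma odd_beads_lift_child:
  assumes "odd_beads N m C'" "m < p" "2 \<le> p" "p + m < N" "bead_move 2 C' C" "bead_move (2 * p) C' S'"
  shows "\<exists>!S. bead_move (2 * p) C S \<and> bead_move 2 S' S"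
proof -
  have fin: "finite C" using odd_beads_finite[OF assms(1)] bead_move_finite[OF assms(5)] by simp
  have "{..<2 * p + 2} \<subseteq> C'" using odd_beads_low[OF assms(1)] assms(4) by auto
  then show ?thesis
    using lift_child_exists[OF odd_beads_closed[OF assms(1,2)] _ assms(5,6,3)]
      lift_child_unique[OF fin assms(5,6,3)] by blast
qed

theorem odd_beads_parent_unique:
  assumes "odd_beads N n S" "0 < n" "bead_move 2 S1 S" "odd_beads N (n - 1) S1"
    "bead_move 2 S2 S" "odd_beads N (n - 1) S2"
  shows "S1 = S2"
  using assms
proof (induction n arbitrary: S S1 S2 rule: less_induct)
  case (less n)
  obtain k where k: "2 ^ k \<le> n" "n < 2 ^ Suc k" using ex_power_ivl1[of 2 n] less.prems(2) by auto
  define p where "p = (2 ^ k :: nat)"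
  obtain m where m: "n = p + m" "m < p" using k that[of "n - p"] by (auto simp: p_def)
  show ?case
  \<comment> \<open>For \<open>m = 0\<close> the parents have rank below \<open>2 ^ k\<close> and
    hence no core at this level; parity on the hook decides. Otherwise the cores of both parents are
    odd parents of the core of \<open>S\<close>, which has smaller rank.\<close>
  proof (cases "m = 0")
    case True
    then obtain j where j: "n = Suc j" "Suc j = 2 ^ k" using m by (cases n) (auto simp: p_def)
    then obtain c where "c < 2 * N" "2 * N \<le> c + 2 * Suc j" "S = hook_beads N c (Suc j)"
      using odd_beads_power_two_iff[of N k S] less.prems(1) by auto
    then show ?thesis using odd_beads_hook_parent_unique[of N j S c S1 S2] less.prems j
      by (metis diff_Suc_1)
  next
    case False
    then have p2: "2 \<le> p" and m': "n - 1 = p + (m - 1)" "m - 1 < p" using m by auto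
    obtain C where C: "bead_move (2 * p) C S" "odd_beads N m C"
      using less.prems(1) m odd_beads_core_iff[of m k N S] by (auto simp: p_def)
    obtain C1 where C1: "bead_move (2 * p) C1 S1" "odd_beads N (m - 1) C1"
      using less.prems(4) m' odd_beads_core_iff[of "m - 1" k N S1] by (auto simp: p_def)
    obtain C2 where C2: "bead_move (2 * p) C2 S2" "odd_beads N (m - 1) C2"
      using less.prems(6) m' odd_beads_core_iff[of "m - 1" k N S2] by (auto simp: p_def)
    have o: "odd_beads N (p + (m - 1)) S1" "odd_beads N (p + (m - 1)) S2" using less.prems m' by auto
    have m1: "bead_move 2 C1 C"
      using odd_beads_core_parent[OF C(2) m(2) o(1) m'(2) p2 C(1) less.prems(3) C1(1)] .
    have m2: "bead_move 2 C2 C"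
      using odd_beads_core_parent[OF C(2) m(2) o(2) m'(2) p2 C(1) less.prems(5) C2(1)] .
    have "C1 = C2" using less.IH[OF _ C(2) _ m1 C1(2) m2 C2(2)] False m(1) p2 by simp
    then show ?thesis
      using odd_beads_lift_parent[OF C(2) m(2) p2 m1 C(1)] C1(1) C2(1) less.prems(3,5) by blast
  qed
qed

text \<open>A bead set of size \<open>2 * N\<close> comes from a bipartition iff half of its beads are even.\<close>

definition balanced :: "nat \<Rightarrow> nat set \<Rightarrow> bool" where
  "balanced N S \<longleftrightarrow> finite S \<and> card {x\<in>S. even x} = N \<and> card {x\<in>S. odd x} = N"

lemma bead_move_balanced:
  assumes "bead_move (2 * r) C S"
  shows "balanced N C \<longleftrightarrow> balanced N S"
proof -
  obtain c where c: "c \<in> C" "c + 2 * r \<notin> C" "S = insert (c + 2 * r) (C - {c})"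
    using assms by (auto simp: bead_move_def)
  have "card {x\<in>S. P x} = card {x\<in>C. P x}" if fin: "finite C" and P: "P (c + 2 * r) = P c" for P
  proof (cases "P c")
    case True
    then have "{x\<in>S. P x} = insert (c + 2 * r) ({x\<in>C. P x} - {c})" using c P by auto
    then show ?thesis using c True fin card_Suc_Diff1[of "{x\<in>C. P x}" c] by simp
  next
    case False
    then have "{x\<in>S. P x} = {x\<in>C. P x}" using c P by auto
    then show ?thesis by simp
  qed
  from this[of even] this[of odd] show ?thesis
    using bead_move_finite[OF assms] by (auto simp: balanced_def)
qed

lemma balanced_card:
  assumes "balanced N S"
  shows "card S = 2 * N"
proof -
  have "S = {x\<in>S. even x} \<union> {x\<in>S. odd x}" by auto
  then have "card S = card {x\<in>S. even x} + card {x\<in>S. odd x}"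
    using assms card_Un_disjoint[of "{x\<in>S. even x}" "{x\<in>S. odd x}"] by (auto simp: balanced_def)
  then show ?thesis using assms by (simp add: balanced_def)
qed

lemma card_even_odd_lessThan:
  "card {x. x < 2 * N \<and> even x} = N" "card {x. x < 2 * N \<and> odd x} = (N::nat)"
proof -
  have "{x. x < 2 * N \<and> even x} = (\<lambda>i. 2 * i) ` {..<N}" by (auto elim!: evenE)
  then show "card {x. x < 2 * N \<and> even x} = N" by (simp add: card_image inj_on_def)
  have "{x. x < 2 * N \<and> odd x} = (\<lambda>i. 2 * i + 1) ` {..<N}" by (auto elim!: oddE)
  then show "card {x. x < 2 * N \<and> odd x} = (N::nat)" by (simp add: card_image inj_on_def)
qed

lemma balanced_vacuum: "balanced N {..<2 * N}"
  using card_even_odd_lessThan[of N] by (simp add: balanced_def)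

text \<open>Without holes each parity class is closed downwards; having \<open>N\<close> elements,
  it is an initial segment of its class.\<close>

lemma balanced_eq_vacuum:
  assumes "balanced N S" "holes 2 S = {}"
  shows "S = {..<2 * N}"
proof -
  have down: "y \<in> S" if xy: "x \<in> S" "y \<le> x" "even (x - y)" for x y
  proof -
    obtain i where "x - y = 2 * i" using xy(3) by (rule evenE)
    then have "x = y + 2 * i" using xy(2) by simp
    moreover have "y + 2 * i \<in> S \<Longrightarrow> y \<in> S" for i
    proof (induction i)
      case (Suc i)
      then have "y + 2 * i + 2 \<in> S" by simp
      then show ?case using Suc.IH assms(2) by (auto simp: holes_def)
    qed simp
    ultimately show ?thesis using xy(1) by simp
  qed
  have "{..<2 * N} \<subseteq> S"
  proof
    fix y assume y: "y \<in> {..<2 * N}"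
    show "y \<in> S"
    proof (rule ccontr)
      assume n: "y \<notin> S"
      let ?E = "{x\<in>S. even x = even y}"
      have lt: "x < y" if "x \<in> ?E" for x
      proof (rule ccontr)
        assume "\<not> x < y"
        then show False using down[of x y] n that by auto
      qed
      then have sub: "?E \<subseteq> {x. x < 2 * N \<and> even x = even y} - {y}" using y by fastforce
      have "card ?E \<le> card ({x. x < 2 * N \<and> even x = even y} - {y})" by (rule card_mono[OF _ sub]) simp
      also have "\<dots> < card {x. x < 2 * N \<and> even x = even y}"
        using y by (intro card_Diff1_less) auto
      also have "\<dots> = N" using card_even_odd_lessThan[of N] by (cases "even y") auto
      also have "\<dots> = card ?E" using assms(1) by (cases "even y") (auto simp: balanced_def)
      finally show False by simp
    qed
  qed
  moreover have "finite S" using assms(1) by (simp add: balanced_def)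
  ultimately show ?thesis using balanced_card[OF assms(1)]
    by (metis card_lessThan card_subset_eq)
qed

text \<open>A balanced set other than the vacuum has a hole, so the descent never gets stuck.
  Positivity of every summand is what turns a path count of 1 into a unique hole.\<close>

lemma paths_pos:
  assumes "balanced N S" "\<Sum>S = \<Sum>{..<2 * N} + 2 * n"
  shows "0 < paths N n S"
  using assms
proof (induction n arbitrary: S)
  case 0
  have fin: "finite S" using 0 by (simp add: balanced_def)
  have "holes 2 S = {}"
  proof (rule ccontr)
    assume "holes 2 S \<noteq> {}"
    then obtain c where "bead_move 2 (drop_bead 2 S c) S" by (auto simp: bead_move_iff_holes)
    from bead_move_sum_ge[OF fin this balanced_card[OF 0(1)]] 0 show False by simp
  qed
  then show ?case using balanced_eq_vacuum[OF 0(1)] by simp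
next
  case (Suc n)
  have fin: "finite S" using Suc by (simp add: balanced_def)
  have "holes 2 S \<noteq> {}" using balanced_eq_vacuum[OF Suc.prems(1)] Suc.prems(2) by auto
  then obtain c where c: "c \<in> holes 2 S" by auto
  then have mv: "bead_move (2 * 1) (drop_bead 2 S c) S" by (auto simp: bead_move_iff_holes)
  have "0 < paths N n (drop_bead 2 S c)"
  proof (rule Suc.IH)
    show "balanced N (drop_bead 2 S c)" using bead_move_balanced[OF mv] Suc.prems by simp
    show "\<Sum>(drop_bead 2 S c) = \<Sum>{..<2 * N} + 2 * n"
      using bead_move_card_sum(2)[OF mv fin] Suc.prems by simp
  qed
  then show ?case using c fin by (auto simp: paths_Suc sum_pos2)
qed

lemma paths_pos_balanced: "0 < paths N n S \<Longrightarrow> finite S \<Longrightarrow> balanced N S"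
proof (induction n arbitrary: S)
  case 0
  then show ?case using balanced_vacuum by (simp split: if_splits)
next
  case (Suc n)
  then obtain c where c: "c \<in> holes 2 S" "0 < paths N n (drop_bead 2 S c)"
    by (metis gr0I paths_Suc sum.neutral less_irrefl)
  then have mv: "bead_move (2 * 1) (drop_bead 2 S c) S" by (auto simp: bead_move_iff_holes)
  show ?case using bead_move_balanced[OF mv, of N] Suc.IH[OF c(2)] Suc.prems(2) by simp
qed

section \<open>Bead sets with exactly one path\<close>

lemma paths_eq_1_parent:
  assumes "finite S" "paths N (Suc n) S = 1"
  shows "\<exists>S'. bead_move 2 S' S \<and> paths N n S' = 1 \<and> (\<forall>T. bead_move 2 T S \<longrightarrow> T = S')"
proof -
  have pos: "0 < paths N n (drop_bead 2 S c)" if "c \<in> holes 2 S" for c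
  proof -
    have mv: "bead_move (2 * 1) (drop_bead 2 S c) S" using that by (auto simp: bead_move_iff_holes)
    show ?thesis
    proof (rule paths_pos)
      show "balanced N (drop_bead 2 S c)"
        using bead_move_balanced[OF mv] paths_pos_balanced[of N "Suc n" S] assms by simp
      show "\<Sum>(drop_bead 2 S c) = \<Sum>{..<2 * N} + 2 * n"
        using bead_move_card_sum(2)[OF mv assms(1)] paths_card_sum[OF assms(1), of N "Suc n"] assms by simp
    qed
  qed
  have "card (holes 2 S) \<le> (\<Sum>c\<in>holes 2 S. paths N n (drop_bead 2 S c))"
    using sum_mono[of "holes 2 S" "\<lambda>_. 1::nat" "\<lambda>c. paths N n (drop_bead 2 S c)"] pos
    by (simp add: Suc_leI)
  then have "card (holes 2 S) \<le> 1" using assms by (simp add: paths_Suc)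
  moreover have "holes 2 S \<noteq> {}" using assms by (auto simp: paths_Suc)
  ultimately obtain c where "holes 2 S = {c}"
    using assms(1) by (metis card_0_eq card_1_singletonE finite_holes le_Suc_eq le_zero_eq One_nat_def)
  then show ?thesis using assms(2)
    by (intro exI[of _ "drop_bead 2 S c"]) (auto simp: bead_move_iff_holes paths_Suc)
qed

text \<open>The hooks that are a single row or a single column. In the row, \<open>c\<close> is the
  highest vacuum bead of its parity class; in the column, it lands on the first free position of
  that class.\<close>

definition straight :: "nat \<Rightarrow> nat \<Rightarrow> nat \<Rightarrow> bool" where
  "straight N c n \<longleftrightarrow> c < 2 * N \<and> 2 * N \<le> c + 2 * n \<and> (2 * N \<le> c + 2 \<or> c + 2 * n \<le> 2 * N + 1)"

lemma paths_eq_1_imp_straight: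
  assumes "finite S" "paths N n S = 1" "0 < n"
  shows "\<exists>c. straight N c n \<and> S = hook_beads N c n"
  using assms
proof (induction n arbitrary: S)
  case (Suc n)
  obtain S' where S': "bead_move 2 S' S" "paths N n S' = 1" "\<And>T. bead_move 2 T S \<Longrightarrow> T = S'"
    using paths_eq_1_parent[OF Suc.prems(1,2)] by blast
  show ?case
  proof (cases "n = 0")
    case True
    then have "S' = {..<2 * N}" using S'(2) by (simp add: of_bool_def split: if_splits)
    then have "bead_move (2 * 1) {..<2 * N} S" using S'(1) by simp
    then show ?thesis unfolding bead_move_vacuum_iff using True by (auto simp: straight_def)
  next
    case False
    have fin: "finite S'" using bead_move_finite[OF S'(1)] Suc.prems(1) by simp
    obtain c where c: "straight N c n" "S' = hook_beads N c n"
      using Suc.IH[OF fin S'(2)] False Suc.prems by auto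
    have c': "c < 2 * N" "2 * N \<le> c + 2 * n" using c by (auto simp: straight_def)
    have uniq: "x = y" if "x \<in> holes 2 S" "y \<in> holes 2 S" for x y
    proof -
      have "drop_bead 2 S x = S'" "drop_bead 2 S y = S'"
        using S'(3) that by (auto simp: bead_move_iff_holes)
      then show ?thesis using inj_onD[OF inj_on_drop_bead _ that] by simp
    qed
    obtain y where y: "y \<in> S'" "y + 2 \<notin> S'" "S = insert (y + 2) (S' - {y})"
      using S'(1) by (auto simp: bead_move_def)
    have y1: "y \<in> holes 2 S" using y by (auto simp: holes_def)
    \<comment> \<open>The last box lengthens the arm, lengthens the leg, or starts the other
      component. Whenever the result is not straight, a second box is removable, against the
      uniqueness of the hole.\<close>
    consider "y = c + 2 * n" | "y + 2 = c" "y \<noteq> c + 2 * n" | "y + 2 \<noteq> c" "y \<noteq> c + 2 * n" by blast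
    then show ?thesis
    proof cases
      case 1
      have S: "S = hook_beads N c (Suc n)" unfolding y(3) c(2) using 1 c' by (auto simp: hook_beads_def)
      have "\<not> c + 2 < 2 * N"
      proof
        assume "c + 2 < 2 * N"
        then have "c \<in> holes 2 S" unfolding S using c' by (auto simp: holes_def hook_beads_def)
        then have "y = c" using uniq[OF y1] by blast
        then show False using 1 False by simp
      qed
      then show ?thesis using S c' by (auto simp: straight_def)
    next
      case 2
      have S: "S = hook_beads N y (Suc n)" unfolding y(3) c(2) using 2 c' by (auto simp: hook_beads_def)
      have "\<not> 2 * N \<le> y + 2 * n"
      proof
        assume "2 * N \<le> y + 2 * n"
        then have "y + 2 * n \<in> holes 2 S" unfolding S using c' 2 by (auto simp: holes_def hook_beads_def)
        then have "y = y + 2 * n" using uniq[OF y1] by blast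
        then show False using False by simp
      qed
      then have "straight N y (Suc n)" using c' 2 by (auto simp: straight_def)
      then show ?thesis using S by blast
    next
      case 3
      have yN: "y < 2 * N" "2 * N \<le> y + 2" "y \<noteq> c" "y + 2 \<noteq> c + 2 * n"
        using y 3 c' unfolding c(2) by (auto simp: hook_beads_def)
      have S: "S = insert (y + 2) (insert (c + 2 * n) ({..<2 * N} - {c} - {y}))"
        unfolding y(3) c(2) using 3 by (auto simp: hook_beads_def)
      show ?thesis
      proof (cases "2 * N \<le> c + 2")
        case True
        define x where "x = c + 2 * n - 2"
        have x: "x + 2 = c + 2 * n" using False by (simp add: x_def)
        have "c + 1 = y \<or> y + 1 = c" using c'(1) True yN(1,2,3) by linarith
        then have "x \<noteq> y + 2" using x by presburger
        then have "x \<in> holes 2 S" unfolding S holes_def using x c' True yN by auto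
        then have "x = y" using uniq[OF y1] by simp
        then show ?thesis using x 3 yN by simp
      next
        case F: False
        then have "c + 2 * n \<le> 2 * N + 1" using c by (auto simp: straight_def)
        then have "y + 2 + 1 = c + 2 * n \<or> y + 2 = c + 2 * n + 1" using yN c'(2) by linarith
        then have "c + 2 \<noteq> y" by presburger
        then have "c \<in> holes 2 S" unfolding S holes_def using c' F yN by auto
        then show ?thesis using uniq[OF y1] yN by simp
      qed
    qed
  qed
qed simp

lemma paths_straight:
  assumes "straight N c n" "0 < n"
  shows "paths N n (hook_beads N c n) = 1"
  using assms
proof (induction n arbitrary: c)
  case (Suc n)
  have c: "c < 2 * N" "2 * N \<le> c + 2 * Suc n" using Suc.prems by (auto simp: straight_def)
  let ?S = "hook_beads N c (Suc n)"
  show ?case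
  proof (cases "n = 0")
    case True
    have "holes 2 ?S = {c}" "drop_bead 2 ?S c = {..<2 * N}"
      using True c by (auto simp: holes_def hook_beads_def drop_bead_def)
    then show ?thesis using True by (simp add: paths_Suc)
  next
    case False
    show ?thesis
    proof (cases "2 * N \<le> c + 2")
      case True
      have "holes 2 ?S = {c + 2 * n}" "drop_bead 2 ?S (c + 2 * n) = hook_beads N c n"
        using True False c by (auto simp: holes_def hook_beads_def drop_bead_def)
      moreover have "straight N c n" using True False c by (auto simp: straight_def)
      ultimately show ?thesis using Suc.IH False by (simp add: paths_Suc)
    next
      case F: False
      then have "c + 2 * Suc n \<le> 2 * N + 1" using Suc.prems by (auto simp: straight_def)
      then have "holes 2 ?S = {c}" "drop_bead 2 ?S c = hook_beads N (c + 2) n" "straight N (c + 2) n"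
        using F False c by (auto simp: holes_def hook_beads_def drop_bead_def straight_def)
      then show ?thesis using Suc.IH False by (simp add: paths_Suc)
    qed
  qed
qed simp

section \<open>Partitions and standard tableaux\<close>

text \<open>Extending by 0 makes the removal of a box a change of one value, even when it empties
  the last row; \<open>of_rows\<close> then discards the trailing zeros.\<close>

definition row :: "partition \<Rightarrow> nat \<Rightarrow> nat" where
  "row \<alpha> i = (if i < length \<alpha> then \<alpha> ! i else 0)"

definition of_rows :: "(nat \<Rightarrow> nat) \<Rightarrow> partition" where
  "of_rows r = map r [0..<LEAST n. r n = 0]"

definition corners :: "partition \<Rightarrow> nat set" where
  "corners \<alpha> = {i. row \<alpha> (Suc i) < row \<alpha> i}"

definition remove_box :: "partition \<Rightarrow> nat \<Rightarrow> partition" where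
  "remove_box \<alpha> i = of_rows ((row \<alpha>)(i := row \<alpha> i - 1))"

lemma young_diagram_row: "young_diagram \<alpha> = {(i, j). j < row \<alpha> i}"
  by (auto simp: young_diagram_def row_def split: if_splits)

lemma row_Nil [simp]: "row [] i = 0"
  by (simp add: row_def)

lemma is_partition_Nil [simp]: "is_partition []"
  by (simp add: is_partition_def)

lemma row_eq_0_iff: "is_partition \<alpha> \<Longrightarrow> row \<alpha> i = 0 \<longleftrightarrow> length \<alpha> \<le> i"
  using nth_mem[of i \<alpha>] by (auto simp: row_def is_partition_def split: if_splits)

lemma row_antimono: "is_partition \<alpha> \<Longrightarrow> i \<le> j \<Longrightarrow> row \<alpha> j \<le> row \<alpha> i"
  by (cases "i = j") (auto simp: row_def is_partition_def sorted_wrt_iff_nth_less)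

lemma partition_eqI:
  assumes "is_partition \<alpha>" "is_partition \<beta>" "\<And>i. row \<alpha> i = row \<beta> i"
  shows "\<alpha> = \<beta>"
proof (rule nth_equalityI)
  show l: "length \<alpha> = length \<beta>"
    using row_eq_0_iff[OF assms(1)] row_eq_0_iff[OF assms(2)] assms(3) by (metis order_antisym order_refl)
  show "\<alpha> ! i = \<beta> ! i" if "i < length \<alpha>" for i
    using assms(3)[of i] that l by (simp add: row_def)
qed

lemma of_rows:
  assumes "\<And>i. r (Suc i) \<le> r i" "r N = 0"
  shows "is_partition (of_rows r)" "row (of_rows r) = r" "length (of_rows r) \<le> N"
proof -
  let ?L = "LEAST n. r n = 0"
  have anti: "r j \<le> r i" if "i \<le> j" for i j
    using lift_Suc_antimono_le[of r, OF assms(1) that] .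
  have L: "r ?L = 0" using assms(2) by (rule LeastI)
  have pos: "0 < r i" if "i < ?L" for i using not_less_Least[OF that] by simp
  show "is_partition (of_rows r)"
    using anti pos by (auto simp: is_partition_def of_rows_def sorted_wrt_iff_nth_less)
  show "row (of_rows r) = r"
  proof
    fix i
    show "row (of_rows r) i = r i" using anti[of ?L i] L by (auto simp: row_def of_rows_def)
  qed
  show "length (of_rows r) \<le> N" using assms(2) by (simp add: of_rows_def Least_le)
qed

lemma remove_box:
  assumes "is_partition \<alpha>" "i \<in> corners \<alpha>"
  shows "is_partition (remove_box \<alpha> i)" "row (remove_box \<alpha> i) = (row \<alpha>)(i := row \<alpha> i - 1)"
    "length (remove_box \<alpha> i) \<le> length \<alpha>"
proof -
  let ?r = "(row \<alpha>)(i := row \<alpha> i - 1)"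
  have "?r (Suc j) \<le> ?r j" for j
    using assms row_antimono[OF assms(1), of j "Suc j"] by (auto simp: corners_def)
  moreover have "?r (length \<alpha>) = 0" by (simp add: row_def)
  ultimately show "is_partition (remove_box \<alpha> i)" "row (remove_box \<alpha> i) = ?r"
    "length (remove_box \<alpha> i) \<le> length \<alpha>"
    unfolding remove_box_def by (rule of_rows)+
qed

lemma corners_length: "i \<in> corners \<alpha> \<Longrightarrow> i < length \<alpha>"
  by (auto simp: corners_def row_def split: if_splits)

lemma finite_corners [simp]: "finite (corners \<alpha>)"
  by (rule finite_subset[of _ "{..<length \<alpha>}"]) (auto dest: corners_length)

lemma corners_Nil [simp]: "corners [] = {}"
  by (simp add: corners_def)

lemma sum_list_row: "length \<alpha> \<le> N \<Longrightarrow> sum_list \<alpha> = (\<Sum>i<N. row \<alpha> i)"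
proof -
  assume "length \<alpha> \<le> N"
  then have "(\<Sum>i<N. row \<alpha> i) = (\<Sum>i<length \<alpha>. row \<alpha> i)"
    by (intro sum.mono_neutral_right) (auto simp: row_def)
  then show ?thesis by (simp add: sum_list_sum_nth row_def atLeast0LessThan)
qed

lemma sum_list_remove_box:
  assumes "is_partition \<alpha>" "i \<in> corners \<alpha>"
  shows "sum_list \<alpha> = Suc (sum_list (remove_box \<alpha> i))"
proof -
  let ?N = "length \<alpha>"
  have i: "i < ?N" using corners_length assms(2) .
  have "0 < row \<alpha> i" using assms(2) by (auto simp: corners_def)
  then have "(\<Sum>j<?N. row \<alpha> j) = Suc (\<Sum>j<?N. ((row \<alpha>)(i := row \<alpha> i - 1)) j)"
    using i by (simp add: sum.remove[of "{..<?N}" i])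
  then show ?thesis using sum_list_row[of \<alpha> ?N] sum_list_row[of "remove_box \<alpha> i" ?N] remove_box[OF assms]
    by simp
qed

lemma length_le_sum_list: "is_partition \<alpha> \<Longrightarrow> length \<alpha> \<le> sum_list \<alpha>"
  by (induction \<alpha>) (auto simp: is_partition_def Suc_le_eq)

lemma young_diagram_remove_box:
  assumes "is_partition \<alpha>" "i \<in> corners \<alpha>"
  shows "young_diagram (remove_box \<alpha> i) = young_diagram \<alpha> - {(i, row \<alpha> i - 1)}"
    "(i, row \<alpha> i - 1) \<in> young_diagram \<alpha>"
  using assms(2) by (auto simp: young_diagram_row remove_box[OF assms] corners_def split: if_splits)

text \<open>The lowest row in which \<open>\<gamma>\<close> is strictly shorter than
  \<open>\<alpha>\<close> ends in a corner of \<open>\<alpha>\<close>: in the next row both agree,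
  and the rows of \<open>\<gamma>\<close> decrease.\<close>

lemma young_diagram_subset_remove_box:
  assumes "is_partition \<alpha>" "is_partition \<gamma>" "young_diagram \<gamma> \<subseteq> young_diagram \<alpha>" "\<gamma> \<noteq> \<alpha>"
  shows "\<exists>i\<in>corners \<alpha>. young_diagram \<gamma> \<subseteq> young_diagram (remove_box \<alpha> i)"
proof -
  have le: "row \<gamma> i \<le> row \<alpha> i" for i
  proof (rule ccontr)
    assume "\<not> row \<gamma> i \<le> row \<alpha> i"
    then have "(i, row \<alpha> i) \<in> young_diagram \<gamma>" by (simp add: young_diagram_row)
    then show False using assms(3) by (auto simp: young_diagram_row)
  qed
  let ?I = "{i. row \<gamma> i < row \<alpha> i}"
  have "?I \<noteq> {}" using partition_eqI[OF assms(2,1)] le assms(4) by (auto simp: order.order_iff_strict)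
  moreover have fin: "finite ?I"
    by (rule finite_subset[of _ "{..<length \<alpha>}"]) (auto simp: row_def split: if_splits)
  ultimately have M: "Max ?I \<in> ?I" by (intro Max_in) auto
  have "Suc (Max ?I) \<notin> ?I" using Max_ge[OF fin] by (meson Suc_n_not_le_n)
  then have "row \<alpha> (Suc (Max ?I)) = row \<gamma> (Suc (Max ?I))" using le by (metis (no_types, lifting) mem_Collect_eq le_neq_implies_less)
  also have "\<dots> \<le> row \<gamma> (Max ?I)" using row_antimono[OF assms(2)] by simp
  finally have c: "Max ?I \<in> corners \<alpha>" using M by (auto simp: corners_def)
  moreover have "young_diagram \<gamma> \<subseteq> young_diagram (remove_box \<alpha> (Max ?I))"
    unfolding young_diagram_remove_box(1)[OF assms(1) c] using assms(3) M by (auto simp: young_diagram_row)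
  ultimately show ?thesis by blast
qed

lemma finite_young_diagram: "finite (young_diagram \<alpha>)"
proof -
  have "young_diagram \<alpha> = Sigma {..<length \<alpha>} (\<lambda>i. {..<\<alpha> ! i})" by (auto simp: young_diagram_def)
  then show ?thesis by simp
qed

lemma finite_standard_young_tableaux: "finite (standard_young_tableaux \<alpha>)"
proof (rule finite_subset)
  show "finite {T. \<forall>c. (c \<in> young_diagram \<alpha> \<longrightarrow> T c \<in> {1..sum_list \<alpha>}) \<and> (c \<notin> young_diagram \<alpha> \<longrightarrow> T c = 0)}"
    using finite_young_diagram by (intro finite_set_of_finite_funs) auto
  show "standard_young_tableaux \<alpha> \<subseteq> \<dots>"
    by (auto simp: standard_young_tableaux_def bij_betw_def)
qed

text \<open>Deleting the largest entry is a bijection, with inverse writing it back into the corner.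
  Since tableaux are 0 off the diagram, deletion is an update by 0.\<close>

lemma card_tableaux_corner:
  assumes "is_partition \<alpha>" "i \<in> corners \<alpha>"
  shows "card {T \<in> standard_young_tableaux \<alpha>. T (i, row \<alpha> i - 1) = sum_list \<alpha>} = f_part (remove_box \<alpha> i)"
proof -
  define c where "c = (i, row \<alpha> i - 1)"
  define n where "n = sum_list (remove_box \<alpha> i)"
  let ?D = "young_diagram \<alpha>" and ?D' = "young_diagram (remove_box \<alpha> i)"
  have n: "sum_list \<alpha> = Suc n" using sum_list_remove_box[OF assms] by (simp add: n_def)
  have D: "?D' = ?D - {c}" "c \<in> ?D" using young_diagram_remove_box[OF assms] by (auto simp: c_def)
  have corner: "(fst c, Suc (snd c)) \<notin> ?D" "(Suc (fst c), snd c) \<notin> ?D"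
    using assms(2) by (auto simp: c_def corners_def young_diagram_row)
  have down: "(a, b) \<in> ?D" if "(a, Suc b) \<in> ?D \<or> (Suc a, b) \<in> ?D" for a b
    using that row_antimono[OF assms(1), of a "Suc a"] by (auto simp: young_diagram_row)
  have ins: "{1..Suc n} = {1..n} \<union> {Suc n}" "?D = ?D' \<union> {c}"
    using D(2) unfolding D(1) by auto
  have bij: "bij_betw T ?D {1..Suc n} \<longleftrightarrow> bij_betw T ?D' {1..n}" if "T c = Suc n" for T
    using notIn_Un_bij_betw3[of c ?D' T "{1..n}"] that D unfolding ins by auto
  have cong: "bij_betw (T(c := x)) ?D' A \<longleftrightarrow> bij_betw T ?D' A" for T x A
    using D by (intro bij_betw_cong) auto
  let ?A = "{T \<in> standard_young_tableaux \<alpha>. T c = Suc n}"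
  have "bij_betw (\<lambda>T. T(c := 0)) ?A (standard_young_tableaux (remove_box \<alpha> i))"
  proof (rule bij_betw_byWitness[where f' = "\<lambda>T. T(c := Suc n)"])
    show "\<forall>T\<in>?A. (T(c := 0))(c := Suc n) = T" by auto
    show "\<forall>T\<in>standard_young_tableaux (remove_box \<alpha> i). (T(c := Suc n))(c := 0) = T"
      using D by (auto simp: standard_young_tableaux_def fun_eq_iff)
    show "(\<lambda>T. T(c := 0)) ` ?A \<subseteq> standard_young_tableaux (remove_box \<alpha> i)"
    proof
      fix T' assume "T' \<in> (\<lambda>T. T(c := 0)) ` ?A"
      then obtain T where T: "T \<in> standard_young_tableaux \<alpha>" "T c = Suc n" "T' = T(c := 0)" by auto
      have "bij_betw T' ?D' {1..n}"
        using T bij[of T] n by (simp add: cong standard_young_tableaux_def)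
      moreover have "T' (a, b) < T' (a, Suc b)" if "(a, Suc b) \<in> ?D'" for a b
        using that T D corner by (auto simp: standard_young_tableaux_def)
      moreover have "T' (a, b) < T' (Suc a, b)" if "(Suc a, b) \<in> ?D'" for a b
        using that T D corner by (auto simp: standard_young_tableaux_def)
      ultimately show "T' \<in> standard_young_tableaux (remove_box \<alpha> i)"
        using T D by (auto simp: standard_young_tableaux_def n_def)
    qed
    show "(\<lambda>T. T(c := Suc n)) ` standard_young_tableaux (remove_box \<alpha> i) \<subseteq> ?A"
    proof
      fix T' assume "T' \<in> (\<lambda>T. T(c := Suc n)) ` standard_young_tableaux (remove_box \<alpha> i)"
      then obtain T where T: "T \<in> standard_young_tableaux (remove_box \<alpha> i)" "T' = T(c := Suc n)" by auto
      have bT: "bij_betw T ?D' {1..n}" using T by (simp add: standard_young_tableaux_def n_def)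
      then have le: "T x < Suc n" if "x \<in> ?D'" for x using bij_betw_apply[OF bT that] by simp
      have "T' c = Suc n" using T by simp
      then have "bij_betw T' ?D {1..Suc n}" using bT T(2) cong[of T "Suc n"] by (simp only: bij)
      moreover have "T' (a, b) < T' (a, Suc b)" if "(a, Suc b) \<in> ?D" for a b
      proof (cases "(a, Suc b) = c")
        case True
        then have "(a, b) \<in> ?D'" unfolding D(1) using down[of a b] that by auto
        then show ?thesis using le True T by auto
      next
        case False
        then have "(a, Suc b) \<in> ?D'" "(a, b) \<noteq> c" unfolding D(1) using that corner by auto
        then show ?thesis using T False by (auto simp: standard_young_tableaux_def)
      qed
      moreover have "T' (a, b) < T' (Suc a, b)" if "(Suc a, b) \<in> ?D" for a b
      proof (cases "(Suc a, b) = c")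
        case True
        then have "(a, b) \<in> ?D'" unfolding D(1) using down[of a b] that by auto
        then show ?thesis using le True T by auto
      next
        case False
        then have "(Suc a, b) \<in> ?D'" "(a, b) \<noteq> c" unfolding D(1) using that corner by auto
        then show ?thesis using T False by (auto simp: standard_young_tableaux_def)
      qed
      ultimately show "T' \<in> ?A"
        using T D n by (auto simp: standard_young_tableaux_def)
    qed
  qed
  then show ?thesis using n by (simp add: f_part_def bij_betw_same_card c_def)
qed

text \<open>The branching rule. The largest entry has no neighbour to its right or below, so it sits
  in a corner, and injectivity keeps the classes of different corners apart.\<close>

lemma f_part_rec:
  assumes "is_partition \<alpha>" "\<alpha> \<noteq> []"
  shows "f_part \<alpha> = (\<Sum>i\<in>corners \<alpha>. f_part (remove_box \<alpha> i))"
proof -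
  let ?n = "sum_list \<alpha>" and ?D = "young_diagram \<alpha>"
  let ?c = "\<lambda>i. (i, row \<alpha> i - 1)"
  let ?A = "\<lambda>i. {T \<in> standard_young_tableaux \<alpha>. T (?c i) = ?n}"
  have n: "0 < ?n" using length_le_sum_list[OF assms(1)] assms(2) by (cases \<alpha>) auto
  have cD: "?c i \<in> ?D" if "i \<in> corners \<alpha>" for i using young_diagram_remove_box(2)[OF assms(1) that] .
  have "\<exists>i\<in>corners \<alpha>. T (?c i) = ?n" if T: "T \<in> standard_young_tableaux \<alpha>" for T
  proof -
    have b: "T ` ?D = {1..?n}" using T by (auto simp: standard_young_tableaux_def bij_betw_def)
    then have "?n \<in> T ` ?D" using n by simp
    then obtain i j where ij: "(i, j) \<in> ?D" "T (i, j) = ?n" by auto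
    have le: "T x \<le> ?n" if "x \<in> ?D" for x using b that by auto
    have "(i, Suc j) \<notin> ?D"
    proof
      assume "(i, Suc j) \<in> ?D"
      then show False using T le[of "(i, Suc j)"] ij by (force simp: standard_young_tableaux_def)
    qed
    moreover have "(Suc i, j) \<notin> ?D"
    proof
      assume "(Suc i, j) \<in> ?D"
      then show False using T le[of "(Suc i, j)"] ij by (force simp: standard_young_tableaux_def)
    qed
    ultimately have "j = row \<alpha> i - 1" "i \<in> corners \<alpha>" using ij(1) by (auto simp: young_diagram_row corners_def)
    then show ?thesis using ij by auto
  qed
  then have "standard_young_tableaux \<alpha> = (\<Union>i\<in>corners \<alpha>. ?A i)" by blast
  then have "f_part \<alpha> = card (\<Union>i\<in>corners \<alpha>. ?A i)" by (simp add: f_part_def)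
  also have "\<dots> = (\<Sum>i\<in>corners \<alpha>. card (?A i))"
  proof (rule card_UN_disjoint)
    show "\<forall>i\<in>corners \<alpha>. finite (?A i)" using finite_standard_young_tableaux by simp
    show "\<forall>i\<in>corners \<alpha>. \<forall>j\<in>corners \<alpha>. i \<noteq> j \<longrightarrow> ?A i \<inter> ?A j = {}"
    proof (intro ballI impI)
      fix i j assume ij: "i \<in> corners \<alpha>" "j \<in> corners \<alpha>" "i \<noteq> j"
      have "i = j" if "T \<in> ?A i" "T \<in> ?A j" for T
      proof -
        have "inj_on T ?D" using that by (auto simp: standard_young_tableaux_def bij_betw_def)
        moreover have "T (?c i) = T (?c j)" using that by simp
        ultimately have "?c i = ?c j" using cD[OF ij(1)] cD[OF ij(2)] by (rule inj_onD)
        then show ?thesis by simp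
      qed
      then show "?A i \<inter> ?A j = {}" using ij(3) by blast
    qed
  qed simp
  also have "\<dots> = (\<Sum>i\<in>corners \<alpha>. f_part (remove_box \<alpha> i))"
    using card_tableaux_corner[OF assms(1)] by (intro sum.cong) auto
  finally show ?thesis .
qed

lemma f_part_Nil [simp]: "f_part [] = 1"
proof -
  have "standard_young_tableaux [] = {\<lambda>_. 0}"
    by (auto simp: standard_young_tableaux_def young_diagram_def bij_betw_def)
  then show ?thesis by (simp add: f_part_def)
qed

lemma f_bip_choose: "f_bip (\<alpha>, \<beta>) = (sum_list \<alpha> + sum_list \<beta> choose sum_list \<alpha>) * f_part \<alpha> * f_part \<beta>"
  by (simp add: binomial_fact')

lemma is_partition_sum_list_eq_0: "is_partition \<alpha> \<Longrightarrow> sum_list \<alpha> = 0 \<longleftrightarrow> \<alpha> = []"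
  by (cases \<alpha>) (auto simp: is_partition_def)

text \<open>Pascal's rule splits the binomial coefficient according to the component that loses a
  box; the branching rule then expands that component.\<close>

lemma f_bip_rec:
  assumes p: "is_partition \<alpha>" "is_partition \<beta>" and ne: "(\<alpha>, \<beta>) \<noteq> ([], [])"
  shows "f_bip (\<alpha>, \<beta>) = (\<Sum>i\<in>corners \<alpha>. f_bip (remove_box \<alpha> i, \<beta>)) + (\<Sum>i\<in>corners \<beta>. f_bip (\<alpha>, remove_box \<beta> i))"
proof -
  define a b where "a = sum_list \<alpha>" "b = sum_list \<beta>"
  have l: "(\<Sum>i\<in>corners \<alpha>. f_bip (remove_box \<alpha> i, \<beta>)) = ((a - 1) + b choose (a - 1)) * f_part \<alpha> * f_part \<beta>"
    if "\<alpha> \<noteq> []"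
  proof -
    have "f_bip (remove_box \<alpha> i, \<beta>) = ((a - 1) + b choose (a - 1)) * f_part (remove_box \<alpha> i) * f_part \<beta>"
      if "i \<in> corners \<alpha>" for i
      unfolding f_bip_choose using sum_list_remove_box[OF p(1) that] by (simp add: a_b_def)
    then show ?thesis using f_part_rec[OF p(1) that] by (simp add: sum_distrib_left sum_distrib_right del: f_bip.simps)
  qed
  have r: "(\<Sum>i\<in>corners \<beta>. f_bip (\<alpha>, remove_box \<beta> i)) = (a + (b - 1) choose a) * f_part \<alpha> * f_part \<beta>"
    if "\<beta> \<noteq> []"
  proof -
    have "f_bip (\<alpha>, remove_box \<beta> i) = (a + (b - 1) choose a) * f_part \<alpha> * f_part (remove_box \<beta> i)"
      if "i \<in> corners \<beta>" for i
      unfolding f_bip_choose using sum_list_remove_box[OF p(2) that] by (simp add: a_b_def)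
    then show ?thesis using f_part_rec[OF p(2) that] by (simp add: sum_distrib_left sum_distrib_right del: f_bip.simps)
  qed
  consider "\<alpha> = []" "\<beta> \<noteq> []" | "\<alpha> \<noteq> []" "\<beta> = []" | "\<alpha> \<noteq> []" "\<beta> \<noteq> []" using ne by auto
  then show ?thesis
  proof cases
    case 1
    then show ?thesis using r unfolding f_bip_choose by (simp add: a_b_def)
  next
    case 2
    then show ?thesis using l unfolding f_bip_choose by (simp add: a_b_def)
  next
    case 3
    then obtain a' b' where "a = Suc a'" "b = Suc b'"
      using is_partition_sum_list_eq_0 p by (metis a_b_def not0_implies_Suc)
    then have "a + b choose a = ((a - 1) + b choose (a - 1)) + (a + (b - 1) choose a)" by simp
    then show ?thesis using l r 3 unfolding f_bip_choose by (simp add: a_b_def[symmetric] algebra_simps)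
  qed
qed

section \<open>The covering relation of bipartitions\<close>

definition bip_parents :: "bipartition \<Rightarrow> bipartition set" where
  "bip_parents y = (\<lambda>i. (remove_box (fst y) i, snd y)) ` corners (fst y)
     \<union> (\<lambda>i. (fst y, remove_box (snd y) i)) ` corners (snd y)"

lemma bip_parents:
  assumes "x \<in> bip_parents y" "y \<in> bipartitions"
  shows "x \<in> bipartitions" "bip_rank y = Suc (bip_rank x)"
  using assms by (auto simp: bip_parents_def bipartitions_def remove_box sum_list_remove_box)

lemma bip_le_refl [simp]: "bip_le x x"
  by (cases x) simp

lemma bip_le_parent:
  assumes "x \<in> bipartitions" "y \<in> bipartitions" "bip_less x y"
  shows "\<exists>z\<in>bip_parents y. bip_le x z"
proof -
  obtain \<gamma> \<delta> \<alpha> \<beta> where xy: "x = (\<gamma>, \<delta>)" "y = (\<alpha>, \<beta>)" by (cases x; cases y) auto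
  then have p: "is_partition \<alpha>" "is_partition \<beta>" "is_partition \<gamma>" "is_partition \<delta>"
    and le: "young_diagram \<gamma> \<subseteq> young_diagram \<alpha>" "young_diagram \<delta> \<subseteq> young_diagram \<beta>"
    and "\<gamma> \<noteq> \<alpha> \<or> \<delta> \<noteq> \<beta>"
    using assms by (auto simp: bipartitions_def bip_less_def)
  then consider "\<gamma> \<noteq> \<alpha>" | "\<delta> \<noteq> \<beta>" by blast
  then show ?thesis
  proof cases
    case 1
    then obtain i where "i \<in> corners \<alpha>" "young_diagram \<gamma> \<subseteq> young_diagram (remove_box \<alpha> i)"
      using young_diagram_subset_remove_box[OF p(1,3) le(1)] by blast
    then show ?thesis using le(2)
      by (intro bexI[of _ "(remove_box \<alpha> i, \<beta>)"]) (auto simp: xy bip_parents_def)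
  next
    case 2
    then obtain i where "i \<in> corners \<beta>" "young_diagram \<delta> \<subseteq> young_diagram (remove_box \<beta> i)"
      using young_diagram_subset_remove_box[OF p(2,4) le(2)] by blast
    then show ?thesis using le(1)
      by (intro bexI[of _ "(\<alpha>, remove_box \<beta> i)"]) (auto simp: xy bip_parents_def)
  qed
qed

lemma bip_parents_less:
  assumes "x \<in> bip_parents y" "y \<in> bipartitions"
  shows "bip_less x y"
proof -
  have "bip_le x y"
    using assms young_diagram_remove_box by (force simp: bip_parents_def bipartitions_def)
  moreover have "x \<noteq> y" using bip_parents(2)[OF assms] by auto
  ultimately show ?thesis by (simp add: bip_less_def)
qed

lemma bip_le_rank:
  assumes "x \<in> bipartitions" "y \<in> bipartitions" "bip_le x y"
  shows "bip_rank x \<le> bip_rank y"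
  using assms
proof (induction "bip_rank y" arbitrary: y rule: less_induct)
  case less
  show ?case
  proof (cases "x = y")
    case False
    then obtain z where z: "z \<in> bip_parents y" "bip_le x z"
      using bip_le_parent[OF less.prems(1,2)] less.prems(3) unfolding bip_less_def by blast
    then show ?thesis using less.hyps[of z] bip_parents[OF z(1)] less.prems by simp
  qed simp
qed

text \<open>Every strict containment factors through a parent, which lowers the rank by exactly one.
  So a cover is a parent, and nothing fits strictly between \<open>y\<close> and a parent of
  \<open>y\<close>, for that would need a rank difference of 2.\<close>

lemma bip_covers_iff:
  assumes "x \<in> bipartitions" "y \<in> bipartitions"
  shows "bip_covers y x \<longleftrightarrow> x \<in> bip_parents y"
proof
  assume c: "bip_covers y x"
  then obtain z where z: "z \<in> bip_parents y" "bip_le x z"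
    using bip_le_parent[OF assms] unfolding bip_covers_def by blast
  then have "x = z"
    using c bip_parents_less[OF z(1) assms(2)] bip_parents(1)[OF z(1) assms(2)]
    by (auto simp: bip_covers_def bip_less_def)
  then show "x \<in> bip_parents y" using z by simp
next
  assume x: "x \<in> bip_parents y"
  have "\<not> (bip_less x r \<and> bip_less r y)" if r: "r \<in> bipartitions" for r
  proof
    assume l: "bip_less x r \<and> bip_less r y"
    then obtain z where z: "z \<in> bip_parents y" "bip_le r z"
      using bip_le_parent[OF r assms(2)] by blast
    obtain w where w: "w \<in> bip_parents r" "bip_le x w"
      using bip_le_parent[OF assms(1) r] l by blast
    have "bip_rank r \<le> bip_rank z" using bip_le_rank[OF r _ z(2)] bip_parents(1)[OF z(1) assms(2)] .
    moreover have "bip_rank x \<le> bip_rank w" using bip_le_rank[OF assms(1) _ w(2)] bip_parents(1)[OF w(1) r] .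
    ultimately show False
      using bip_parents(2)[OF z(1) assms(2)] bip_parents(2)[OF w(1) r] bip_parents(2)[OF x assms(2)] by simp
  qed
  then show "bip_covers y x" using bip_parents_less[OF x assms(2)] by (auto simp: bip_covers_def)
qed

section \<open>Beta-numbers of partitions\<close>

definition row_beads :: "nat \<Rightarrow> partition \<Rightarrow> nat set" where
  "row_beads N \<alpha> = (\<lambda>i. row \<alpha> i + (N - 1 - i)) ` {..<N}"

definition beads :: "nat \<Rightarrow> bipartition \<Rightarrow> nat set" where
  "beads N x = (\<lambda>b. 2 * b) ` row_beads N (fst x) \<union> (\<lambda>b. 2 * b + 1) ` row_beads N (snd x)"

lemma row_beads_strict:
  assumes "is_partition \<alpha>" "i < j" "j < N"
  shows "row \<alpha> j + (N - 1 - j) < row \<alpha> i + (N - 1 - i)"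
  using row_antimono[OF assms(1), of i j] assms by linarith

lemma inj_on_row_beads: "is_partition \<alpha> \<Longrightarrow> inj_on (\<lambda>i. row \<alpha> i + (N - 1 - i)) {..<N}"
  by (rule linorder_inj_onI) (use row_beads_strict in \<open>force+\<close>)

lemma finite_row_beads [simp]: "finite (row_beads N \<alpha>)"
  by (simp add: row_beads_def)

lemma card_row_beads: "is_partition \<alpha> \<Longrightarrow> card (row_beads N \<alpha>) = N"
  unfolding row_beads_def by (subst card_image[OF inj_on_row_beads]) auto

lemma row_beads_inj:
  assumes "is_partition \<alpha>" "is_partition \<beta>" "length \<alpha> \<le> N" "length \<beta> \<le> N" "row_beads N \<alpha> = row_beads N \<beta>"
  shows "\<alpha> = \<beta>"
proof (rule partition_eqI[OF assms(1,2)])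
  fix i
  \<comment> \<open>The bead of row \<open>i\<close> is recognised inside the set by having exactly
    \<open>i\<close> beads above it.\<close>
  have above: "card {b \<in> row_beads N \<gamma>. row \<gamma> i + (N - 1 - i) < b} = i"
    if "is_partition \<gamma>" "i < N" for i \<gamma>
  proof -
    let ?f = "\<lambda>i. row \<gamma> i + (N - 1 - i)"
    have "?f i < ?f j \<longleftrightarrow> j < i" if "j < N" for j
      using row_beads_strict[OF \<open>is_partition \<gamma>\<close>, of i j N] row_beads_strict[OF \<open>is_partition \<gamma>\<close>, of j i N]
        that \<open>i < N\<close> by (cases i j rule: linorder_cases) auto
    then have "{b \<in> row_beads N \<gamma>. ?f i < b} = ?f ` {..<i}" using \<open>i < N\<close> by (auto simp: row_beads_def)
    moreover have "inj_on ?f {..<i}" using inj_on_row_beads[OF that(1), of N] that(2) by (auto intro: inj_on_subset)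
    ultimately show ?thesis by (simp add: card_image)
  qed
  show "row \<alpha> i = row \<beta> i"
  proof (cases "i < N")
    case True
    then have "row \<alpha> i + (N - 1 - i) \<in> row_beads N \<beta>" using assms(5) by (auto simp: row_beads_def)
    then obtain j where j: "j < N" "row \<alpha> i + (N - 1 - i) = row \<beta> j + (N - 1 - j)" by (auto simp: row_beads_def)
    then have "i = j" using above[OF assms(1) True] above[OF assms(2) j(1)] assms(5) by simp
    then show ?thesis using j by simp
  qed (use assms(3,4) in \<open>simp add: row_def\<close>)
qed

lemma row_beads_surj:
  assumes "finite S" "card S = N"
  shows "\<exists>\<alpha>. is_partition \<alpha> \<and> length \<alpha> \<le> N \<and> row_beads N \<alpha> = S"
proof -
  \<comment> \<open>\<open>e i\<close> is the element with \<open>i\<close> larger ones. It has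
    \<open>N - 1 - i\<close> elements below it, so the subtraction in \<open>r\<close> does not
    truncate.\<close>
  define e where "e i = sorted_list_of_set S ! (N - 1 - i)" for i
  have len: "length (sorted_list_of_set S) = N" using assms by simp
  have strict: "e (Suc i) < e i" if "Suc i < N" for i
    unfolding e_def using that len
    by (intro sorted_wrt_nth_less[OF strict_sorted_list_of_set[of S]]) auto
  have low: "N - 1 - i \<le> e i" if "i < N" for i
    using that
  proof (induction "N - 1 - i" arbitrary: i)
    case (Suc d)
    then have "N - 1 - Suc i \<le> e (Suc i)" using Suc(1)[of "Suc i"] by linarith
    then show ?case using strict[of i] Suc by linarith
  qed simp
  define r where "r i = (if i < N then e i - (N - 1 - i) else 0)" for i
  have "r (Suc i) \<le> r i" for i using strict[of i] low[of i] by (auto simp: r_def)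
  moreover have "r N = 0" by (simp add: r_def)
  ultimately have p: "is_partition (of_rows r)" "row (of_rows r) = r" "length (of_rows r) \<le> N"
    by (rule of_rows)+
  have "row_beads N (of_rows r) = e ` {..<N}"
    unfolding row_beads_def p(2)
  proof (rule image_cong)
    fix i assume "i \<in> {..<N}"
    then show "r i + (N - 1 - i) = e i" using le_add_diff_inverse2[OF low[of i]] by (simp only: r_def lessThan_iff if_True)
  qed simp
  also have "\<dots> = (\<lambda>i. sorted_list_of_set S ! i) ` {..<N}"
  proof -
    have "(\<lambda>i. N - 1 - i) ` {..<N} = {..<N}"
    proof (intro equalityI subsetI)
      fix i assume "i \<in> {..<N}"
      then show "i \<in> (\<lambda>i. N - 1 - i) ` {..<N}" by (intro image_eqI[of _ _ "N - 1 - i"]) auto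
    qed auto
    then show ?thesis unfolding e_def by (metis (no_types, lifting) image_image image_cong)
  qed
  also have "\<dots> = set (sorted_list_of_set S)" using len by (auto simp: set_conv_nth)
  also have "\<dots> = S" using assms by simp
  finally show ?thesis using p by blast
qed

lemma sum_row_beads:
  assumes "is_partition \<alpha>" "length \<alpha> \<le> N"
  shows "\<Sum>(row_beads N \<alpha>) = \<Sum>{..<N} + sum_list \<alpha>"
proof -
  have "\<Sum>(row_beads N \<alpha>) = (\<Sum>i<N. row \<alpha> i + (N - 1 - i))"
    unfolding row_beads_def sum.reindex[OF inj_on_row_beads[OF assms(1)]] by simp
  also have "\<dots> = sum_list \<alpha> + (\<Sum>i<N. N - 1 - i)" unfolding sum.distrib sum_list_row[OF assms(2)] ..
  also have "(\<Sum>i<N. N - 1 - i) = \<Sum>{..<N}" using sum.nat_diff_reindex[of "\<lambda>i. i" N] by simp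
  finally show ?thesis by simp
qed

text \<open>The bead of row \<open>i + 1\<close> occupies the place directly below that of row
  \<open>i\<close> precisely when the two rows are equally long. So a bead can drop by one exactly
  when its row ends in a corner.\<close>

lemma holes_row_beads:
  assumes "is_partition \<alpha>" "length \<alpha> \<le> N"
  shows "bij_betw (\<lambda>i. row \<alpha> i - 1 + (N - 1 - i)) (corners \<alpha>) (holes 1 (row_beads N \<alpha>))"
  and "i \<in> corners \<alpha> \<Longrightarrow> drop_bead 1 (row_beads N \<alpha>) (row \<alpha> i - 1 + (N - 1 - i)) = row_beads N (remove_box \<alpha> i)"
proof -
  let ?f = "\<lambda>i. row \<alpha> i + (N - 1 - i)" and ?g = "\<lambda>i. row \<alpha> i - 1 + (N - 1 - i)"
  have fg: "?f i = Suc (?g i)" if "i \<in> corners \<alpha>" for i using that by (auto simp: corners_def)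
  have iN: "i < N" if "i \<in> corners \<alpha>" for i using corners_length[OF that] assms(2) by simp
  have hole: "?g i \<notin> row_beads N \<alpha>" if i: "i \<in> corners \<alpha>" for i
  proof
    assume "?g i \<in> row_beads N \<alpha>"
    then obtain j where j: "j < N" "?g i = ?f j" by (auto simp: row_beads_def)
    consider "j \<le> i" | "Suc i \<le> j" by linarith
    then show False
    proof cases
      case 1
      then have "?f i \<le> ?f j" using row_beads_strict[OF assms(1), of j i N] iN[OF i] by (cases "i = j") auto
      then show False using fg[OF i] j by simp
    next
      case 2
      then have "?f j \<le> ?f (Suc i)" using row_beads_strict[OF assms(1), of "Suc i" j N] j by (cases "Suc i = j") auto
      also have "\<dots> < ?g i" using i j 2 by (auto simp: corners_def)
      finally show False using j by simp
    qed
  qed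
  have inj: "inj_on ?g (corners \<alpha>)"
  proof (rule inj_onI)
    fix i j assume ij: "i \<in> corners \<alpha>" "j \<in> corners \<alpha>" "?g i = ?g j"
    then have "?f i = ?f j" by (simp only: fg)
    then show "i = j" by (rule inj_onD[OF inj_on_row_beads[OF assms(1)]]) (use iN ij in auto)
  qed
  have "?g ` corners \<alpha> = holes 1 (row_beads N \<alpha>)"
  proof (intro equalityI subsetI)
    fix x assume "x \<in> ?g ` corners \<alpha>"
    then obtain i where i: "i \<in> corners \<alpha>" "x = ?g i" by auto
    then have "x + 1 = ?f i" using fg by simp
    moreover have "?f i \<in> row_beads N \<alpha>" using iN[OF i(1)] unfolding row_beads_def by blast
    ultimately show "x \<in> holes 1 (row_beads N \<alpha>)" using hole[OF i(1)] i(2) by (simp only: holes_def mem_Collect_eq simp_thms)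
  next
    fix x assume x: "x \<in> holes 1 (row_beads N \<alpha>)"
    then obtain i where i: "i < N" "x + 1 = ?f i" by (auto simp: holes_def row_beads_def)
    have "i \<in> corners \<alpha>"
    proof (rule ccontr)
      assume "i \<notin> corners \<alpha>"
      then have eq: "row \<alpha> (Suc i) = row \<alpha> i" using row_antimono[OF assms(1), of i "Suc i"] by (auto simp: corners_def)
      show False
      proof (cases "Suc i < N")
        case True
        then have "x = ?f (Suc i)" using i eq by auto
        then show False using x True by (auto simp: holes_def row_beads_def)
      next
        case False
        then have "row \<alpha> (Suc i) = 0" using assms(2) by (simp add: row_def)
        then show False using i eq False by simp
      qed
    qed
    moreover from this have "x = ?g i" using i(2) fg by fastforce
    ultimately show "x \<in> ?g ` corners \<alpha>" by blast
  qed
  then show "bij_betw ?g (corners \<alpha>) (holes 1 (row_beads N \<alpha>))" using inj by (simp add: bij_betw_def)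
  show "drop_bead 1 (row_beads N \<alpha>) (?g i) = row_beads N (remove_box \<alpha> i)" if i: "i \<in> corners \<alpha>"
  proof -
    have "row_beads N (remove_box \<alpha> i) = insert (?g i) (?f ` ({..<N} - {i}))"
    proof -
      have "{..<N} = insert i ({..<N} - {i})" using iN[OF i] by auto
      then have "row_beads N (remove_box \<alpha> i) = (\<lambda>j. row (remove_box \<alpha> i) j + (N - 1 - j)) ` insert i ({..<N} - {i})"
        by (simp add: row_beads_def)
      also have "\<dots> = insert (?g i) (?f ` ({..<N} - {i}))"
        unfolding image_insert remove_box(2)[OF assms(1) i] by (intro arg_cong2[of _ _ _ _ insert] image_cong) auto
      finally show ?thesis .
    qed
    also have "?f ` ({..<N} - {i}) = row_beads N \<alpha> - {?f i}"
      unfolding row_beads_def using inj_on_image_set_diff[OF inj_on_row_beads[OF assms(1), of N], of "{..<N}" "{i}"] iN[OF i]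
      by auto
    finally show ?thesis using fg[OF i] by (simp add: drop_bead_def)
  qed
qed

section \<open>Bipartitions as bead sets\<close>

definition fits :: "nat \<Rightarrow> bipartition \<Rightarrow> bool" where
  "fits N x \<longleftrightarrow> x \<in> bipartitions \<and> length (fst x) \<le> N \<and> length (snd x) \<le> N"

lemma fits_if_rank_le: "x \<in> bipartitions \<Longrightarrow> bip_rank x \<le> N \<Longrightarrow> fits N x"
  using length_le_sum_list[of "fst x"] length_le_sum_list[of "snd x"]
  by (cases x) (auto simp: fits_def bipartitions_def)

lemma fits_parent: "fits N y \<Longrightarrow> x \<in> bip_parents y \<Longrightarrow> fits N x"
  using bip_parents(1)[of x y] by (auto simp: fits_def bip_parents_def bipartitions_def dest: remove_box(3))

lemma beads_even_odd: "2 * b \<in> beads N x \<longleftrightarrow> b \<in> row_beads N (fst x)"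
  "Suc (2 * b) \<in> beads N x \<longleftrightarrow> b \<in> row_beads N (snd x)"
  by (auto simp: beads_def) presburger+

lemma finite_beads [simp]: "finite (beads N x)"
  by (simp add: beads_def)

lemma beads_inj:
  assumes "fits N x" "fits N y" "beads N x = beads N y"
  shows "x = y"
proof -
  have "row_beads N (fst x) = row_beads N (fst y)" "row_beads N (snd x) = row_beads N (snd y)"
    using beads_even_odd[of _ N x] beads_even_odd[of _ N y] assms(3) by blast+
  then show ?thesis using assms(1,2) row_beads_inj
    by (cases x; cases y) (auto simp: fits_def bipartitions_def)
qed

lemma beads_surj:
  assumes "balanced N S"
  shows "\<exists>x. fits N x \<and> beads N x = S"
proof -
  have "finite S" using assms by (simp add: balanced_def)
  define A B where "A = {b. 2 * b \<in> S}" "B = {b. 2 * b + 1 \<in> S}"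
  have im: "{b\<in>S. even b} = (\<lambda>b. 2 * b) ` A" "{b\<in>S. odd b} = (\<lambda>b. 2 * b + 1) ` B"
    by (auto simp: A_B_def elim!: evenE oddE) presburger+
  have "finite ((\<lambda>b. 2 * b) ` A)" "finite ((\<lambda>b. 2 * b + 1) ` B)" unfolding im[symmetric] using \<open>finite S\<close> by auto
  then have fin: "finite A" "finite B" by (auto simp: finite_image_iff inj_on_def)
  have "card A = N" "card B = N"
    using assms unfolding balanced_def im by (auto simp: card_image inj_on_def)
  then obtain \<alpha> \<beta> where "is_partition \<alpha>" "length \<alpha> \<le> N" "row_beads N \<alpha> = A"
    "is_partition \<beta>" "length \<beta> \<le> N" "row_beads N \<beta> = B"
    using row_beads_surj fin by metis
  moreover have "S = (\<lambda>b. 2 * b) ` A \<union> (\<lambda>b. 2 * b + 1) ` B" unfolding im[symmetric] by auto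
  ultimately show ?thesis by (intro exI[of _ "(\<alpha>, \<beta>)"]) (auto simp: fits_def bipartitions_def beads_def)
qed

lemma sum_double_split: "\<Sum>((\<lambda>b. 2 * b) ` A \<union> (\<lambda>b. 2 * b + 1) ` B) = 2 * \<Sum>A + (2 * \<Sum>B + card B)"
  if "finite A" "finite B" for A B :: "nat set"
proof -
  have "(\<lambda>b. 2 * b) ` A \<inter> (\<lambda>b. 2 * b + 1) ` B = {}" by auto presburger
  then have "\<Sum>((\<lambda>b. 2 * b) ` A \<union> (\<lambda>b. 2 * b + 1) ` B) = \<Sum>((\<lambda>b. 2 * b) ` A) + \<Sum>((\<lambda>b. 2 * b + 1) ` B)"
    using that by (intro sum.union_disjoint) auto
  then show ?thesis by (simp add: sum.reindex inj_on_def sum.distrib sum_distrib_left sum_Suc)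
qed

lemma vacuum_split: "{..<2 * N} = (\<lambda>b. 2 * b) ` {..<N} \<union> (\<lambda>b. 2 * b + 1) ` {..<N :: nat}"
proof (intro equalityI subsetI)
  fix x assume "x \<in> {..<2 * N}"
  then show "x \<in> (\<lambda>b. 2 * b) ` {..<N} \<union> (\<lambda>b. 2 * b + 1) ` {..<N}"
    by (cases "even x") (auto elim!: evenE oddE)
qed auto

lemma sum_beads:
  assumes "fits N x"
  shows "\<Sum>(beads N x) = \<Sum>{..<2 * N} + 2 * bip_rank x"
proof -
  obtain \<alpha> \<beta> where x: "x = (\<alpha>, \<beta>)" by (cases x)
  have "\<Sum>(beads N x) = 2 * \<Sum>(row_beads N \<alpha>) + (2 * \<Sum>(row_beads N \<beta>) + N)"
    using assms unfolding beads_def x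
    by (subst sum_double_split) (auto simp: card_row_beads fits_def bipartitions_def)
  also have "\<dots> = (2 * \<Sum>{..<N} + (2 * \<Sum>{..<N} + N)) + 2 * bip_rank x"
    using assms by (simp add: sum_row_beads fits_def bipartitions_def x)
  also have "2 * \<Sum>{..<N} + (2 * \<Sum>{..<N} + N) = \<Sum>{..<2 * N}"
    unfolding vacuum_split by (subst sum_double_split) auto
  finally show ?thesis .
qed

lemma row_beads_Nil: "row_beads N [] = {..<N}"
proof -
  have "(\<lambda>i. N - 1 - i) ` {..<N} = {..<N}"
  proof (intro equalityI subsetI)
    fix i assume "i \<in> {..<N}"
    then show "i \<in> (\<lambda>i. N - 1 - i) ` {..<N}" by (intro image_eqI[of _ _ "N - 1 - i"]) auto
  qed auto
  then show ?thesis by (simp add: row_beads_def)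
qed

lemma beads_Nil: "beads N ([], []) = {..<2 * N}"
  by (simp add: beads_def row_beads_Nil vacuum_split)

lemma holes_beads:
  "holes 2 (beads N x) = (\<lambda>b. 2 * b) ` holes 1 (row_beads N (fst x)) \<union> (\<lambda>b. 2 * b + 1) ` holes 1 (row_beads N (snd x))"
proof (intro equalityI subsetI)
  fix c assume c: "c \<in> holes 2 (beads N x)"
  show "c \<in> (\<lambda>b. 2 * b) ` holes 1 (row_beads N (fst x)) \<union> (\<lambda>b. 2 * b + 1) ` holes 1 (row_beads N (snd x))"
  proof (cases "even c")
    case True
    then obtain b where b: "c = 2 * b" by (rule evenE)
    then have "b \<in> holes 1 (row_beads N (fst x))"
      using c beads_even_odd(1)[of b N x] beads_even_odd(1)[of "b + 1" N x] by (simp add: holes_def)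
    then show ?thesis using b by blast
  next
    case False
    then obtain b where b: "c = 2 * b + 1" by (rule oddE)
    then have "b \<in> holes 1 (row_beads N (snd x))"
      using c beads_even_odd(2)[of b N x] beads_even_odd(2)[of "b + 1" N x] by (simp add: holes_def)
    then show ?thesis using b by blast
  qed
next
  fix c assume "c \<in> (\<lambda>b. 2 * b) ` holes 1 (row_beads N (fst x)) \<union> (\<lambda>b. 2 * b + 1) ` holes 1 (row_beads N (snd x))"
  then consider b where "c = 2 * b" "b \<in> holes 1 (row_beads N (fst x))"
    | b where "c = 2 * b + 1" "b \<in> holes 1 (row_beads N (snd x))" by blast
  then show "c \<in> holes 2 (beads N x)"
  proof cases
    case 1
    then show ?thesis
      using beads_even_odd(1)[of b N x] beads_even_odd(1)[of "b + 1" N x] by (simp add: holes_def)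
  next
    case 2
    then show ?thesis
      using beads_even_odd(2)[of b N x] beads_even_odd(2)[of "b + 1" N x] by (simp add: holes_def)
  qed
qed

lemma drop_bead_beads:
  "drop_bead 2 (beads N (\<alpha>, \<beta>)) (2 * b) = (\<lambda>b. 2 * b) ` drop_bead 1 (row_beads N \<alpha>) b \<union> (\<lambda>b. 2 * b + 1) ` row_beads N \<beta>"
  "drop_bead 2 (beads N (\<alpha>, \<beta>)) (2 * b + 1) = (\<lambda>b. 2 * b) ` row_beads N \<alpha> \<union> (\<lambda>b. 2 * b + 1) ` drop_bead 1 (row_beads N \<beta>) b"
proof -
  have "2 * b + 2 \<notin> (\<lambda>b. 2 * b + 1) ` row_beads N \<beta>" by (auto, presburger)
  moreover have "2 * b + 2 = 2 * (b + 1)" by simp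
  ultimately show "drop_bead 2 (beads N (\<alpha>, \<beta>)) (2 * b) = (\<lambda>b. 2 * b) ` drop_bead 1 (row_beads N \<alpha>) b \<union> (\<lambda>b. 2 * b + 1) ` row_beads N \<beta>"
    unfolding drop_bead_def beads_def fst_conv snd_conv by auto
  have "2 * b + 1 + 2 \<notin> (\<lambda>b. 2 * b) ` row_beads N \<alpha>" by (auto, presburger)
  moreover have "2 * b + 1 + 2 = 2 * (b + 1) + 1" by simp
  ultimately show "drop_bead 2 (beads N (\<alpha>, \<beta>)) (2 * b + 1) = (\<lambda>b. 2 * b) ` row_beads N \<alpha> \<union> (\<lambda>b. 2 * b + 1) ` drop_bead 1 (row_beads N \<beta>) b"
    unfolding drop_bead_def beads_def fst_conv snd_conv by auto
qed

lemma drop_bead_remove_box: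
  assumes "fits N (\<alpha>, \<beta>)"
  shows "i \<in> corners \<alpha> \<Longrightarrow>
      drop_bead 2 (beads N (\<alpha>, \<beta>)) (2 * (row \<alpha> i - 1 + (N - 1 - i))) = beads N (remove_box \<alpha> i, \<beta>)"
    and "i \<in> corners \<beta> \<Longrightarrow>
      drop_bead 2 (beads N (\<alpha>, \<beta>)) (2 * (row \<beta> i - 1 + (N - 1 - i)) + 1) = beads N (\<alpha>, remove_box \<beta> i)"
proof -
  have p: "is_partition \<alpha>" "length \<alpha> \<le> N" "is_partition \<beta>" "length \<beta> \<le> N"
    using assms by (auto simp: fits_def bipartitions_def)
  show "drop_bead 2 (beads N (\<alpha>, \<beta>)) (2 * (row \<alpha> i - 1 + (N - 1 - i))) = beads N (remove_box \<alpha> i, \<beta>)"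
    if "i \<in> corners \<alpha>"
    unfolding drop_bead_beads holes_row_beads(2)[OF p(1,2) that] by (simp add: beads_def)
  show "drop_bead 2 (beads N (\<alpha>, \<beta>)) (2 * (row \<beta> i - 1 + (N - 1 - i)) + 1) = beads N (\<alpha>, remove_box \<beta> i)"
    if "i \<in> corners \<beta>"
    unfolding drop_bead_beads holes_row_beads(2)[OF p(3,4) that] by (simp add: beads_def)
qed

lemma sum_holes_beads:
  assumes "fits N (\<alpha>, \<beta>)"
  shows "(\<Sum>c\<in>holes 2 (beads N (\<alpha>, \<beta>)). g (drop_bead 2 (beads N (\<alpha>, \<beta>)) c))
    = (\<Sum>i\<in>corners \<alpha>. g (beads N (remove_box \<alpha> i, \<beta>))) + (\<Sum>i\<in>corners \<beta>. g (beads N (\<alpha>, remove_box \<beta> i)) :: nat)"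
proof -
  have p: "is_partition \<alpha>" "length \<alpha> \<le> N" "is_partition \<beta>" "length \<beta> \<le> N"
    using assms by (auto simp: fits_def bipartitions_def)
  let ?S = "beads N (\<alpha>, \<beta>)" and ?A = "holes 1 (row_beads N \<alpha>)" and ?B = "holes 1 (row_beads N \<beta>)"
  have "(\<lambda>b. 2 * b) ` ?A \<inter> (\<lambda>b. 2 * b + 1) ` ?B = {}" by auto presburger
  then have "(\<Sum>c\<in>holes 2 ?S. g (drop_bead 2 ?S c))
      = (\<Sum>c\<in>(\<lambda>b. 2 * b) ` ?A. g (drop_bead 2 ?S c)) + (\<Sum>c\<in>(\<lambda>b. 2 * b + 1) ` ?B. g (drop_bead 2 ?S c))"
    unfolding holes_beads fst_conv snd_conv by (intro sum.union_disjoint) auto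
  also have "(\<Sum>c\<in>(\<lambda>b. 2 * b) ` ?A. g (drop_bead 2 ?S c)) = (\<Sum>b\<in>?A. g (drop_bead 2 ?S (2 * b)))"
    by (simp add: sum.reindex inj_on_def)
  also have "\<dots> = (\<Sum>i\<in>corners \<alpha>. g (drop_bead 2 ?S (2 * (row \<alpha> i - 1 + (N - 1 - i)))))"
    using sum.reindex_bij_betw[OF holes_row_beads(1)[OF p(1,2)], of "\<lambda>b. g (drop_bead 2 ?S (2 * b))"] by simp
  also have "\<dots> = (\<Sum>i\<in>corners \<alpha>. g (beads N (remove_box \<alpha> i, \<beta>)))"
    by (intro sum.cong refl) (simp only: drop_bead_remove_box[OF assms])
  also have "(\<Sum>c\<in>(\<lambda>b. 2 * b + 1) ` ?B. g (drop_bead 2 ?S c)) = (\<Sum>b\<in>?B. g (drop_bead 2 ?S (2 * b + 1)))"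
    by (simp add: sum.reindex inj_on_def)
  also have "\<dots> = (\<Sum>i\<in>corners \<beta>. g (drop_bead 2 ?S (2 * (row \<beta> i - 1 + (N - 1 - i)) + 1)))"
    using sum.reindex_bij_betw[OF holes_row_beads(1)[OF p(3,4)], of "\<lambda>b. g (drop_bead 2 ?S (2 * b + 1))"] by simp
  also have "\<dots> = (\<Sum>i\<in>corners \<beta>. g (beads N (\<alpha>, remove_box \<beta> i)))"
    by (intro sum.cong refl) (simp only: drop_bead_remove_box[OF assms])
  finally show ?thesis .
qed

lemma bead_move_beads_iff:
  assumes "fits N y"
  shows "bead_move 2 C (beads N y) \<longleftrightarrow> (\<exists>x\<in>bip_parents y. C = beads N x)"
proof -
  obtain \<alpha> \<beta> where y: "y = (\<alpha>, \<beta>)" by (cases y)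
  have p: "is_partition \<alpha>" "length \<alpha> \<le> N" "is_partition \<beta>" "length \<beta> \<le> N"
    using assms y by (auto simp: fits_def bipartitions_def)
  have A: "holes 1 (row_beads N \<alpha>) = (\<lambda>i. row \<alpha> i - 1 + (N - 1 - i)) ` corners \<alpha>"
    using holes_row_beads(1)[OF p(1,2)] unfolding bij_betw_def by (rule conjE) (rule sym)
  have B: "holes 1 (row_beads N \<beta>) = (\<lambda>i. row \<beta> i - 1 + (N - 1 - i)) ` corners \<beta>"
    using holes_row_beads(1)[OF p(3,4)] unfolding bij_betw_def by (rule conjE) (rule sym)
  have "(\<lambda>c. drop_bead 2 (beads N y) c) ` holes 2 (beads N y) = beads N ` bip_parents y"
    unfolding holes_beads y image_Un image_image fst_conv snd_conv A B bip_parents_def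
    by (intro arg_cong2[of _ _ _ _ "(\<union>)"] image_cong refl)
      (simp_all only: drop_bead_remove_box[OF assms[unfolded y]])
  then show ?thesis unfolding bead_move_iff_holes[OF zero_less_numeral] by blast
qed

lemma bip_rank_eq_0: "x \<in> bipartitions \<Longrightarrow> bip_rank x = 0 \<longleftrightarrow> x = ([], [])"
  using is_partition_sum_list_eq_0[of "fst x"] is_partition_sum_list_eq_0[of "snd x"]
  by (cases x) (auto simp: bipartitions_def)

text \<open>Dropping a bead by 2 is removing a box from one component, so both sides satisfy the
  same recursion, starting from the empty bipartition.\<close>

lemma paths_beads: "fits N x \<Longrightarrow> paths N (bip_rank x) (beads N x) = f_bip x"
proof (induction "bip_rank x" arbitrary: x)
  case 0
  then have "x = ([], [])" by (metis bip_rank_eq_0 fits_def)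
  then show ?case by (simp add: beads_Nil)
next
  case (Suc n)
  obtain \<alpha> \<beta> where x: "x = (\<alpha>, \<beta>)" by (cases x)
  have p: "is_partition \<alpha>" "is_partition \<beta>" and ne: "(\<alpha>, \<beta>) \<noteq> ([], [])"
    using Suc.prems Suc.hyps(2) x by (auto simp: fits_def bipartitions_def)
  have IH: "paths N n (beads N z) = f_bip z" if "z \<in> bip_parents x" for z
    using Suc.hyps(1)[of z] fits_parent[OF Suc.prems that] bip_parents(2)[OF that] Suc.prems Suc.hyps(2)
    by (simp add: fits_def)
  have "paths N (Suc n) (beads N x) = (\<Sum>i\<in>corners \<alpha>. paths N n (beads N (remove_box \<alpha> i, \<beta>)))
      + (\<Sum>i\<in>corners \<beta>. paths N n (beads N (\<alpha>, remove_box \<beta> i)))"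
    unfolding paths_Suc x by (rule sum_holes_beads) (use Suc.prems x in simp)
  also have "\<dots> = f_bip x"
    unfolding x f_bip_rec[OF p ne]
    by (intro arg_cong2[of _ _ _ _ "(+)"] sum.cong refl) (auto intro!: IH simp del: f_bip.simps simp: x bip_parents_def)
  finally show ?case using Suc.hyps(2) by simp
qed

definition odd_bip :: "bipartition \<Rightarrow> bool" where
  "odd_bip x \<longleftrightarrow> x \<in> bipartitions \<and> odd (f_bip x)"

lemma odd_beads_beads_iff:
  assumes "fits N x"
  shows "odd_beads N n (beads N x) \<longleftrightarrow> odd_bip x \<and> bip_rank x = n"
proof
  assume o: "odd_beads N n (beads N x)"
  then have "bip_rank x = n" using odd_beads_sum[OF o] sum_beads[OF assms] by simp
  then show "odd_bip x \<and> bip_rank x = n"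
    using o paths_beads[OF assms] assms by (simp add: odd_beads_def odd_bip_def fits_def)
next
  assume "odd_bip x \<and> bip_rank x = n"
  then show "odd_beads N n (beads N x)"
    using paths_beads[OF assms] by (auto simp: odd_beads_def odd_bip_def)
qed

text \<open>A positive path count forces balance, and balanced sets are exactly the ones that encode
  bipartitions. Results on odd bead sets can thus be read back as results on nodes.\<close>

lemma odd_beads_imp_beads:
  assumes "odd_beads N n S"
  obtains x where "fits N x" "odd_bip x" "bip_rank x = n" "beads N x = S"
proof -
  have "0 < paths N n S" using assms by (auto simp: odd_beads_def elim: oddE)
  then obtain x where x: "fits N x" "beads N x = S"
    using beads_surj paths_pos_balanced odd_beads_finite[OF assms] by blast
  then show ?thesis using that odd_beads_beads_iff[OF x(1)] assms by blast
qed

definition parent :: "bipartition \<Rightarrow> bipartition" where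
  "parent y = (THE x. odd_bip x \<and> x \<in> bip_parents y)"

lemma odd_bip_ex1_parent:
  assumes "odd_bip y" "0 < bip_rank y"
  shows "\<exists>!x. odd_bip x \<and> x \<in> bip_parents y"
proof -
  let ?N = "bip_rank y"
  have fy: "fits ?N y" using assms fits_if_rank_le by (simp add: odd_bip_def)
  have o: "odd_beads ?N (bip_rank y) (beads ?N y)" using odd_beads_beads_iff[OF fy] assms by simp
  obtain n where n: "bip_rank y = Suc n" using assms(2) by (cases "bip_rank y") auto
  obtain S where S: "bead_move 2 S (beads ?N y)" "odd_beads ?N n S"
    using odd_beads_parent_exists[of ?N n "beads ?N y"] o n by auto
  obtain x where x: "x \<in> bip_parents y" "S = beads ?N x" using S(1) bead_move_beads_iff[OF fy] by auto
  have "odd_bip x" using S(2) x odd_beads_beads_iff[OF fits_parent[OF fy x(1)]] by simp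
  moreover have "x' = x''" if "odd_bip x'" "x' \<in> bip_parents y" "odd_bip x''" "x'' \<in> bip_parents y" for x' x''
  proof -
    have f: "fits ?N x'" "fits ?N x''" using fits_parent[OF fy] that by auto
    have "odd_beads ?N (bip_rank y - 1) (beads ?N x')" "odd_beads ?N (bip_rank y - 1) (beads ?N x'')"
      unfolding odd_beads_beads_iff[OF f(1)] odd_beads_beads_iff[OF f(2)]
      using that bip_parents(2)[OF that(2)] bip_parents(2)[OF that(4)] assms(1) by (simp_all add: odd_bip_def)
    moreover have "bead_move 2 (beads ?N x') (beads ?N y)" "bead_move 2 (beads ?N x'') (beads ?N y)"
      using bead_move_beads_iff[OF fy] that by auto
    ultimately have "beads ?N x' = beads ?N x''" using odd_beads_parent_unique[OF o assms(2)] by blast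
    then show ?thesis using beads_inj f by blast
  qed
  ultimately show ?thesis using x(1) by blast
qed

lemma parent:
  assumes "odd_bip y" "0 < bip_rank y"
  shows "odd_bip (parent y)" "parent y \<in> bip_parents y" "bip_rank y = Suc (bip_rank (parent y))"
proof -
  have "odd_bip (parent y) \<and> parent y \<in> bip_parents y"
    unfolding parent_def by (rule theI'[OF odd_bip_ex1_parent[OF assms]])
  then show "odd_bip (parent y)" "parent y \<in> bip_parents y" "bip_rank y = Suc (bip_rank (parent y))"
    using bip_parents(2) assms(1) by (auto simp: odd_bip_def)
qed

lemma parent_eqI: "odd_bip y \<Longrightarrow> odd_bip x \<Longrightarrow> x \<in> bip_parents y \<Longrightarrow> parent y = x"
  using odd_bip_ex1_parent[of y] parent[of y] bip_parents(2)[of x y] by (auto simp: odd_bip_def)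

lemma parent_eqI_beads:
  assumes "fits N x" "fits N y" "odd_bip x" "odd_bip y" "bead_move 2 (beads N x) (beads N y)"
  shows "parent y = x"
  using assms bead_move_beads_iff[OF assms(2)] beads_inj[OF assms(1)] fits_parent[OF assms(2)]
  by (metis parent_eqI)

section \<open>Hooks and one-dimensional bipartitions as bead sets\<close>

definition hook_partition :: "nat \<Rightarrow> nat \<Rightarrow> partition" where
  "hook_partition j m = j # replicate (m - j) 1"

lemma hook_partition:
  assumes "1 \<le> j" "j \<le> m"
  shows "is_partition (hook_partition j m)" "sum_list (hook_partition j m) = m"
    "length (hook_partition j m) = Suc (m - j)"
  using assms by (auto simp: is_partition_def hook_partition_def sorted_wrt_iff_nth_less sum_list_replicate nth_Cons')

text \<open>Both sides have \<open>N\<close> elements, so one inclusion is enough: the first row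
  gives the raised bead, the leg shifts a block of beads up by one, and the remaining beads
  stay.\<close>

lemma row_beads_hook:
  assumes "1 \<le> j" "j \<le> m" "m - j < N"
  shows "row_beads N (hook_partition j m) = insert (N - 1 + j) ({..<N} - {N - 1 - (m - j)})"
proof (rule card_subset_eq)
  let ?e = "N - 1 - (m - j)"
  have r: "row (hook_partition j m) i = (if i = 0 then j else if i \<le> m - j then 1 else 0)" for i
    by (auto simp: row_def hook_partition_def nth_Cons')
  have "card (row_beads N (hook_partition j m)) = N" by (rule card_row_beads[OF hook_partition(1)[OF assms(1,2)]])
  also have "\<dots> = card (insert (N - 1 + j) ({..<N} - {?e}))" using assms by (subst card_insert_disjoint) auto
  finally show "card (row_beads N (hook_partition j m)) = card (insert (N - 1 + j) ({..<N} - {?e}))" .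
  show "row_beads N (hook_partition j m) \<subseteq> insert (N - 1 + j) ({..<N} - {?e})"
  proof
    fix b assume "b \<in> row_beads N (hook_partition j m)"
    then obtain i where i: "i < N" "b = row (hook_partition j m) i + (N - 1 - i)" by (auto simp: row_beads_def)
    consider "i = 0" | "0 < i" "i \<le> m - j" | "m - j < i" by linarith
    then show "b \<in> insert (N - 1 + j) ({..<N} - {?e})"
      by cases (use i r assms in \<open>auto\<close>)
  qed
qed auto

lemma beads_hook:
  assumes "1 \<le> j" "j \<le> m" "m - j < N"
  shows "beads N (hook_partition j m, []) = hook_beads N (2 * (N - 1 - (m - j))) m"
    and "beads N ([], hook_partition j m) = hook_beads N (2 * (N - 1 - (m - j)) + 1) m"
proof -
  let ?e = "N - 1 - (m - j)"
  have e: "2 * (N - 1 + j) = 2 * ?e + 2 * m" using assms by auto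
  have "(\<lambda>b. 2 * b) ` insert (N - 1 + j) ({..<N} - {?e}) = insert (2 * ?e + 2 * m) ((\<lambda>b. 2 * b) ` {..<N} - {2 * ?e})"
    unfolding e[symmetric] by (subst image_insert) auto
  moreover have "2 * ?e \<notin> (\<lambda>b. 2 * b + 1) ` {..<N}" by (auto, presburger)
  ultimately show "beads N (hook_partition j m, []) = hook_beads N (2 * ?e) m"
    unfolding beads_def fst_conv snd_conv row_beads_hook[OF assms] row_beads_Nil hook_beads_def vacuum_split by auto
  have "(\<lambda>b. 2 * b + 1) ` insert (N - 1 + j) ({..<N} - {?e})
      = insert (2 * ?e + 1 + 2 * m) ((\<lambda>b. 2 * b + 1) ` {..<N} - {2 * ?e + 1})"
    using e by (subst image_insert) auto
  moreover have "2 * ?e + 1 \<notin> (\<lambda>b. 2 * b) ` {..<N}" by (auto, presburger)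
  ultimately show "beads N ([], hook_partition j m) = hook_beads N (2 * ?e + 1) m"
    unfolding beads_def fst_conv snd_conv row_beads_hook[OF assms] row_beads_Nil hook_beads_def vacuum_split by auto
qed

lemma is_hook_iff_beads:
  assumes "fits N x"
  shows "is_hook x \<longleftrightarrow> (\<exists>c n. c < 2 * N \<and> 2 * N \<le> c + 2 * n \<and> 0 < n \<and> beads N x = hook_beads N c n)"
proof
  assume "is_hook x"
  then obtain j m where jm: "1 \<le> j" "j \<le> m"
    and x: "x = (hook_partition j m, []) \<or> x = ([], hook_partition j m)"
    unfolding hook_partition_def by (cases x) (simp only: is_hook.simps is_hook_partition_def, blast)
  then have N: "m - j < N" using assms hook_partition(3)[OF jm] by (auto simp: fits_def)
  have le: "2 * (N - 1 - (m - j)) + 1 < 2 * N" "2 * N \<le> 2 * (N - 1 - (m - j)) + 2 * m" "0 < m"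
    using jm N by linarith+
  from x show "\<exists>c n. c < 2 * N \<and> 2 * N \<le> c + 2 * n \<and> 0 < n \<and> beads N x = hook_beads N c n"
  proof
    assume "x = (hook_partition j m, [])"
    then have "beads N x = hook_beads N (2 * (N - 1 - (m - j))) m" using beads_hook(1)[OF jm N] by simp
    then show ?thesis using le by (metis add_lessD1)
  next
    assume "x = ([], hook_partition j m)"
    then have "beads N x = hook_beads N (2 * (N - 1 - (m - j)) + 1) m" using beads_hook(2)[OF jm N] by simp
    moreover have "2 * N \<le> 2 * (N - 1 - (m - j)) + 1 + 2 * m" using le(2) by simp
    ultimately show ?thesis using le(1,3) by blast
  qed
next
  assume "\<exists>c n. c < 2 * N \<and> 2 * N \<le> c + 2 * n \<and> 0 < n \<and> beads N x = hook_beads N c n"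
  then obtain c n where c: "c < 2 * N" "2 * N \<le> c + 2 * n" "0 < n" "beads N x = hook_beads N c n" by blast
  define e where "e = c div 2"
  \<comment> \<open>The solution of \<open>N - 1 - (n - j) = e\<close>, so that
    \<open>beads_hook\<close> returns a gap in the pair of positions containing
    \<open>c\<close>.\<close>
  define j where "j = e + n + 1 - N"
  have e: "e < N" "N \<le> e + n" using c by (auto simp: e_def)
  have jm: "1 \<le> j" "j \<le> n" "n - j < N" and ee: "N - 1 - (n - j) = e" using e by (auto simp: j_def)
  have fit: "fits N (hook_partition j n, [])" "fits N ([], hook_partition j n)"
    using hook_partition[OF jm(1,2)] jm(3) by (auto simp: fits_def bipartitions_def)
  have h: "is_hook_partition (hook_partition j n)" using jm by (auto simp: is_hook_partition_def hook_partition_def)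
  show "is_hook x"
  proof (cases "even c")
    case True
    then have "c = 2 * e" by (simp add: e_def)
    then have "x = (hook_partition j n, [])"
      using beads_inj[OF assms fit(1)] beads_hook(1)[OF jm] c(4) ee by simp
    then show ?thesis using h by simp
  next
    case False
    then have "c = 2 * e + 1" by (simp add: e_def)
    then have "x = ([], hook_partition j n)"
      using beads_inj[OF assms fit(2)] beads_hook(2)[OF jm] c(4) ee by simp
    then show ?thesis using h by simp
  qed
qed

lemma hook_beads_sum:
  assumes "c < 2 * N" "2 * N \<le> c + 2 * n"
  shows "\<Sum>(hook_beads N c n) = \<Sum>{..<2 * N} + 2 * n"
proof -
  have "bead_move (2 * n) {..<2 * N} (hook_beads N c n)" using assms by (auto simp: bead_move_vacuum_iff)
  from bead_move_card_sum(2)[OF this] show ?thesis by (simp add: hook_beads_def)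
qed

lemma is_hook_rank_iff_beads:
  assumes "fits N x"
  shows "is_hook x \<longleftrightarrow> (\<exists>c. c < 2 * N \<and> 2 * N \<le> c + 2 * bip_rank x \<and> beads N x = hook_beads N c (bip_rank x))"
proof
  assume "is_hook x"
  then obtain c n where c: "c < 2 * N" "2 * N \<le> c + 2 * n" "beads N x = hook_beads N c n"
    unfolding is_hook_iff_beads[OF assms] by blast
  then have "bip_rank x = n" using hook_beads_sum[OF c(1,2)] sum_beads[OF assms] by simp
  then show "\<exists>c. c < 2 * N \<and> 2 * N \<le> c + 2 * bip_rank x \<and> beads N x = hook_beads N c (bip_rank x)" using c by auto
next
  assume "\<exists>c. c < 2 * N \<and> 2 * N \<le> c + 2 * bip_rank x \<and> beads N x = hook_beads N c (bip_rank x)"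
  then show "is_hook x" unfolding is_hook_iff_beads[OF assms] by fastforce
qed

lemma one_dimensional_iff_beads:
  assumes "fits N x" "0 < bip_rank x"
  shows "one_dimensional x \<longleftrightarrow> (\<exists>c. straight N c (bip_rank x) \<and> beads N x = hook_beads N c (bip_rank x))"
  using paths_eq_1_imp_straight[of "beads N x" N "bip_rank x"] paths_straight[of N _ "bip_rank x"] assms
    paths_beads[OF assms(1)] by (auto simp: one_dimensional_def)

section \<open>The tree of odd bipartitions\<close>

declare bip_rank.simps [simp del] f_bip.simps [simp del] split_paired_All [simp del] split_paired_Ex [simp del]

lemma odd_bip_Nil [simp]: "odd_bip ([], [])"
  by (simp add: odd_bip_def bipartitions_def f_bip.simps)

lemma bip_rank_0_iff: "odd_bip x \<Longrightarrow> bip_rank x = 0 \<longleftrightarrow> x = ([], [])"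
  by (simp add: odd_bip_def bip_rank_eq_0)

lemma nodes_M2: "nodes M2 = {x. odd_bip x}"
  by (auto simp: M2_def induced_def Y2_def odd_bip_def)

lemma edges_M2: "edges M2 = {{parent y, y} | y. odd_bip y \<and> 0 < bip_rank y}"
proof -
  have "edges M2 = {{x, y} | x y. odd_bip x \<and> odd_bip y \<and> x \<in> bip_parents y}"
  proof (intro equalityI subsetI)
    fix e assume "e \<in> edges M2"
    then obtain x y where "e = {x, y}" "x \<in> bipartitions" "y \<in> bipartitions" "bip_covers y x" "e \<subseteq> {p. odd (f_bip p)}"
      unfolding M2_def induced_def Y2_def by auto
    then show "e \<in> {{x, y} | x y. odd_bip x \<and> odd_bip y \<and> x \<in> bip_parents y}"
      using bip_covers_iff[of x y] by (auto simp: odd_bip_def)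
  next
    fix e assume "e \<in> {{x, y} | x y. odd_bip x \<and> odd_bip y \<and> x \<in> bip_parents y}"
    then obtain x y where e: "e = {x, y}" "odd_bip x" "odd_bip y" "x \<in> bip_parents y" by blast
    then have "bip_covers y x" using bip_covers_iff[of x y] by (simp add: odd_bip_def)
    then show "e \<in> edges M2" using e unfolding M2_def induced_def Y2_def by (auto simp: odd_bip_def)
  qed
  also have "\<dots> = {{parent y, y} | y. odd_bip y \<and> 0 < bip_rank y}"
  proof (intro Collect_cong iffI)
    fix e assume "\<exists>x y. e = {x, y} \<and> odd_bip x \<and> odd_bip y \<and> x \<in> bip_parents y"
    then obtain x y where "e = {x, y}" "odd_bip x" "odd_bip y" "x \<in> bip_parents y" by blast
    moreover from this have "parent y = x" by (intro parent_eqI)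
    moreover from calculation have "0 < bip_rank y" using bip_parents(2)[of x y] by (simp add: odd_bip_def)
    ultimately show "\<exists>y. e = {parent y, y} \<and> odd_bip y \<and> 0 < bip_rank y" by blast
  next
    fix e assume "\<exists>y. e = {parent y, y} \<and> odd_bip y \<and> 0 < bip_rank y"
    then show "\<exists>x y. e = {x, y} \<and> odd_bip x \<and> odd_bip y \<and> x \<in> bip_parents y" using parent by blast
  qed
  finally show ?thesis .
qed

lemma nodes_M2k: "nodes (M2k k) = {x. odd_bip x \<and> bip_rank x < 2 ^ k}"
proof -
  have "n \<le> 2 ^ k - 1 \<longleftrightarrow> n < 2 ^ k" for n :: nat using zero_less_power[of "2::nat" k] by linarith
  then show ?thesis by (auto simp: M2k_def induced_def nodes_M2)
qed

lemma edges_M2k: "edges (M2k k) = {{parent y, y} | y. odd_bip y \<and> 0 < bip_rank y \<and> bip_rank y < 2 ^ k}"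
proof -
  have le: "n \<le> 2 ^ k - 1 \<longleftrightarrow> n < 2 ^ k" for n :: nat using zero_less_power[of "2::nat" k] by linarith
  have "edges (M2k k) = {e \<in> edges M2. \<forall>x\<in>e. bip_rank x < 2 ^ k}"
    by (auto simp: M2k_def induced_def le[unfolded One_nat_def] subset_eq)
  also have "\<dots> = {{parent y, y} | y. odd_bip y \<and> 0 < bip_rank y \<and> bip_rank y < 2 ^ k}"
  proof (intro equalityI subsetI)
    fix e assume "e \<in> {e \<in> edges M2. \<forall>x\<in>e. bip_rank x < 2 ^ k}"
    then show "e \<in> {{parent y, y} | y. odd_bip y \<and> 0 < bip_rank y \<and> bip_rank y < 2 ^ k}"
      unfolding edges_M2 by blast
  next
    fix e assume "e \<in> {{parent y, y} | y. odd_bip y \<and> 0 < bip_rank y \<and> bip_rank y < 2 ^ k}"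
    then obtain y where "e = {parent y, y}" "odd_bip y" "0 < bip_rank y" "bip_rank y < 2 ^ k" by blast
    moreover from this have "bip_rank (parent y) < 2 ^ k" using parent(3)[of y] by simp
    ultimately show "e \<in> {e \<in> edges M2. \<forall>x\<in>e. bip_rank x < 2 ^ k}"
      unfolding edges_M2 by blast
  qed
  finally show ?thesis .
qed

text \<open>A common form for the edges of \<open>M2\<close> and of its truncations:
  \<open>P\<close> restricts the rank of the upper end.\<close>

definition parent_edges :: "(nat \<Rightarrow> bool) \<Rightarrow> bipartition set set" where
  "parent_edges P = {{parent y, y} | y. odd_bip y \<and> 0 < bip_rank y \<and> P (bip_rank y)}"

lemma edges_parent_edges: "edges M2 = parent_edges (\<lambda>_. True)" "edges (M2k k) = parent_edges (\<lambda>n. n < 2 ^ k)"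
  by (simp_all add: edges_M2 edges_M2k parent_edges_def)

lemma parent_edges_iff:
  "{x, y} \<in> parent_edges P \<longleftrightarrow> (odd_bip y \<and> 0 < bip_rank y \<and> P (bip_rank y) \<and> x = parent y)
    \<or> (odd_bip x \<and> 0 < bip_rank x \<and> P (bip_rank x) \<and> y = parent x)"
  by (auto simp: parent_edges_def doubleton_eq_iff)

lemma up_edge_iff:
  "{x, y} \<in> parent_edges P \<and> bip_rank x < bip_rank y \<longleftrightarrow>
    odd_bip y \<and> 0 < bip_rank y \<and> P (bip_rank y) \<and> x = parent y"
  unfolding parent_edges_iff using parent(3)[of x] parent(3)[of y] by (metis lessI not_less_iff_gr_or_eq)

text \<open>Every odd node of positive rank has a single parent, so lying above a node becomes a
  statement about the ancestor at that node's rank, and the transitive closure is replaced by a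
  function.\<close>

definition ancestor :: "nat \<Rightarrow> bipartition \<Rightarrow> bipartition" where
  "ancestor r w = (parent ^^ (bip_rank w - r)) w"

lemma ancestor_self [simp]: "bip_rank w \<le> r \<Longrightarrow> ancestor r w = w"
  by (simp add: ancestor_def)

lemma ancestor_parent:
  assumes "odd_bip w" "r < bip_rank w"
  shows "ancestor r w = ancestor r (parent w)"
proof -
  have "bip_rank w - r = Suc (bip_rank (parent w) - r)" using parent(3)[of w] assms by simp
  then show ?thesis by (simp add: ancestor_def funpow_swap1)
qed

lemma ancestor:
  assumes "odd_bip w" "r \<le> bip_rank w"
  shows "odd_bip (ancestor r w) \<and> bip_rank (ancestor r w) = r"
  using assms
proof (induction "bip_rank w" arbitrary: w rule: less_induct)
  case less
  show ?case
  proof (cases "r = bip_rank w")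
    case False
    then show ?thesis using less parent[of w] ancestor_parent[of w r] by simp
  qed (use less in simp)
qed

text \<open>Walking down from \<open>w\<close> by parents reaches \<open>x\<close>; that
  \<open>P\<close> is inherited by smaller ranks keeps this walk inside the graph.\<close>

lemma lies_above_iff:
  assumes G: "edges G = parent_edges P" and P: "\<And>n. P (Suc n) \<Longrightarrow> P n"
  shows "lies_above G x w \<longleftrightarrow> odd_bip w \<and> P (bip_rank w) \<and> bip_rank x < bip_rank w \<and> ancestor (bip_rank x) w = x"
proof
  assume "lies_above G x w"
  then show "odd_bip w \<and> P (bip_rank w) \<and> bip_rank x < bip_rank w \<and> ancestor (bip_rank x) w = x"
    unfolding lies_above_def G up_edge_iff
  proof (induction rule: tranclp_induct)
    case (base y)
    then show ?case using parent(3)[of y] ancestor_parent[of y "bip_rank x"] by simp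
  next
    case (step y z)
    then show ?case using parent(3)[of z] ancestor_parent[of z "bip_rank x"] by simp
  qed
next
  assume "odd_bip w \<and> P (bip_rank w) \<and> bip_rank x < bip_rank w \<and> ancestor (bip_rank x) w = x"
  then show "lies_above G x w"
    unfolding lies_above_def G up_edge_iff
  proof (induction "bip_rank w" arbitrary: w rule: less_induct)
    case less
    then have w: "odd_bip w" "0 < bip_rank w" "P (bip_rank w)" "bip_rank w = Suc (bip_rank (parent w))"
      using parent(3)[of w] by auto
    have anc: "ancestor (bip_rank x) (parent w) = x" using less.prems ancestor_parent[of w "bip_rank x"] by metis
    show ?case
    proof (cases "bip_rank (parent w) = bip_rank x")
      case True
      then have "x = parent w" using anc by simp
      then show ?thesis using w by (intro tranclp.r_into_trancl) auto
    next
      case False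
      have "(\<lambda>x y. odd_bip y \<and> 0 < bip_rank y \<and> P (bip_rank y) \<and> x = parent y)\<^sup>+\<^sup>+ x (parent w)"
        using less.hyps[of "parent w"] less.prems w False anc parent(1)[OF w(1,2)] P by simp
      then show ?thesis by (rule tranclp.trancl_into_trancl) (use w in \<open>auto\<close>)
    qed
  qed
qed

lemma branch_at_M2:
  "odd_bip u \<Longrightarrow> branch_at M2 u = {w. odd_bip w \<and> bip_rank u \<le> bip_rank w \<and> ancestor (bip_rank u) w = u}"
  unfolding branch_at_def lies_above_iff[OF edges_parent_edges(1) TrueI] by (auto simp: le_less)

lemma branch_at_M2k:
  "u \<in> nodes (M2k k) \<Longrightarrow> branch_at (M2k k) u
    = {w. odd_bip w \<and> bip_rank u \<le> bip_rank w \<and> bip_rank w < 2 ^ k \<and> ancestor (bip_rank u) w = u}"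
proof -
  assume u: "u \<in> nodes (M2k k)"
  have "lies_above (M2k k) u w \<longleftrightarrow>
      odd_bip w \<and> bip_rank w < 2 ^ k \<and> bip_rank u < bip_rank w \<and> ancestor (bip_rank u) w = u" for w
    by (rule lies_above_iff[OF edges_parent_edges(2)]) simp
  then show ?thesis using u unfolding branch_at_def by (auto simp: le_less nodes_M2k)
qed

lemma edges_M2k_iff:
  "{x, y} \<in> edges (M2k k) \<longleftrightarrow> (odd_bip y \<and> 0 < bip_rank y \<and> bip_rank y < 2 ^ k \<and> x = parent y)
    \<or> (odd_bip x \<and> 0 < bip_rank x \<and> bip_rank x < 2 ^ k \<and> y = parent x)"
  unfolding edges_parent_edges parent_edges_iff ..

section \<open>One doubling step: cores and copies\<close>

locale level =
  fixes k :: nat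
  assumes k_pos: "1 \<le> k"
begin

definition p :: nat where "p = 2 ^ k"
text \<open>Beads per component. There is ample room for all bipartitions of rank up to
  \<open>2 * p\<close>, and the low positions stay filled, so that legs can grow by \<open>p\<close>
  and squares of moves can be completed.\<close>

definition N :: nat where "N = 4 * p"

lemma p_ge_2: "2 \<le> p"
  using k_pos self_le_power[of "2::nat" k] by (simp add: p_def)

lemma two_power_Suc_k: "2 ^ (k + 1) = 2 * p" "2 ^ Suc k = 2 * p"
  by (simp_all add: p_def)

abbreviation B :: "bipartition \<Rightarrow> nat set" where "B \<equiv> beads N"

lemma fits: "odd_bip x \<Longrightarrow> bip_rank x \<le> 2 * p \<Longrightarrow> fits N x"
  by (rule fits_if_rank_le) (auto simp: odd_bip_def N_def)

definition low :: "bipartition set" where "low = {x. odd_bip x \<and> bip_rank x < p}"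
definition high :: "bipartition set" where "high = {x. odd_bip x \<and> p \<le> bip_rank x \<and> bip_rank x < 2 * p}"

lemma nodes_low: "nodes (M2k k) = low"
  by (simp add: nodes_M2k low_def p_def)

lemma nodes_Suc: "nodes (M2k (Suc k)) = low \<union> high"
  unfolding nodes_M2k two_power_Suc_k by (auto simp: low_def high_def)

lemma low_fits: "x \<in> low \<Longrightarrow> fits N x" and high_fits: "x \<in> high \<Longrightarrow> fits N x"
  by (auto simp: low_def high_def intro: fits)

lemma low_odd_beads: "x \<in> low \<Longrightarrow> odd_beads N (bip_rank x) (B x)"
  using odd_beads_beads_iff[OF low_fits] by (simp add: low_def)

lemma high_odd_beads: "x \<in> high \<Longrightarrow> odd_beads N (p + (bip_rank x - p)) (B x)"
  using odd_beads_beads_iff[OF high_fits] by (simp add: high_def)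

text \<open>The core relation on nodes: \<open>x\<close> is the core of \<open>w\<close>.\<close>

definition lift :: "bipartition \<Rightarrow> bipartition \<Rightarrow> bool" where
  "lift x w \<longleftrightarrow> x \<in> low \<and> w \<in> high \<and> bead_move (2 * p) (B x) (B w)"

lemma lift_rank: "lift x w \<Longrightarrow> bip_rank w = bip_rank x + p"
  using bead_move_card_sum(2)[of "2 * p" "B x" "B w"] sum_beads[OF low_fits, of x] sum_beads[OF high_fits, of w]
  by (simp add: lift_def)

lemma ex1_core: "w \<in> high \<Longrightarrow> \<exists>!x. lift x w"
proof (rule ex_ex1I)
  assume w: "w \<in> high"
  let ?m = "bip_rank w - p"
  have m: "?m < p" using w by (auto simp: high_def)
  obtain C where "bead_move (2 * p) C (B w)" "odd_beads N ?m C"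
    using odd_beads_core_iff[of ?m k N "B w"] high_odd_beads[OF w] m by (auto simp: p_def)
  then show "\<exists>x. lift x w" using odd_beads_imp_beads[of N ?m C] w m
    unfolding lift_def low_def by (metis (no_types, lifting) mem_Collect_eq)
  show "x = y" if "lift x w" "lift y w" for x y
  proof -
    have "B x = B y" using that odd_beads_bead_move_unique[OF high_odd_beads[OF w] m] by (simp add: lift_def)
    then show ?thesis using that beads_inj[of N x y] low_fits by (simp add: lift_def)
  qed
qed

lemma bead_move_lift:
  assumes "x \<in> low" "bead_move (2 * p) (B x) S"
  obtains w where "lift x w" "B w = S"
proof -
  have "odd_beads N (p + bip_rank x) S"
    using odd_beads_core_iff[of "bip_rank x" k N S] low_odd_beads[OF assms(1)] assms by (auto simp: p_def low_def)
  then obtain w where w: "odd_bip w" "bip_rank w = p + bip_rank x" "B w = S" by (rule odd_beads_imp_beads)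
  then have "lift x w" using assms by (auto simp: lift_def low_def high_def)
  then show ?thesis using that w by blast
qed

lemma bead_move_parent: "odd_bip w \<Longrightarrow> 0 < bip_rank w \<Longrightarrow> fits N w \<Longrightarrow> bead_move 2 (B (parent w)) (B w)"
  using bead_move_beads_iff parent(2) by blast

lemma parent_low: "x \<in> low \<Longrightarrow> 0 < bip_rank x \<Longrightarrow> parent x \<in> low"
  using parent[of x] by (simp add: low_def)

lemma parent_high: "w \<in> high \<Longrightarrow> p < bip_rank w \<Longrightarrow> parent w \<in> high"
  using parent[of w] by (simp add: high_def)

text \<open>The core of the parent is the parent of the core: the square argument yields a move
  between the two cores, and the odd parent is unique.\<close>

lemma lift_parent:
  assumes "lift x w" "p < bip_rank w"
  shows "lift (parent x) (parent w)" "0 < bip_rank x"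
proof -
  have x: "x \<in> low" and w: "w \<in> high" and mv: "bead_move (2 * p) (B x) (B w)" using assms(1) by (auto simp: lift_def)
  show x0: "0 < bip_rank x" using lift_rank[OF assms(1)] assms(2) by simp
  have pw: "parent w \<in> high" using parent_high w assms(2) by simp
  obtain y where y: "lift y (parent w)" using ex1_core[OF pw] by blast
  have "bead_move 2 (B y) (B x)"
  proof (rule odd_beads_core_parent[OF low_odd_beads[OF x] _ high_odd_beads[OF pw] _ p_ge_2 mv])
    show "bead_move 2 (B (parent w)) (B w)" using bead_move_parent high_fits w assms(2) by (simp add: high_def)
    show "bead_move (2 * p) (B y) (B (parent w))" using y by (simp add: lift_def)
  qed (use x pw in \<open>auto simp: low_def high_def\<close>)
  then have "parent x = y" using parent_eqI_beads[of N y x] x y low_fits by (simp add: lift_def low_def)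
  then show "lift (parent x) (parent w)" using y by simp
qed

text \<open>Unique lifting of an edge upwards. The fourth corner of the square exists and is unique
  as a bead set, and it is odd because its core is.\<close>

lemma lift_child:
  assumes "x \<in> low" "0 < bip_rank x" "lift (parent x) w'"
  shows "\<exists>!w. lift x w \<and> parent w = w'"
proof (rule ex_ex1I)
  have px: "parent x \<in> low" and w': "w' \<in> high" and mv: "bead_move (2 * p) (B (parent x)) (B w')"
    using assms(3) by (auto simp: lift_def)
  have "\<exists>!S. bead_move (2 * p) (B x) S \<and> bead_move 2 (B w') S"
  proof (rule odd_beads_lift_child[OF low_odd_beads[OF px] _ p_ge_2 _ _ mv])
    show "bead_move 2 (B (parent x)) (B x)" using bead_move_parent low_fits assms by (simp add: low_def)
  qed (use px in \<open>auto simp: low_def N_def\<close>)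
  then obtain S where S: "bead_move (2 * p) (B x) S" "bead_move 2 (B w') S"
    and uniq: "\<And>T. bead_move (2 * p) (B x) T \<Longrightarrow> bead_move 2 (B w') T \<Longrightarrow> T = S" by blast
  obtain w where w: "lift x w" "B w = S" using bead_move_lift[OF assms(1) S(1)] by blast
  have "parent w = w'" using parent_eqI_beads[of N w' w] w S(2) w' high_fits by (auto simp: lift_def high_def)
  then show "\<exists>w. lift x w \<and> parent w = w'" using w by blast
  have "B v = S" if "lift x v" "parent v = w'" for v
  proof -
    have "p < bip_rank v" using lift_rank[OF that(1)] assms(2) by simp
    then show ?thesis
      using uniq bead_move_parent[of v] that high_fits[of v] by (auto simp: lift_def high_def)
  qed
  then show "v = w" if "lift x v \<and> parent v = w'" "lift x w \<and> parent w = w'" for v w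
    using that beads_inj[of N v w] high_fits by (metis lift_def)
qed

text \<open>The path from the root to \<open>x\<close> is lifted edge by edge, starting at
  \<open>u\<close>; induction on the rank of \<open>x\<close>.\<close>

lemma ex1_copy:
  assumes "odd_bip u" "bip_rank u = p" "x \<in> low"
  shows "\<exists>!w. lift x w \<and> ancestor p w = u"
  using assms(3)
proof (induction "bip_rank x" arbitrary: x)
  case 0
  have u: "u \<in> high" using assms p_ge_2 by (simp add: high_def)
  then obtain y where y: "lift y u" using ex1_core by blast
  then have "bip_rank y = 0" using lift_rank assms by fastforce
  then have "y = x" using y 0 bip_rank_0_iff by (auto simp: low_def lift_def)
  moreover have "w = u" if "lift x w" "ancestor p w = u" for w using lift_rank[OF that(1)] that 0 by simp
  ultimately show ?case using y assms by (intro ex1I[of _ u]) auto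
next
  case (Suc n)
  then have r: "0 < bip_rank x" "n = bip_rank (parent x)" using parent(3)[of x] by (auto simp: low_def)
  obtain w' where w': "lift (parent x) w'" "ancestor p w' = u"
    and uniq': "\<And>v. lift (parent x) v \<Longrightarrow> ancestor p v = u \<Longrightarrow> v = w'"
    using Suc.hyps(1)[OF r(2) parent_low[OF Suc.prems r(1)]] by blast
  obtain w where w: "lift x w" "parent w = w'" and uniq: "\<And>v. lift x v \<Longrightarrow> parent v = w' \<Longrightarrow> v = w"
    using lift_child[OF Suc.prems r(1) w'(1)] by blast
  have anc: "ancestor p v = ancestor p (parent v)" "p < bip_rank v" if "lift x v" for v
    using lift_rank[OF that] r(1) that ancestor_parent[of v p] by (auto simp: lift_def high_def)
  show ?case
  proof (rule ex1I[of _ w])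
    show "lift x w \<and> ancestor p w = u" using w w' anc(1)[OF w(1)] by simp
    show "v = w" if "lift x v \<and> ancestor p v = u" for v
      using that anc[of v] uniq uniq' lift_parent[of x v] by metis
  qed
qed

definition copy :: "bipartition \<Rightarrow> bipartition \<Rightarrow> bipartition" where
  "copy u x = (THE w. lift x w \<and> ancestor p w = u)"

lemma copy:
  assumes "odd_bip u" "bip_rank u = p" "x \<in> low"
  shows "lift x (copy u x)" "ancestor p (copy u x) = u"
  using theI'[OF ex1_copy[OF assms]] by (auto simp: copy_def)

lemma copy_eqI:
  assumes "lift x w" "ancestor p w = u"
  shows "copy u x = w"
proof -
  have w: "w \<in> high" "x \<in> low" using assms(1) by (auto simp: lift_def)
  then have "odd_bip u" "bip_rank u = p" using ancestor[of w p] assms(2) by (auto simp: high_def)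
  then show ?thesis using ex1_copy[OF _ _ w(2)] copy[OF _ _ w(2)] assms by blast
qed

lemma branch_high:
  assumes "odd_bip u" "bip_rank u = p"
  shows "branch_at (M2k (Suc k)) u = {w \<in> high. ancestor p w = u}"
proof -
  have "u \<in> nodes (M2k (Suc k))" using assms p_ge_2 by (simp add: nodes_Suc high_def)
  from branch_at_M2k[OF this] show ?thesis unfolding two_power_Suc_k by (auto simp: high_def assms)
qed

lemma nodes_grown_at:
  assumes "odd_bip u" "bip_rank u = p"
  shows "nodes (grown_at k u) = {w \<in> high. ancestor p w = u}"
  by (auto simp: grown_at_def induced_def branch_high[OF assms] nodes_Suc)

lemma copy_parent:
  assumes "odd_bip u" "bip_rank u = p" "x \<in> low" "0 < bip_rank x"
  shows "parent (copy u x) = copy u (parent x)" "p < bip_rank (copy u x)"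
proof -
  have l: "lift x (copy u x)" and a: "ancestor p (copy u x) = u" using copy[OF assms(1-3)] .
  show r: "p < bip_rank (copy u x)" using lift_rank[OF l] assms(4) by simp
  then have "ancestor p (parent (copy u x)) = u" using ancestor_parent[of "copy u x" p] l a by (simp add: lift_def high_def)
  then show "parent (copy u x) = copy u (parent x)" using copy_eqI lift_parent(1)[OF l r] by metis
qed

lemma edges_grown_at:
  assumes "odd_bip u" "bip_rank u = p"
  shows "edges (grown_at k u) = {{parent w, w} | w. w \<in> high \<and> ancestor p w = u \<and> p < bip_rank w}"
proof -
  have "edges (grown_at k u) = {e \<in> edges (M2k (Suc k)). e \<subseteq> {w \<in> high. ancestor p w = u}}"
    by (simp add: grown_at_def induced_def branch_high[OF assms])
  also have "\<dots> = {{parent w, w} | w. w \<in> high \<and> ancestor p w = u \<and> p < bip_rank w}"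
  proof (intro equalityI subsetI)
    fix e assume "e \<in> {e \<in> edges (M2k (Suc k)). e \<subseteq> {w \<in> high. ancestor p w = u}}"
    then obtain w where w: "e = {parent w, w}" "odd_bip w" "0 < bip_rank w" "e \<subseteq> {w \<in> high. ancestor p w = u}"
      unfolding edges_M2k by auto
    then have "p < bip_rank w" using parent(3)[of w] by (auto simp: high_def)
    then show "e \<in> {{parent w, w} | w. w \<in> high \<and> ancestor p w = u \<and> p < bip_rank w}" using w by blast
  next
    fix e assume "e \<in> {{parent w, w} | w. w \<in> high \<and> ancestor p w = u \<and> p < bip_rank w}"
    then obtain w where w: "e = {parent w, w}" "w \<in> high" "ancestor p w = u" "p < bip_rank w" by blast
    then have "ancestor p (parent w) = u" using ancestor_parent[of w p] by (simp add: high_def)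
    then show "e \<in> {e \<in> edges (M2k (Suc k)). e \<subseteq> {w \<in> high. ancestor p w = u}}"
      using w parent_high[OF w(2,4)] unfolding edges_M2k two_power_Suc_k by (auto simp: high_def)
  qed
  finally show ?thesis .
qed

lemma copy_inj:
  assumes "odd_bip u" "bip_rank u = p" "x \<in> low" "y \<in> low" "copy u x = copy u y"
  shows "x = y"
  using copy(1)[OF assms(1-3)] copy(1)[OF assms(1,2,4)] ex1_core[of "copy u x"] assms(5)
  by (auto simp: lift_def)

text \<open>Taking cores inverts \<open>copy u\<close>, and edges are carried over in both
  directions because \<open>parent\<close> commutes with \<open>copy u\<close>.\<close>

lemma rooted_iso_copy:
  assumes "odd_bip u" "bip_rank u = p"
  shows "rooted_iso (copy u) (M2k k) (grown_at k u)"
  unfolding rooted_iso_def nodes_low nodes_grown_at[OF assms]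
proof (intro conjI ballI)
  have inj: "inj_on (copy u) low" using copy_inj[OF assms] by (auto simp: inj_on_def)
  have "copy u ` low = {w \<in> high. ancestor p w = u}"
  proof (intro equalityI subsetI)
    fix w assume "w \<in> copy u ` low"
    then show "w \<in> {w \<in> high. ancestor p w = u}" using copy[OF assms] by (auto simp: lift_def)
  next
    fix w assume w: "w \<in> {w \<in> high. ancestor p w = u}"
    then obtain x where x: "lift x w" using ex1_core[of w] by auto
    then have "copy u x = w" "x \<in> low" using copy_eqI w by (auto simp: lift_def)
    then show "w \<in> copy u ` low" by blast
  qed
  then show "bij_betw (copy u) low {w \<in> high. ancestor p w = u}" using inj by (simp add: bij_betw_def)
  have up: "{copy u x, copy u y} \<in> edges (grown_at k u)" if "x \<in> low" "y \<in> low" "0 < bip_rank y" "x = parent y" for x y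
  proof -
    have "copy u x = parent (copy u y)" "p < bip_rank (copy u y)"
      using copy_parent[OF assms that(2,3)] that(4) by auto
    moreover have "copy u y \<in> high" "ancestor p (copy u y) = u" using copy[OF assms that(2)] by (auto simp: lift_def)
    ultimately show ?thesis
      unfolding edges_grown_at[OF assms] mem_Collect_eq by (intro exI[of _ "copy u y"]) simp
  qed
  have down: "0 < bip_rank y \<and> x = parent y" if "x \<in> low" "y \<in> low" "copy u x = parent (copy u y)" "p < bip_rank (copy u y)" for x y
  proof -
    have y: "0 < bip_rank y" using lift_rank[OF copy(1)[OF assms that(2)]] that(4) by simp
    then have "copy u x = copy u (parent y)" using copy_parent[OF assms that(2)] that(3) by simp
    then show ?thesis using copy_inj[OF assms that(1) parent_low[OF that(2) y]] y by simp
  qed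
  show "{x, y} \<in> edges (M2k k) \<longleftrightarrow> {copy u x, copy u y} \<in> edges (grown_at k u)" if "x \<in> low" "y \<in> low" for x y
  proof
    assume "{x, y} \<in> edges (M2k k)"
    then show "{copy u x, copy u y} \<in> edges (grown_at k u)"
      unfolding edges_M2k_iff using up[of x y] up[of y x] that by (auto simp: insert_commute)
  next
    assume "{copy u x, copy u y} \<in> edges (grown_at k u)"
    then have "\<exists>w. {copy u x, copy u y} = {parent w, w} \<and> w \<in> high \<and> ancestor p w = u \<and> p < bip_rank w"
      by (simp only: edges_grown_at[OF assms] mem_Collect_eq)
    then obtain w where w: "{copy u x, copy u y} = {parent w, w}" "p < bip_rank w" by blast
    moreover from w(1) have "(w = copy u y \<and> parent w = copy u x) \<or> (w = copy u x \<and> parent w = copy u y)"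
      by (simp add: doubleton_eq_iff) metis
    ultimately have "(copy u x = parent (copy u y) \<and> p < bip_rank (copy u y)) \<or> (copy u y = parent (copy u x) \<and> p < bip_rank (copy u x))"
      by metis
    then show "{x, y} \<in> edges (M2k k)"
      unfolding edges_M2k_iff using down[OF that] down[OF that(2,1)] that by (auto simp: low_def p_def)
  qed
  have "u \<in> high" using assms p_ge_2 by (simp add: high_def)
  then obtain y where y: "lift y u" using ex1_core by blast
  then have "bip_rank y = 0" using lift_rank assms by fastforce
  then have "y = ([], [])" using y bip_rank_0_iff by (auto simp: low_def lift_def)
  then show "copy u (root_node (M2k k)) = root_node (grown_at k u)"
    using copy_eqI[OF y, of u] assms by (simp add: M2k_def grown_at_def induced_def)
qed

end

section \<open>Hooks and branches\<close>

text \<open>Both branches are treated at once: \<open>t\<close> is the parity of the one bead that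
  has left the vacuum.\<close>

definition side_root :: "nat \<Rightarrow> bipartition" where
  "side_root t = (if t = 0 then ([1], []) else ([], [1]))"

definition side :: "nat \<Rightarrow> nat \<Rightarrow> bipartition set" where
  "side t j = branch_at M2 (side_root t) \<inter> nodes (M2k j)"

lemma side_branch: "left_branch j = side 0 j" "right_branch j = side 1 j"
  by (auto simp: side_def side_root_def left_branch_def right_branch_def)

lemma beads_side_root:
  assumes "t < 2" "0 < N"
  shows "beads N (side_root t) = hook_beads N (2 * N - 2 + t) 1" "fits N (side_root t)" "bip_rank (side_root t) = 1"
proof -
  have "t = 0 \<or> t = 1" using assms(1) by auto
  then show "beads N (side_root t) = hook_beads N (2 * N - 2 + t) 1"
  proof
    assume "t = 0"
    then show ?thesis using beads_hook(1)[of 1 1 N] assms(2)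
      by (simp add: side_root_def hook_partition_def diff_mult_distrib2)
  next
    assume t: "t = 1"
    have "2 * (N - 1 - (1 - 1)) + 1 = 2 * N - 2 + t" using t by simp
    then show ?thesis using beads_hook(2)[of 1 1 N] assms(2) t
      by (simp add: side_root_def hook_partition_def diff_mult_distrib2 del: add_2_eq_Suc add_2_eq_Suc')
  qed
  show "bip_rank (side_root t) = 1" by (simp add: side_root_def bip_rank.simps)
  show "fits N (side_root t)" using assms(2) by (auto simp: side_root_def fits_def bipartitions_def is_partition_def)
qed

lemma odd_side_root: "t < 2 \<Longrightarrow> odd_bip (side_root t)"
  using odd_beads_beads_iff[of 1 "side_root t" 1] beads_side_root[of t 1] odd_beads_power_two_iff[of 1 0]
  by auto

lemma rank_1_eq:
  assumes "odd_bip x" "bip_rank x = 1"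
  obtains t where "t < 2" "x = side_root t"
proof -
  have f: "fits 1 x" using assms fits_if_rank_le by (simp add: odd_bip_def)
  then have "odd_beads 1 (2 ^ 0) (beads 1 x)" using odd_beads_beads_iff assms by simp
  then obtain c where c: "c < 2" "beads 1 x = hook_beads 1 c 1" unfolding odd_beads_power_two_iff by auto
  then have "x = side_root c" using beads_side_root[of c 1] beads_inj[OF f] by simp
  then show ?thesis using that c(1) by blast
qed

lemma side_iff:
  assumes "t < 2"
  shows "w \<in> side t j \<longleftrightarrow> odd_bip w \<and> 0 < bip_rank w \<and> bip_rank w < 2 ^ j \<and> ancestor 1 w = side_root t"
  unfolding side_def branch_at_M2[OF odd_side_root[OF assms]] beads_side_root(3)[OF assms zero_less_one]
  by (auto simp: nodes_M2k Suc_le_eq)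

lemma side_disjoint: "side 0 j \<inter> side 1 j = {}"
  by (auto simp: side_iff side_root_def)

text \<open>The odd parent of a hook shortens its arm or its leg, which preserves the parity of
  \<open>c\<close> down to the single box. Hence the component of a hook tells its branch.\<close>

lemma ancestor_1_hook:
  assumes "odd_bip w" "fits N w" "beads N w = hook_beads N c (Suc n)" "c < 2 * N" "2 * N \<le> c + 2 * Suc n"
  shows "ancestor 1 w = side_root (c mod 2)"
  using assms
proof (induction n arbitrary: w c)
  case 0
  have "0 < N" using 0 by simp
  moreover have "c = 2 * N - 2 + c mod 2" using 0 by presburger
  ultimately have "w = side_root (c mod 2)"
    using beads_side_root[of "c mod 2" N] beads_inj[OF 0(2)] 0(3) by simp
  then show ?case using beads_side_root(3)[of "c mod 2" N] \<open>0 < N\<close> by simp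
next
  case (Suc n)
  have r: "bip_rank w = Suc (Suc n)"
    using sum_beads[OF Suc.prems(2)] hook_beads_sum[OF Suc.prems(4,5)] Suc.prems(3) by simp
  then have anc: "ancestor 1 w = ancestor 1 (parent w)" using ancestor_parent Suc.prems(1) by simp
  have pf: "odd_bip (parent w)" "fits N (parent w)" using parent[of w] fits_parent Suc.prems r by auto
  have "bead_move 2 (beads N (parent w)) (hook_beads N c (Suc (Suc n)))"
    using bead_move_beads_iff[OF Suc.prems(2)] parent(2)[of w] Suc.prems(1,3) r by auto
  from bead_move_hook_beads[OF Suc.prems(4,5) this] show ?case
  proof (elim disjE conjE)
    assume "beads N (parent w) = hook_beads N c (Suc n)" "2 * N \<le> c + 2 * Suc n"
    then show ?thesis using Suc.IH[OF pf] Suc.prems(4) anc by simp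
  next
    assume "beads N (parent w) = hook_beads N (c + 2) (Suc n)" "c + 2 < 2 * N"
    then show ?thesis using Suc.IH[OF pf, of "c + 2"] Suc.prems(5) anc by simp
  qed simp
qed

lemma hook_in_side_iff:
  assumes "odd_bip w" "fits N w" "beads N w = hook_beads N c (bip_rank w)" "c < 2 * N" "2 * N \<le> c + 2 * bip_rank w"
    and "bip_rank w < 2 ^ j" "t < 2"
  shows "w \<in> side t j \<longleftrightarrow> c mod 2 = t"
proof -
  obtain n where n: "bip_rank w = Suc n" using assms(4,5) by (cases "bip_rank w") auto
  have "ancestor 1 w = side_root (c mod 2)" using ancestor_1_hook[of w N c n] assms n by simp
  moreover have "side_root (c mod 2) = side_root t \<longleftrightarrow> c mod 2 = t" using assms(7) by (auto simp: side_root_def)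
  ultimately show ?thesis using side_iff[OF assms(7)] assms n by simp
qed

lemma mod_two_row: "t < 2 \<Longrightarrow> (2 * N - 2 + t) mod 2 = (t :: nat)"
proof -
  assume "t < 2"
  moreover have "2 * N - 2 + t = t + 2 * (N - 1)" by simp
  ultimately show ?thesis by simp
qed

lemma mod_two_col: "t < 2 \<Longrightarrow> n \<le> N \<Longrightarrow> (2 * N + t - 2 * n) mod 2 = (t :: nat)"
proof -
  assume "t < 2" "n \<le> N"
  moreover from this have "2 * N + t - 2 * n = t + 2 * (N - n)" by simp
  ultimately show ?thesis by simp
qed

text \<open>Within one parity class just two beads qualify: the highest one, giving the row, and the
  one landing on the first free position, giving the column.\<close>

lemma straight_cases:
  assumes "c mod 2 = t" "0 < n" "n \<le> N"
  shows "straight N c n \<longleftrightarrow> c = 2 * N - 2 + t \<or> c = 2 * N + t - 2 * n"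
proof
  obtain e where e: "c = 2 * e + t" using assms(1) by (metis mult_div_mod_eq)
  have t: "t = 0 \<or> t = 1" using assms(1) by auto
  assume s: "straight N c n"
  have "2 * e + t < 2 * N" "2 * N \<le> 2 * e + t + 2 * n" "2 * N \<le> 2 * e + t + 2 \<or> 2 * e + t + 2 * n \<le> 2 * N + 1"
    using s unfolding straight_def e by auto
  then have "e + 1 = N \<or> e + n = N" using t by auto
  then show "c = 2 * N - 2 + t \<or> c = 2 * N + t - 2 * n" unfolding e by auto
next
  have "t < 2" using assms(1) by auto
  assume "c = 2 * N - 2 + t \<or> c = 2 * N + t - 2 * n"
  then show "straight N c n" using assms \<open>t < 2\<close> unfolding straight_def by auto
qed

lemma odd_beads_straight: "straight N c n \<Longrightarrow> 0 < n \<Longrightarrow> odd_beads N n (hook_beads N c n)"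
  by (simp add: odd_beads_def paths_straight) (simp add: hook_beads_def)

lemma top_row_eq: "top_row j = {x. odd_bip x \<and> bip_rank x = 2 ^ j - 1}"
proof -
  have "0 < (2::nat) ^ j" by simp
  then show ?thesis unfolding top_row_def nodes_M2k by auto
qed

text \<open>The parameter \<open>t\<close> selects the component: even beads (\<open>t = 0\<close>) encode the first partition of a
  bipartition and odd beads (\<open>t = 1\<close>) the second.\<close>

definition row_bip :: "nat \<Rightarrow> nat \<Rightarrow> nat \<Rightarrow> bipartition" where
  "row_bip N t n = (THE x. fits N x \<and> beads N x = hook_beads N (2 * N - 2 + t) n)"

definition col_bip :: "nat \<Rightarrow> nat \<Rightarrow> nat \<Rightarrow> bipartition" where
  "col_bip N t n = (THE x. fits N x \<and> beads N x = hook_beads N (2 * N + t - 2 * n) n)"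

lemma straight_bip:
  assumes "straight N c n" "0 < n"
  defines "x \<equiv> (THE x. fits N x \<and> beads N x = hook_beads N c n)"
  shows "fits N x" "beads N x = hook_beads N c n" "odd_bip x" "bip_rank x = n" "one_dimensional x"
proof -
  obtain y where y: "fits N y" "odd_bip y" "bip_rank y = n" "beads N y = hook_beads N c n"
    using odd_beads_imp_beads[OF odd_beads_straight[OF assms(1,2)]] .
  have "x = y" unfolding x_def
  proof (rule the_equality)
    show "fits N y \<and> beads N y = hook_beads N c n" using y by simp
    show "z = y" if "fits N z \<and> beads N z = hook_beads N c n" for z using beads_inj[OF _ y(1), of z] that y(4) by simp
  qed
  moreover have "one_dimensional y" using one_dimensional_iff_beads[OF y(1)] y assms(1,2) by auto
  ultimately show "fits N x" "beads N x = hook_beads N c n" "odd_bip x" "bip_rank x = n" "one_dimensional x"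
    using y by auto
qed

lemma row_bip:
  assumes "t < 2" "0 < n" "n \<le> N"
  shows "fits N (row_bip N t n)" "beads N (row_bip N t n) = hook_beads N (2 * N - 2 + t) n"
    "odd_bip (row_bip N t n)" "bip_rank (row_bip N t n) = n" "one_dimensional (row_bip N t n)"
proof -
  have "straight N (2 * N - 2 + t) n" using assms by (auto simp: straight_def)
  from straight_bip[OF this assms(2)]
  show "fits N (row_bip N t n)" "beads N (row_bip N t n) = hook_beads N (2 * N - 2 + t) n"
    "odd_bip (row_bip N t n)" "bip_rank (row_bip N t n) = n" "one_dimensional (row_bip N t n)"
    unfolding row_bip_def by auto
qed

lemma col_bip:
  assumes "t < 2" "0 < n" "n \<le> N"
  shows "fits N (col_bip N t n)" "beads N (col_bip N t n) = hook_beads N (2 * N + t - 2 * n) n"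
    "odd_bip (col_bip N t n)" "bip_rank (col_bip N t n) = n" "one_dimensional (col_bip N t n)"
proof -
  have "straight N (2 * N + t - 2 * n) n" using assms by (auto simp: straight_def)
  from straight_bip[OF this assms(2)]
  show "fits N (col_bip N t n)" "beads N (col_bip N t n) = hook_beads N (2 * N + t - 2 * n) n"
    "odd_bip (col_bip N t n)" "bip_rank (col_bip N t n) = n" "one_dimensional (col_bip N t n)"
    unfolding col_bip_def by auto
qed

lemma row_ne_col:
  assumes "t < 2" "2 \<le> n" "n \<le> N"
  shows "row_bip N t n \<noteq> col_bip N t n"
proof
  assume "row_bip N t n = col_bip N t n"
  then have "hook_beads N (2 * N - 2 + t) n = hook_beads N (2 * N + t - 2 * n) n"
    using row_bip(2)[of t n N] col_bip(2)[of t n N] assms by simp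
  then have "2 * N - 2 + t = 2 * N + t - 2 * n" by (rule hook_beads_inj(1)[rotated 4]) (use assms in auto)
  then show False using assms by simp
qed

lemma one_dim_side:
  assumes "t < 2" "2 ^ j - 1 \<le> N" "2 \<le> j"
  shows "top_one_dim j \<inter> side t j = {row_bip N t (2 ^ j - 1), col_bip N t (2 ^ j - 1)}"
proof -
  define n where "n = (2 ^ j - 1 :: nat)"
  have "(2::nat) ^ 2 \<le> 2 ^ j" using assms(3) by (intro power_increasing) auto
  then have n: "0 < n" "n \<le> N" "n < 2 ^ j" using assms(2) by (auto simp: n_def)
  have "x \<in> top_one_dim j \<inter> side t j \<longleftrightarrow> x = row_bip N t n \<or> x = col_bip N t n" for x
  proof
    assume x: "x \<in> top_one_dim j \<inter> side t j"
    then have o: "odd_bip x" "bip_rank x = n" "one_dimensional x" by (auto simp: top_one_dim_def top_row_eq n_def)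
    have f: "fits N x" using fits_if_rank_le o n(2) by (simp add: odd_bip_def)
    obtain c where c: "straight N c n" "beads N x = hook_beads N c n"
      using one_dimensional_iff_beads[OF f] o n by auto
    have "c mod 2 = t" using hook_in_side_iff[OF o(1) f _ _ _ _ assms(1), of c j] c o n x by (auto simp: straight_def)
    then have "c = 2 * N - 2 + t \<or> c = 2 * N + t - 2 * n" using straight_cases[of c t n N] c(1) n by simp
    then show "x = row_bip N t n \<or> x = col_bip N t n"
      using c(2) row_bip(1,2)[OF assms(1) n(1,2)] col_bip(1,2)[OF assms(1) n(1,2)] beads_inj[OF f] by metis
  next
    have s: "y \<in> side t j" if "odd_bip y" "fits N y" "beads N y = hook_beads N c n" "bip_rank y = n" "straight N c n" "c mod 2 = t" for y c
      using hook_in_side_iff[OF that(1,2) _ _ _ _ assms(1), of c j] that n by (simp add: straight_def)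
    have c: "straight N (2 * N - 2 + t) n" "(2 * N - 2 + t) mod 2 = t"
      "straight N (2 * N + t - 2 * n) n" "(2 * N + t - 2 * n) mod 2 = t"
      using straight_cases[of "2 * N - 2 + t" t n N] straight_cases[of "2 * N + t - 2 * n" t n N] n
        mod_two_row[OF assms(1), of N] mod_two_col[OF assms(1) n(2)] by simp_all
    assume "x = row_bip N t n \<or> x = col_bip N t n"
    then show "x \<in> top_one_dim j \<inter> side t j"
    proof
      note r = row_bip[OF assms(1) n(1,2)]
      assume x: "x = row_bip N t n"
      have "x \<in> side t j" unfolding x using s[OF r(3,1,2,4) c(1,2)] .
      then show ?thesis using r(3-5) x by (simp add: top_one_dim_def top_row_eq n_def)
    next
      note r = col_bip[OF assms(1) n(1,2)]
      assume x: "x = col_bip N t n"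
      have "x \<in> side t j" unfolding x using s[OF r(3,1,2,4) c(3,4)] .
      then show ?thesis using r(3-5) x by (simp add: top_one_dim_def top_row_eq n_def)
    qed
  qed
  then show ?thesis by (auto simp: n_def)
qed

lemma card_one_dim_side:
  assumes "t < 2" "2 \<le> j"
  shows "card (top_one_dim j \<inter> side t j) = 2"
proof -
  have "(2::nat) ^ 2 \<le> 2 ^ j" using assms(2) by (intro power_increasing) auto
  then show ?thesis
    using one_dim_side[OF assms(1) order_refl assms(2)] row_ne_col[OF assms(1), of "2 ^ j - 1" "2 ^ j - 1"] by simp
qed

lemma one_dim_is_hook:
  assumes "one_dimensional x" "x \<in> bipartitions" "0 < bip_rank x"
  shows "is_hook x"
proof -
  have f: "fits (bip_rank x) x" using assms fits_if_rank_le by simp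
  show ?thesis using one_dimensional_iff_beads[OF f assms(3)] is_hook_rank_iff_beads[OF f] assms(1)
    by (auto simp: straight_def)
qed

lemma hook_in_some_side:
  assumes "odd_bip x" "0 < bip_rank x" "bip_rank x < 2 ^ j"
  shows "x \<in> side 0 j \<or> x \<in> side 1 j"
proof -
  have "odd_bip (ancestor 1 x)" "bip_rank (ancestor 1 x) = 1" using ancestor[of x 1] assms by auto
  then obtain t where "t < 2" "ancestor 1 x = side_root t" by (rule rank_1_eq)
  then have "t = 0 \<or> t = 1" "ancestor 1 x = side_root t" by auto
  then show ?thesis using side_iff[of 0 x j] side_iff[of 1 x j] assms by auto
qed

context level
begin

lemma rank_p_hook:
  assumes "odd_bip u" "bip_rank u = p"
  obtains c where "c < 2 * N" "2 * N \<le> c + 2 * p" "B u = hook_beads N c p"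
proof -
  have "odd_beads N (2 ^ k) (B u)" using odd_beads_beads_iff[OF fits] assms by (simp add: p_def)
  then have "\<exists>c. c < 2 * N \<and> 2 * N \<le> c + 2 * p \<and> B u = hook_beads N c p"
    unfolding odd_beads_power_two_iff p_def .
  then show ?thesis using that by blast
qed

lemma hook_rank_p:
  assumes "c < 2 * N" "2 * N \<le> c + 2 * p"
  obtains u where "odd_bip u" "bip_rank u = p" "B u = hook_beads N c p" "fits N u"
proof -
  have "odd_beads N p (hook_beads N c p)"
    using assms odd_beads_power_two_iff[of N k] unfolding p_def[symmetric] by blast
  then show ?thesis using that odd_beads_imp_beads by metis
qed

lemma top_row_p: "top_row k = {x. odd_bip x \<and> bip_rank x = p - 1}"
  by (simp add: top_row_eq p_def)

lemma attached_eq: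
  assumes "v \<in> top_row k"
  shows "attached k v = {u. odd_bip u \<and> bip_rank u = p \<and> parent u = v}"
proof -
  have "bip_rank v < p" using assms p_ge_2 by (simp add: top_row_p)
  then have "{v, u} \<in> edges (M2k (Suc k)) \<longleftrightarrow> odd_bip u \<and> v = parent u" if "bip_rank u = p" for u
    unfolding edges_M2k_iff two_power_Suc_k using that p_ge_2 parent(3)[of v] by auto
  then show ?thesis using p_ge_2 unfolding attached_def by (auto simp: nodes_M2k p_def[symmetric])
qed

text \<open>Removing a box from a hook leaves a hook, unless nothing is left; \<open>p\<close> being
  at least 2 rules that out. This is why nothing is attached to the other nodes of the top
  row.\<close>

lemma parent_rank_p_hook:
  assumes "odd_bip u" "bip_rank u = p"
  shows "is_hook (parent u)"
proof -
  obtain c where c: "c < 2 * N" "2 * N \<le> c + 2 * p" "B u = hook_beads N c p" using rank_p_hook[OF assms] .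
  obtain n where n: "p = Suc n" "0 < n" using p_ge_2 by (cases p) auto
  have fu: "fits N u" using fits assms by simp
  have f: "fits N (parent u)" using fits_parent[OF fu] parent(2) assms n by simp
  have "bead_move 2 (B (parent u)) (hook_beads N c (Suc n))" using bead_move_parent[of u] assms fu c n by simp
  from bead_move_hook_beads[OF _ _ this] have
    "(B (parent u) = hook_beads N c n \<and> 2 * N \<le> c + 2 * n) \<or> (B (parent u) = hook_beads N (c + 2) n \<and> c + 2 < 2 * N)"
    using c n by auto
  then show ?thesis
  proof (elim disjE conjE)
    assume "B (parent u) = hook_beads N c n" "2 * N \<le> c + 2 * n"
    then show ?thesis unfolding is_hook_iff_beads[OF f] using c n by blast
  next
    assume "B (parent u) = hook_beads N (c + 2) n" "c + 2 < 2 * N"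
    moreover have "2 * N \<le> c + 2 + 2 * n" using c n by simp
    ultimately show ?thesis unfolding is_hook_iff_beads[OF f] using n by blast
  qed
qed

lemma parent_rank_p_top:
  assumes "odd_bip u" "bip_rank u = p"
  shows "parent u \<in> top_hooks k"
  using parent[of u] parent_rank_p_hook[OF assms] assms p_ge_2 by (simp add: top_hooks_def top_row_p)

lemma attachments_eq: "attachments k = {(parent u, u) | u. odd_bip u \<and> bip_rank u = p}"
proof -
  have "(v, u) \<in> attachments k \<longleftrightarrow> odd_bip u \<and> bip_rank u = p \<and> v = parent u" for v u
    using attached_eq[of v] parent_rank_p_top[of u] by (auto simp: attachments_def top_hooks_def)
  then show ?thesis by auto
qed

text \<open>Every hook with \<open>p\<close> boxes is odd, being one long move away from the vacuum.
  So lengthening the arm and lengthening the leg of \<open>v\<close> both give nodes, and no other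
  hook has \<open>v\<close> as its parent.\<close>

lemma card_attached:
  assumes "v \<in> top_row k" "is_hook v"
  shows "card (attached k v) = 2"
proof -
  obtain n where n: "p = Suc n" "0 < n" using p_ge_2 by (cases p) auto
  have v: "odd_bip v" "bip_rank v = n" using assms(1) n by (auto simp: top_row_p)
  then have fv: "fits N v" using fits n by simp
  obtain c where c: "c < 2 * N" "2 * N \<le> c + 2 * n" "B v = hook_beads N c n"
    using is_hook_rank_iff_beads[OF fv] assms(2) v by auto
  have c2: "2 \<le> c" using c n by (simp add: N_def)
  obtain u1 where u1: "odd_bip u1" "bip_rank u1 = p" "B u1 = hook_beads N c p" "fits N u1"
    using hook_rank_p[of c] c n by auto
  obtain u2 where u2: "odd_bip u2" "bip_rank u2 = p" "B u2 = hook_beads N (c - 2) p" "fits N u2"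
  proof (rule hook_rank_p)
    show "c - 2 < 2 * N" "2 * N \<le> c - 2 + 2 * p" using c c2 n by auto
  qed
  have "parent u1 = v"
    using parent_eqI_beads[OF fv u1(4) v(1) u1(1)] hook_beads_arm[OF c(1,2)] u1(3) c(3) n by simp
  moreover have "parent u2 = v"
  proof -
    have e: "c - 2 + 2 = c" using c2 by simp
    have "2 * N \<le> c - 2 + 2 * Suc n" using c c2 by simp
    then have "bead_move 2 (B v) (B u2)" using hook_beads_leg[of "c - 2" N n] u2(3) c unfolding e n(1) by simp
    then show ?thesis by (rule parent_eqI_beads[OF fv u2(4) v(1) u2(1)])
  qed
  moreover have "u1 \<noteq> u2"
  proof
    assume "u1 = u2"
    then have "hook_beads N c p = hook_beads N (c - 2) p" using u1 u2 by simp
    then have "c = c - 2" by (rule hook_beads_inj(1)[rotated 4]) (use c c2 n in auto)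
    then show False using c2 by simp
  qed
  moreover have "u = u1 \<or> u = u2" if u: "odd_bip u" "bip_rank u = p" "parent u = v" for u
  proof -
    have fu: "fits N u" using fits u by simp
    obtain d where d: "d < 2 * N" "2 * N \<le> d + 2 * p" "B u = hook_beads N d p" using rank_p_hook[OF u(1,2)] .
    have "bead_move 2 (hook_beads N c n) (hook_beads N d (Suc n))"
      using bead_move_parent[of u] u fu d c n by simp
    then have "d = c \<or> d + 2 = c" using bead_move_onto_hook_beads[OF c(1,2)] d n by simp
    then have "B u = B u1 \<or> B u = B u2" using d(3) u1(3) u2(3) by auto
    then show ?thesis using beads_inj[OF fu u1(4)] beads_inj[OF fu u2(4)] by blast
  qed
  ultimately have "attached k v = {u1, u2}" using u1 u2 unfolding attached_eq[OF assms(1)] by blast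
  then show ?thesis using \<open>u1 \<noteq> u2\<close> by simp
qed

lemma attached_not_hook: "v \<in> top_row k \<Longrightarrow> \<not> is_hook v \<Longrightarrow> attached k v = {}"
  using attached_eq parent_rank_p_hook by auto

lemma high_ancestor: "w \<in> high \<Longrightarrow> odd_bip (ancestor p w) \<and> bip_rank (ancestor p w) = p"
  using ancestor[of w p] by (simp add: high_def)

lemma nodes_step: "nodes (M2k (Suc k)) = nodes (M2k k) \<union> (\<Union>(v, u)\<in>attachments k. nodes (grown_at k u))"
proof -
  have "(\<Union>(v, u)\<in>attachments k. nodes (grown_at k u)) = (\<Union>u\<in>{u. odd_bip u \<and> bip_rank u = p}. nodes (grown_at k u))"
    unfolding attachments_eq by blast
  also have "\<dots> = high"
  proof (intro equalityI subsetI)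
    fix w assume w: "w \<in> high"
    then have "w \<in> nodes (grown_at k (ancestor p w))" using nodes_grown_at high_ancestor[OF w] by simp
    then show "w \<in> (\<Union>u\<in>{u. odd_bip u \<and> bip_rank u = p}. nodes (grown_at k u))" using high_ancestor[OF w] by blast
  qed (auto simp: nodes_grown_at)
  finally show ?thesis by (simp add: nodes_Suc nodes_low)
qed

text \<open>Edges are sorted by the rank of their upper end: below \<open>p\<close> they are old, at
  \<open>p\<close> they attach a copy, and above \<open>p\<close> they lie inside the copy given by
  the ancestor of rank \<open>p\<close>.\<close>

lemma edges_step: "edges (M2k (Suc k)) = edges (M2k k) \<union> (\<Union>(v, u)\<in>attachments k. insert {v, u} (edges (grown_at k u)))"
proof (intro equalityI subsetI)
  fix e assume "e \<in> edges (M2k (Suc k))"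
  then obtain y where y: "e = {parent y, y}" "odd_bip y" "0 < bip_rank y" "bip_rank y < 2 * p"
    unfolding edges_M2k two_power_Suc_k by blast
  consider "bip_rank y < p" | "bip_rank y = p" | "p < bip_rank y" by linarith
  then show "e \<in> edges (M2k k) \<union> (\<Union>(v, u)\<in>attachments k. insert {v, u} (edges (grown_at k u)))"
  proof cases
    case 1
    then show ?thesis using y unfolding edges_M2k p_def by blast
  next
    case 2
    then have "(parent y, y) \<in> attachments k" using y unfolding attachments_eq by blast
    then show ?thesis using y(1) by blast
  next
    case 3
    then have h: "y \<in> high" using y by (simp add: high_def)
    let ?u = "ancestor p y"
    have u: "odd_bip ?u" "bip_rank ?u = p" using high_ancestor[OF h] by auto
    then have "(parent ?u, ?u) \<in> attachments k" unfolding attachments_eq by blast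
    moreover have "e \<in> edges (grown_at k ?u)"
      unfolding edges_grown_at[OF u] mem_Collect_eq using h 3 y(1) by (intro exI[of _ y]) simp
    ultimately show ?thesis by blast
  qed
next
  fix e assume "e \<in> edges (M2k k) \<union> (\<Union>(v, u)\<in>attachments k. insert {v, u} (edges (grown_at k u)))"
  then consider "e \<in> edges (M2k k)" | v u where "(v, u) \<in> attachments k" "e = {v, u}"
    | v u where "(v, u) \<in> attachments k" "e \<in> edges (grown_at k u)" by blast
  then show "e \<in> edges (M2k (Suc k))"
  proof cases
    case 1
    then show ?thesis unfolding edges_M2k by fastforce
  next
    case 2
    then have "v = parent u" "odd_bip u" "bip_rank u = p" unfolding attachments_eq by auto
    then show ?thesis using 2(2) p_ge_2 unfolding edges_M2k two_power_Suc_k by auto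
  next
    case 3
    then show ?thesis by (simp add: grown_at_def induced_def)
  qed
qed

lemma grown_at_disjoint:
  assumes "odd_bip u" "bip_rank u = p"
  shows "nodes (M2k k) \<inter> nodes (grown_at k u) = {}"
    and "odd_bip u' \<Longrightarrow> bip_rank u' = p \<Longrightarrow> u \<noteq> u' \<Longrightarrow> nodes (grown_at k u) \<inter> nodes (grown_at k u') = {}"
  by (auto simp: nodes_grown_at assms nodes_low low_def high_def)

text \<open>For \<open>d = 0\<close> the copy at \<open>u\<close> lengthens the arm of a hook by \<open>p\<close>, for \<open>d = 2 * p\<close> its leg.\<close>

lemma copy_hook:
  assumes u: "odd_bip u" "bip_rank u = p" "fits N u"
    and d: "d = 0 \<or> d = 2 * p" and base: "bead_move 2 (B u) (hook_beads N (2 * N - 2 + t - d) (Suc p))"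
    and x: "x \<in> low" "bip_rank x = Suc n" "B x = hook_beads N c (Suc n)" "c < 2 * N" "2 * N \<le> c + 2 * Suc n" "c mod 2 = t"
  shows "B (copy u x) = hook_beads N (c - d) (Suc n + p)"
  using x
proof (induction n arbitrary: x c)
  have lifts: "\<exists>w. lift x w \<and> B w = hook_beads N (c - d) (m + p)"
    if "x \<in> low" "B x = hook_beads N c m" "c < 2 * N" "2 * N \<le> c + 2 * m" "m < p" for x c m
  proof -
    \<comment> \<open>For \<open>d = 0\<close> the raised bead rises by another
      \<open>2 * p\<close>; for \<open>d = 2 * p\<close> the bead at \<open>c - 2 * p\<close> fills
      the gap \<open>c\<close>, which moves the gap down.\<close>
    have "bead_move (2 * p) (hook_beads N c m) (hook_beads N (c - d) (m + p))"
      using d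
    proof
      assume "d = 0"
      then show ?thesis unfolding bead_move_def hook_beads_def
        using that p_ge_2 by (intro exI[of _ "c + 2 * m"]) auto
    next
      assume d: "d = 2 * p"
      have "2 * p \<le> c" using that by (simp add: N_def)
      then obtain e where e: "c = e + 2 * p" by (metis le_add_diff_inverse2)
      show ?thesis unfolding bead_move_def hook_beads_def
        using that p_ge_2 d e by (intro exI[of _ e]) auto
    qed
    then show ?thesis using bead_move_lift[OF that(1)] that(2) by metis
  qed
  {
    case 0
    \<comment> \<open>A single box forces \<open>c\<close> to be the highest vacuum bead of its
      parity, as in the hypothesis \<open>base\<close>.\<close>
    have "c = 2 * N - 2 + t" using 0 by presburger
    obtain w where w: "lift x w" "B w = hook_beads N (c - d) (1 + p)"
      using lifts[of x c 1] 0 p_ge_2 by auto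
    have h: "w \<in> high" and r: "bip_rank w = Suc p" using w(1) lift_rank[OF w(1)] 0 by (auto simp: lift_def)
    have "parent w = u"
      using parent_eqI_beads[OF u(3) high_fits[OF h] u(1)] base w(2) h \<open>c = 2 * N - 2 + t\<close> by (simp add: high_def)
    then have "ancestor p w = u" using ancestor_parent[of w p] h r u by (simp add: high_def)
    then show ?case using copy_eqI[OF w(1)] w(2) by simp
  next
    case (Suc n)
    have x: "odd_bip x" "0 < bip_rank x" "fits N x" "Suc (Suc n) < p" using Suc.prems low_fits by (auto simp: low_def)
    have px: "parent x \<in> low" "bip_rank (parent x) = Suc n" using parent_low parent(3)[of x] Suc.prems x by auto
    obtain w where w: "lift x w" "B w = hook_beads N (c - d) (Suc (Suc n) + p)"
      using lifts[of x c "Suc (Suc n)"] Suc.prems x by auto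
    have h: "w \<in> high" and r: "p < bip_rank w" using w(1) lift_rank[OF w(1)] x by (auto simp: lift_def)
    have lw: "lift (parent x) (parent w)" using lift_parent[OF w(1) r] by simp
    have cd: "d \<le> c" using d Suc.prems x by (auto simp: N_def)
    let ?w = "copy u (parent x)"
    have copy: "odd_bip ?w" "fits N ?w" "ancestor p ?w = u" "?w \<in> high"
      using copy[OF u(1,2) px(1)] high_fits by (auto simp: lift_def high_def)
    have "bead_move 2 (B (parent x)) (hook_beads N c (Suc (Suc n)))" using bead_move_parent[OF x(1-3)] Suc.prems by simp
    from bead_move_hook_beads[OF Suc.prems(4,5) this]
    \<comment> \<open>The box that separates \<open>x\<close> from its parent lies at the end of the
      arm or of the leg, and the same box separates the two lengthened hooks.\<close>
    have "bead_move 2 (B ?w) (B w)"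
    proof (elim disjE conjE)
      assume c: "B (parent x) = hook_beads N c (Suc n)" "2 * N \<le> c + 2 * Suc n"
      have "B ?w = hook_beads N (c - d) (Suc n + p)" using Suc.IH[OF px c(1) Suc.prems(4) c(2) Suc.prems(6)] .
      then show ?thesis using hook_beads_arm[of "c - d" N "Suc n + p"] w(2) Suc.prems(4) c(2) d cd by auto
    next
      assume c: "B (parent x) = hook_beads N (c + 2) (Suc n)" "c + 2 < 2 * N"
      have "B ?w = hook_beads N (c + 2 - d) (Suc n + p)"
        using Suc.IH[OF px c] Suc.prems(5,6) by simp
      moreover have "c + 2 - d = c - d + 2" using cd by simp
      moreover have "2 * N \<le> c - d + 2 * Suc (Suc n + p)" using Suc.prems(5) d cd by auto
      ultimately show ?thesis using hook_beads_leg[of "c - d" N "Suc n + p"] w(2) c(2) by simp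
    qed simp
    then have "parent w = ?w" using parent_eqI_beads[OF copy(2) high_fits[OF h] copy(1)] h by (simp add: high_def)
    then have "ancestor p w = u" using ancestor_parent[of w p] copy(3) h r by (simp add: high_def)
    then show ?case using copy_eqI[OF w(1)] w(2) by simp
  }
qed

abbreviation "u_row t \<equiv> row_bip N t p"
abbreviation "u_col t \<equiv> col_bip N t p"

lemma p_le_N: "0 < p" "p \<le> N" "p - 1 \<le> N" "0 < p - 1" "2 * p - 1 \<le> N" "2 \<le> 2 * p - 1"
  using p_ge_2 by (auto simp: N_def)

lemma copy_hook_row:
  assumes "t < 2" "x \<in> low" "bip_rank x = n" "B x = hook_beads N c n" "c < 2 * N" "2 * N \<le> c + 2 * n" "c mod 2 = t"
  shows "B (copy (u_row t) x) = hook_beads N c (n + p)"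
proof -
  obtain m where m: "n = Suc m" using assms by (cases n) auto
  note u = row_bip[OF assms(1) p_le_N(1,2)]
  have "bead_move 2 (B (u_row t)) (hook_beads N (2 * N - 2 + t - 0) (Suc p))"
    unfolding u(2) minus_nat.diff_0 by (rule hook_beads_arm) (use assms(1) p_ge_2 in \<open>auto simp: N_def\<close>)
  from copy_hook[OF u(3,4,1) _ this] show ?thesis using assms m by simp
qed

lemma copy_hook_col:
  assumes "t < 2" "x \<in> low" "bip_rank x = n" "B x = hook_beads N c n" "c < 2 * N" "2 * N \<le> c + 2 * n" "c mod 2 = t"
  shows "B (copy (u_col t) x) = hook_beads N (c - 2 * p) (n + p)"
proof -
  obtain m where m: "n = Suc m" using assms by (cases n) auto
  note u = col_bip[OF assms(1) p_le_N(1,2)]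
  have "2 * N + t - 2 * p = 2 * N - 2 + t - 2 * p + 2" using p_ge_2 by (simp add: N_def)
  then have "bead_move 2 (B (u_col t)) (hook_beads N (2 * N - 2 + t - 2 * p) (Suc p))"
    unfolding u(2) by (simp only:, intro hook_beads_leg) (use assms(1) p_ge_2 in \<open>auto simp: N_def\<close>)
  from copy_hook[OF u(3,4,1) _ this] show ?thesis using assms m by simp
qed

lemma top_hooks_side_iff:
  assumes "t < 2" "bip_rank x \<le> 2 * p" "0 < bip_rank x" "bip_rank x = 2 ^ j - 1"
  shows "x \<in> top_hooks j \<inter> side t j \<longleftrightarrow> odd_bip x \<and> (\<exists>c. c < 2 * N \<and> 2 * N \<le> c + 2 * bip_rank x \<and>
     B x = hook_beads N c (bip_rank x) \<and> c mod 2 = t)"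
proof (cases "odd_bip x")
  case True
  have f: "fits N x" using fits True assms(2) by simp
  have "bip_rank x < 2 ^ j" using assms(3,4) by simp
  then show ?thesis
    using hook_in_side_iff[OF True f _ _ _ _ assms(1), of _ j] is_hook_rank_iff_beads[OF f] True assms(4)
    by (auto simp: top_hooks_def top_row_eq)
qed (auto simp: top_hooks_def top_row_eq)

text \<open>Arm and leg add up to \<open>2 * p - 2\<close>, so at most one of them reaches
  \<open>p\<close>. Since \<open>w\<close> is odd it has a core, hence one of them does, and the
  core shortens it by \<open>p\<close>. The hook with arm and leg both \<open>p - 1\<close> has no
  core and is thereby excluded.\<close>

lemma hook_core_cases:
  assumes "odd_bip w" "bip_rank w = 2 * p - 1" "B w = hook_beads N c (2 * p - 1)" "c < 2 * N" "2 * N \<le> c + 2 * (2 * p - 1)"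
  obtains x where "lift x w" "bip_rank x = p - 1" "B x = hook_beads N (c + 2 * p) (p - 1)" "c + 2 * p < 2 * N"
  | x where "lift x w" "bip_rank x = p - 1" "B x = hook_beads N c (p - 1)" "2 * N \<le> c + 2 * (p - 1)"
proof -
  have h: "w \<in> high" using assms p_ge_2 by (simp add: high_def)
  then obtain x where x: "lift x w" using ex1_core by blast
  then have r: "bip_rank x = p - 1" using lift_rank assms(2) by fastforce
  have "bead_move (2 * p) (B x) (B w)" using x by (simp add: lift_def)
  then obtain y where y: "y \<notin> B w" "y + 2 * p \<in> B w" "B x = insert y (B w - {y + 2 * p})"
    using p_ge_2 by (auto simp: bead_move_iff_holes holes_def drop_bead_def)
  have e: "c + 2 * (2 * p - 1) = c + 2 * (p - 1) + 2 * p" using p_ge_2 by simp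
  consider "y = c" "c + 2 * p < 2 * N" | "y = c + 2 * (p - 1)" "2 * N \<le> y"
  proof -
    have "y = c \<or> 2 * N \<le> y" using y(1) unfolding assms(3) hook_beads_def by auto
    moreover have "y + 2 * p = c + 2 * (p - 1) + 2 * p \<or> y + 2 * p < 2 * N"
      using y(2) unfolding assms(3) hook_beads_def e by auto
    ultimately show ?thesis using that p_ge_2 by auto
  qed
  then show ?thesis
  proof cases
    case 1
    have "B x = hook_beads N (c + 2 * p) (p - 1)"
      unfolding y(3) assms(3) hook_beads_def e using 1 p_ge_2 assms(4,5) by auto
    then show ?thesis using that(1)[OF x r] 1 by simp
  next
    case 2
    have "B x = hook_beads N c (p - 1)"
      unfolding y(3) assms(3) hook_beads_def e using 2 p_ge_2 assms(4,5) by auto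
    then show ?thesis using that(2)[OF x r] 2 by simp
  qed
qed

text \<open>Sorting the top hooks by whether the core shortened the arm or the leg places them in
  the copy above the row or above the column of length \<open>p\<close>, respectively.\<close>

lemma hooks_step:
  assumes "t < 2"
  shows "top_hooks (Suc k) \<inter> side t (Suc k)
    = copy (u_row t) ` (top_hooks k \<inter> side t k) \<union> copy (u_col t) ` (top_hooks k \<inter> side t k)"
proof -
  have Suc: "w \<in> top_hooks (Suc k) \<inter> side t (Suc k) \<longleftrightarrow> odd_bip w \<and> bip_rank w = 2 * p - 1 \<and> (\<exists>c. c < 2 * N \<and>
     2 * N \<le> c + 2 * (2 * p - 1) \<and> B w = hook_beads N c (2 * p - 1) \<and> c mod 2 = t)" for w
  proof (cases "bip_rank w = 2 * p - 1")
    case True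
    then show ?thesis using top_hooks_side_iff[OF assms, of w "Suc k"] p_ge_2 unfolding two_power_Suc_k by simp
  next
    case False
    then show ?thesis unfolding top_hooks_def top_row_eq two_power_Suc_k by simp
  qed
  have low: "x \<in> top_hooks k \<inter> side t k \<longleftrightarrow> odd_bip x \<and> bip_rank x = p - 1 \<and> (\<exists>c. c < 2 * N \<and>
     2 * N \<le> c + 2 * (p - 1) \<and> B x = hook_beads N c (p - 1) \<and> c mod 2 = t)" for x
  proof (cases "bip_rank x = p - 1")
    case True
    then show ?thesis using top_hooks_side_iff[OF assms, of x k] p_ge_2 unfolding p_def[symmetric] by simp
  next
    case False
    then show ?thesis unfolding top_hooks_def top_row_p by simp
  qed
  note ur = row_bip[OF assms p_le_N(1,2)] and uc = col_bip[OF assms p_le_N(1,2)]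
  show ?thesis
  proof (intro equalityI subsetI)
    fix w assume "w \<in> top_hooks (Suc k) \<inter> side t (Suc k)"
    then obtain c where w: "odd_bip w" "bip_rank w = 2 * p - 1" "c < 2 * N" "2 * N \<le> c + 2 * (2 * p - 1)"
      "B w = hook_beads N c (2 * p - 1)" "c mod 2 = t" unfolding Suc by blast
    have fw: "fits N w" using fits w by simp
    have e: "p - 1 + p = 2 * p - 1" using p_ge_2 by simp
    from w(1,2,5,3,4) show "w \<in> copy (u_row t) ` (top_hooks k \<inter> side t k) \<union> copy (u_col t) ` (top_hooks k \<inter> side t k)"
    proof (cases rule: hook_core_cases)
      case (1 x)
      have xl: "x \<in> low" using 1 by (simp add: lift_def)
      have n: "2 * N \<le> c + 2 * p + 2 * (p - 1)" using w(4) p_ge_2 by simp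
      have m: "(c + 2 * p) mod 2 = t" using w(6) by simp
      have "B (copy (u_col t) x) = B w"
        using copy_hook_col[OF assms xl 1(2,3,4) n m] w(5) unfolding e by simp
      then have "copy (u_col t) x = w"
        using beads_inj[OF high_fits fw] copy(1)[OF uc(3,4) xl] by (simp add: lift_def)
      moreover have "x \<in> top_hooks k \<inter> side t k" unfolding low using 1 n m xl low_def by blast
      ultimately show ?thesis by blast
    next
      case (2 x)
      have xl: "x \<in> low" using 2 by (simp add: lift_def)
      have "B (copy (u_row t) x) = B w"
        using copy_hook_row[OF assms xl 2(2,3) w(3) 2(4) w(6)] w(5) unfolding e by simp
      then have "copy (u_row t) x = w"
        using beads_inj[OF high_fits fw] copy(1)[OF ur(3,4) xl] by (simp add: lift_def)
      moreover have "x \<in> top_hooks k \<inter> side t k" unfolding low using 2 w xl low_def by blast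
      ultimately show ?thesis by blast
    qed
  next
    fix w assume "w \<in> copy (u_row t) ` (top_hooks k \<inter> side t k) \<union> copy (u_col t) ` (top_hooks k \<inter> side t k)"
    then obtain x where x: "x \<in> top_hooks k \<inter> side t k" and w: "w = copy (u_row t) x \<or> w = copy (u_col t) x" by blast
    then obtain c where c: "odd_bip x" "bip_rank x = p - 1" "c < 2 * N" "2 * N \<le> c + 2 * (p - 1)"
      "B x = hook_beads N c (p - 1)" "c mod 2 = t" unfolding low by blast
    have xl: "x \<in> low" using c p_ge_2 by (simp add: low_def)
    have e: "p - 1 + p = 2 * p - 1" using p_ge_2 by simp
    have "lift x w" using w copy(1)[OF ur(3,4) xl] copy(1)[OF uc(3,4) xl] by (elim disjE) simp_all
    have "bip_rank w = bip_rank x + p" using lift_rank[OF \<open>lift x w\<close>] .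
    then have o: "odd_bip w" "bip_rank w = 2 * p - 1"
      using \<open>lift x w\<close> c(2) e by (simp_all add: lift_def high_def)
    from w show "w \<in> top_hooks (Suc k) \<inter> side t (Suc k)"
    proof
      assume "w = copy (u_row t) x"
      then have "B w = hook_beads N c (2 * p - 1)" using copy_hook_row[OF assms xl c(2,5,3,4,6)] e by simp
      moreover have "2 * N \<le> c + 2 * (2 * p - 1)" using c(4) by simp
      ultimately show ?thesis unfolding Suc using o c by blast
    next
      assume "w = copy (u_col t) x"
      then have "B w = hook_beads N (c - 2 * p) (2 * p - 1)" using copy_hook_col[OF assms xl c(2,5,3,4,6)] e by simp
      moreover have "2 * p \<le> c" using c(4) by (simp add: N_def)
      then obtain d where d: "c = d + 2 * p" by (metis le_add_diff_inverse2)
      have "2 * N \<le> c - 2 * p + 2 * (2 * p - 1)" "(c - 2 * p) mod 2 = t" "c - 2 * p < 2 * N"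
        using c(3,4,6) p_ge_2 unfolding d by auto
      ultimately show ?thesis unfolding Suc using o by blast
    qed
  qed
qed

text \<open>Lengthening the arm of a row gives a row, and lengthening the leg of a column gives a
  column.\<close>

lemma one_dim_step:
  assumes "t < 2"
  shows "copy (u_row t) (row_bip N t (p - 1)) = row_bip N t (2 * p - 1)"
    and "copy (u_col t) (col_bip N t (p - 1)) = col_bip N t (2 * p - 1)"
proof -
  note ur = row_bip[OF assms p_le_N(1,2)] and uc = col_bip[OF assms p_le_N(1,2)]
  note vr = row_bip[OF assms p_le_N(4,3)] and vc = col_bip[OF assms p_le_N(4,3)]
  have "0 < 2 * p - 1" using p_ge_2 by simp
  note wr = row_bip[OF assms this p_le_N(5)] and wc = col_bip[OF assms this p_le_N(5)]
  have e: "p - 1 + p = 2 * p - 1" using p_ge_2 by simp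
  have l: "row_bip N t (p - 1) \<in> low" "col_bip N t (p - 1) \<in> low" using vr vc p_ge_2 by (auto simp: low_def)
  have "B (copy (u_row t) (row_bip N t (p - 1))) = hook_beads N (2 * N - 2 + t) (p - 1 + p)"
    by (rule copy_hook_row[OF assms l(1) vr(4,2) _ _ mod_two_row[OF assms]]) (use assms p_ge_2 in \<open>auto simp: N_def\<close>)
  then show "copy (u_row t) (row_bip N t (p - 1)) = row_bip N t (2 * p - 1)"
    using beads_inj[OF high_fits wr(1)] copy(1)[OF ur(3,4) l(1)] wr(2) e by (simp add: lift_def)
  have "B (copy (u_col t) (col_bip N t (p - 1))) = hook_beads N (2 * N + t - 2 * (p - 1) - 2 * p) (p - 1 + p)"
    by (rule copy_hook_col[OF assms l(2) vc(4,2) _ _ mod_two_col[OF assms p_le_N(3)]])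
      (use assms p_ge_2 in \<open>auto simp: N_def\<close>)
  moreover have "2 * N + t - 2 * (p - 1) - 2 * p = 2 * N + t - 2 * (2 * p - 1)" using p_ge_2 by simp
  ultimately show "copy (u_col t) (col_bip N t (p - 1)) = col_bip N t (2 * p - 1)"
    using beads_inj[OF high_fits wc(1)] copy(1)[OF uc(3,4) l(2)] wc(2) e by (simp add: lift_def)
qed

end

section \<open>The bottom of the tree\<close>

definition children :: "bipartition \<Rightarrow> bipartition set" where
  "children x = {y. odd_bip y \<and> 0 < bip_rank y \<and> parent y = x}"

lemma children_rank: "y \<in> children x \<Longrightarrow> bip_rank y = Suc (bip_rank x)"
  using parent(3)[of y] by (auto simp: children_def)

lemma children_root: "children ([], []) = {side_root 0, side_root 1}"
proof -
  have "side_root t \<in> children ([], [])" if "t < 2" for t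
  proof -
    note r = odd_side_root[OF that] beads_side_root(3)[OF that zero_less_one]
    then have "bip_rank (parent (side_root t)) = 0" "odd_bip (parent (side_root t))"
      using parent(1,3)[OF r(1)] by simp_all
    then have "parent (side_root t) = ([], [])" using bip_rank_0_iff by blast
    then show ?thesis using r by (simp add: children_def)
  qed
  moreover have "y = side_root 0 \<or> y = side_root 1" if "y \<in> children ([], [])" for y
  proof -
    have "odd_bip y" "bip_rank y = 1" using that children_rank[OF that] by (auto simp: children_def bip_rank.simps)
    then obtain t where "t < 2" "y = side_root t" by (rule rank_1_eq)
    moreover from this have "t = 0 \<or> t = 1" by auto
    ultimately show ?thesis by auto
  qed
  ultimately show ?thesis by fastforce
qed

lemma card_children_root: "card (children ([], [])) = 2"
  by (simp add: children_root side_root_def)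

lemma up_neighbours_M2k:
  assumes "bip_rank x < 2 ^ k - 1"
  shows "up_neighbours (M2k k) x = children x"
proof -
  have "{x, y} \<in> edges (M2k k) \<and> bip_rank y = bip_rank x + 1 \<longleftrightarrow> y \<in> children x" for y
    unfolding edges_M2k_iff children_def using parent(3)[of y] parent(3)[of x] assms by auto
  moreover have "y \<in> children x \<Longrightarrow> y \<in> nodes (M2k k)" for y
    using children_rank[of y x] assms by (auto simp: nodes_M2k children_def)
  ultimately show ?thesis unfolding up_neighbours_def by blast
qed

text \<open>With two children everywhere below rank \<open>d\<close>, nodes are addressed by words
  of binary choices, and unique parents make the addresses unique.\<close>

lemma binary_tree_iso:
  assumes two: "\<And>x. odd_bip x \<Longrightarrow> bip_rank x < d \<Longrightarrow> card (children x) = 2"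
  shows "\<exists>\<psi> :: bool list \<Rightarrow> bipartition. bij_betw \<psi> {w. length w \<le> d} {x. odd_bip x \<and> bip_rank x \<le> d} \<and>
    \<psi> [] = ([], []) \<and> (\<forall>w. length w \<le> d \<longrightarrow> bip_rank (\<psi> w) = length w) \<and>
    (\<forall>b w. length w < d \<longrightarrow> parent (\<psi> (b # w)) = \<psi> w)"
proof -
  have "\<exists>f :: bool \<Rightarrow> bipartition. inj f \<and> children x = range f" if x: "odd_bip x" "bip_rank x < d" for x
  proof -
    obtain y z where "children x = {y, z}" "y \<noteq> z" using two[OF x] by (auto simp: card_2_iff)
    then show ?thesis by (intro exI[of _ "\<lambda>b. if b then y else z"]) (auto simp: inj_on_def UNIV_bool)
  qed
  then obtain ch :: "bipartition \<Rightarrow> bool \<Rightarrow> bipartition"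
    where ch: "\<And>x. odd_bip x \<Longrightarrow> bip_rank x < d \<Longrightarrow> inj (ch x) \<and> children x = range (ch x)" by metis
  \<comment> \<open>The head of a word is the last choice, matching the edges between
    \<open>w\<close> and \<open>b # w\<close>; hence \<open>foldr\<close>, which starts at the root
    with the end of the word.\<close>
  define \<psi> where "\<psi> w = foldr (\<lambda>b x. ch x b) w ([], [])" for w
  have \<psi>0: "\<psi> [] = ([], [])" and \<psi>S: "\<psi> (b # w) = ch (\<psi> w) b" for b w by (simp_all add: \<psi>_def)
  have r: "odd_bip (\<psi> w) \<and> bip_rank (\<psi> w) = length w" if "length w \<le> d" for w
    using that
  proof (induction w)
    case Nil
    then show ?case by (simp add: \<psi>0 bip_rank.simps)
  next
    case (Cons b w)
    then have c: "\<psi> (b # w) \<in> children (\<psi> w)" using ch[of "\<psi> w"] by (simp add: \<psi>S)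
    then show ?case using children_rank[OF c] Cons by (simp add: children_def)
  qed
  have par: "parent (\<psi> (b # w)) = \<psi> w" if "length w < d" for b w
  proof -
    have "\<psi> (b # w) \<in> children (\<psi> w)" using ch[of "\<psi> w"] r[of w] that by (simp add: \<psi>S)
    then show ?thesis by (simp add: children_def)
  qed
  have len: "length v = length w" if "length v \<le> d" "length w \<le> d" "\<psi> v = \<psi> w" for v w
    using r[OF that(1)] r[OF that(2)] that(3) by metis
  have inj: "v = w" if "length v \<le> d" "length w \<le> d" "\<psi> v = \<psi> w" for v w
    using that
  proof (induction v arbitrary: w)
    case Nil
    then show ?case using len[OF Nil] by simp
  next
    case (Cons b v)
    obtain b' w' where w: "w = b' # w'" using len[OF Cons.prems] by (cases w) auto
    then have "\<psi> v = \<psi> w'" using par[of v b] par[of w' b'] Cons.prems by simp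
    then have "v = w'" using Cons w by simp
    moreover have "b = b'" using ch[of "\<psi> v"] r[of v] Cons.prems w \<open>v = w'\<close> by (simp add: \<psi>S inj_eq)
    ultimately show ?case using w by simp
  qed
  have surj: "\<exists>w. length w \<le> d \<and> \<psi> w = x" if "odd_bip x" "bip_rank x \<le> d" for x
    using that
  proof (induction "bip_rank x" arbitrary: x)
    case 0
    then have "x = ([], [])" using bip_rank_0_iff by simp
    then show ?case using \<psi>0 by (intro exI[of _ "[]"]) simp
  next
    case (Suc n)
    then have p: "odd_bip (parent x)" "bip_rank (parent x) = n" using parent[of x] by auto
    then obtain w where w: "length w \<le> d" "\<psi> w = parent x" using Suc by (metis Suc_leD)
    then have "x \<in> range (ch (parent x))" using ch[of "parent x"] p Suc by (auto simp: children_def)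
    then obtain b where "x = \<psi> (b # w)" using w by (auto simp: \<psi>S)
    moreover have "length (b # w) \<le> d" using r[OF w(1)] w(2) p Suc by simp
    ultimately show ?case by blast
  qed
  have "bij_betw \<psi> {w. length w \<le> d} {x. odd_bip x \<and> bip_rank x \<le> d}"
    unfolding bij_betw_def
  proof
    show "inj_on \<psi> {w. length w \<le> d}" using inj by (intro inj_onI) simp
    show "\<psi> ` {w. length w \<le> d} = {x. odd_bip x \<and> bip_rank x \<le> d}"
    proof (intro equalityI subsetI)
      fix x assume "x \<in> \<psi> ` {w. length w \<le> d}"
      then show "x \<in> {x. odd_bip x \<and> bip_rank x \<le> d}" using r by auto
    next
      fix x assume "x \<in> {x. odd_bip x \<and> bip_rank x \<le> d}"
      then show "x \<in> \<psi> ` {w. length w \<le> d}" using surj by blast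
    qed
  qed
  then show ?thesis using \<psi>0 r par by (intro exI[of _ \<psi>]) simp
qed

lemma complete_binary_tree_iso:
  assumes "\<And>x. odd_bip x \<Longrightarrow> bip_rank x < 2 ^ k - 1 \<Longrightarrow> card (children x) = 2"
  obtains \<phi> where "rooted_iso \<phi> (M2k k) (complete_binary_tree (2 ^ k - 1))"
    "\<And>x. x \<in> nodes (M2k k) \<Longrightarrow> length (\<phi> x) = bip_rank x"
proof -
  let ?d = "2 ^ k - 1" let ?W = "{w :: bool list. length w \<le> ?d}"
  have "m \<le> ?d \<longleftrightarrow> m < 2 ^ k" for m :: nat using zero_less_power[of "2::nat" k] by linarith
  then have n: "{x. odd_bip x \<and> bip_rank x \<le> ?d} = nodes (M2k k)" unfolding nodes_M2k by simp
  obtain \<psi> :: "bool list \<Rightarrow> bipartition" where bij: "bij_betw \<psi> ?W (nodes (M2k k))" and \<psi>0: "\<psi> [] = ([], [])"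
    and r: "\<And>w. length w \<le> ?d \<Longrightarrow> bip_rank (\<psi> w) = length w"
    and par: "\<And>b w. length w < ?d \<Longrightarrow> parent (\<psi> (b # w)) = \<psi> w"
    using binary_tree_iso[of ?d, OF assms] unfolding n by blast
  define \<phi> where "\<phi> = inv_into ?W \<psi>"
  have \<phi>\<psi>: "\<phi> (\<psi> w) = w" if "length w \<le> ?d" for w
    using bij_betw_inv_into_left[OF bij] that by (simp add: \<phi>_def)
  have \<psi>\<phi>: "\<psi> (\<phi> x) = x" "length (\<phi> x) \<le> ?d" if "x \<in> nodes (M2k k)" for x
    using bij_betw_inv_into_right[OF bij that] bij_betw_apply[OF bij_betw_inv_into[OF bij] that] by (auto simp: \<phi>_def)
  have len: "length (\<phi> x) = bip_rank x" if "x \<in> nodes (M2k k)" for x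
    using r[OF \<psi>\<phi>(2)[OF that]] \<psi>\<phi>(1)[OF that] by simp
  have e: "0 < bip_rank y \<and> x = parent y \<longleftrightarrow> (\<exists>b. \<phi> y = b # \<phi> x \<and> length (\<phi> x) < ?d)"
    if xy: "x \<in> nodes (M2k k)" "y \<in> nodes (M2k k)" for x y
  proof
    assume y: "0 < bip_rank y \<and> x = parent y"
    then obtain b w where w: "\<phi> y = b # w" using len[OF xy(2)] by (cases "\<phi> y") auto
    then have "length w < ?d" using \<psi>\<phi>(2)[OF xy(2)] by simp
    then have "x = \<psi> w" using par[of w b] \<psi>\<phi>(1)[OF xy(2)] y w by simp
    then show "\<exists>b. \<phi> y = b # \<phi> x \<and> length (\<phi> x) < ?d" using \<phi>\<psi>[of w] w \<open>length w < ?d\<close> by simp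
  next
    assume "\<exists>b. \<phi> y = b # \<phi> x \<and> length (\<phi> x) < ?d"
    then obtain b where b: "\<phi> y = b # \<phi> x" "length (\<phi> x) < ?d" by blast
    have "parent y = x" using par[OF b(2), of b] \<psi>\<phi>(1)[OF xy(1)] \<psi>\<phi>(1)[OF xy(2)] b(1) by simp
    then show "0 < bip_rank y \<and> x = parent y" using len[OF xy(2)] b by auto
  qed
  have "rooted_iso \<phi> (M2k k) (complete_binary_tree ?d)"
    unfolding rooted_iso_def
  proof (intro conjI ballI)
    show "bij_betw \<phi> (nodes (M2k k)) (nodes (complete_binary_tree ?d))"
      using bij_betw_inv_into[OF bij] by (simp add: \<phi>_def complete_binary_tree_def)
    show "\<phi> (root_node (M2k k)) = root_node (complete_binary_tree ?d)"
      using \<phi>\<psi>[of "[]"] \<psi>0 by (simp add: complete_binary_tree_def M2k_def induced_def)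
    fix x y assume xy: "x \<in> nodes (M2k k)" "y \<in> nodes (M2k k)"
    have "{x, y} \<in> edges (M2k k) \<longleftrightarrow> (0 < bip_rank y \<and> x = parent y) \<or> (0 < bip_rank x \<and> y = parent x)"
      using xy unfolding edges_M2k_iff nodes_M2k by auto
    also have "\<dots> \<longleftrightarrow> (\<exists>b. \<phi> y = b # \<phi> x \<and> length (\<phi> x) < ?d) \<or> (\<exists>b. \<phi> x = b # \<phi> y \<and> length (\<phi> y) < ?d)"
      using e[OF xy] e[OF xy(2,1)] by simp
    also have "\<dots> \<longleftrightarrow> {\<phi> x, \<phi> y} \<in> edges (complete_binary_tree ?d)"
      unfolding complete_binary_tree_def by (auto simp: doubleton_eq_iff)
    finally show "{x, y} \<in> edges (M2k k) \<longleftrightarrow> {\<phi> x, \<phi> y} \<in> edges (complete_binary_tree ?d)" .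
  qed
  then show ?thesis using that len by blast
qed

lemma parent_row_bip:
  assumes "t < 2" "0 < n" "n < N"
  shows "parent (row_bip N t (Suc n)) = row_bip N t n"
proof -
  note v = row_bip[OF assms(1,2) less_imp_le[OF assms(3)]] and u = row_bip[OF assms(1) zero_less_Suc Suc_leI[OF assms(3)]]
  have "bead_move 2 (beads N (row_bip N t n)) (beads N (row_bip N t (Suc n)))"
    unfolding v(2) u(2) by (rule hook_beads_arm) (use assms in auto)
  then show ?thesis by (rule parent_eqI_beads[OF v(1) u(1) v(3) u(3)])
qed

lemma parent_col_bip:
  assumes "t < 2" "0 < n" "n < N"
  shows "parent (col_bip N t (Suc n)) = col_bip N t n"
proof -
  note v = col_bip[OF assms(1,2) less_imp_le[OF assms(3)]] and u = col_bip[OF assms(1) zero_less_Suc Suc_leI[OF assms(3)]]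
  have "2 * N + t - 2 * n = 2 * N + t - 2 * Suc n + 2" using assms by simp
  then have "bead_move 2 (beads N (col_bip N t n)) (beads N (col_bip N t (Suc n)))"
    unfolding v(2) u(2) by (simp only:, intro hook_beads_leg) (use assms in auto)
  then show ?thesis by (rule parent_eqI_beads[OF v(1) u(1) v(3) u(3)])
qed

context level
begin

lemma attachments_straight:
  assumes "t < 2"
  shows "(row_bip N t (p - 1), u_row t) \<in> attachments k" "(col_bip N t (p - 1), u_col t) \<in> attachments k"
proof -
  have s: "Suc (p - 1) = p" "0 < p - 1" "p - 1 < N" using p_ge_2 by (auto simp: N_def)
  show "(row_bip N t (p - 1), u_row t) \<in> attachments k" "(col_bip N t (p - 1), u_col t) \<in> attachments k"
    using parent_row_bip[OF assms s(2,3)] parent_col_bip[OF assms s(2,3)]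
      row_bip[OF assms p_le_N(1,2)] col_bip[OF assms p_le_N(1,2)]
    unfolding attachments_eq s(1) by auto
qed

text \<open>The copy above \<open>u\<close> starts like the tree itself, so the children of
  \<open>u\<close> are the copies of the two children of the root.\<close>

lemma card_children_rank_p:
  assumes "odd_bip u" "bip_rank u = p"
  shows "card (children u) = 2"
proof -
  have root: "([], []) \<in> low" using p_ge_2 by (simp add: low_def bip_rank.simps)
  have u0: "copy u ([], []) = u"
    using copy(2)[OF assms root] lift_rank[OF copy(1)[OF assms root]] by (simp add: bip_rank.simps)
  have cl: "x \<in> low" "0 < bip_rank x" "parent x = ([], [])" if "x \<in> children ([], [])" for x
    using that children_rank[OF that] p_ge_2 by (auto simp: children_def low_def bip_rank.simps)
  have "children u = copy u ` children ([], [])"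
  proof (intro equalityI subsetI)
    fix y assume y: "y \<in> children u"
    then have r: "bip_rank y = Suc p" using children_rank assms by simp
    then have h: "y \<in> high" using y p_ge_2 by (simp add: children_def high_def)
    then obtain x where x: "lift x y" using ex1_core by blast
    have "bip_rank x = Suc 0" using lift_rank[OF x] r by simp
    then have "x \<in> children ([], [])"
      using x parent[of x] bip_rank_0_iff[of "parent x"] by (auto simp: children_def lift_def low_def)
    moreover have "ancestor p y = u" using ancestor_parent[of y p] y r assms by (simp add: children_def)
    then have "copy u x = y" using copy_eqI[OF x] by simp
    ultimately show "y \<in> copy u ` children ([], [])" by blast
  next
    fix y assume "y \<in> copy u ` children ([], [])"
    then obtain x where x: "x \<in> children ([], [])" "y = copy u x" by blast
    have "parent y = u" using copy_parent(1)[OF assms cl(1,2)[OF x(1)]] x u0 cl(3) by simp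
    moreover have "odd_bip y" "0 < bip_rank y"
      using copy(1)[OF assms cl(1)[OF x(1)]] x p_ge_2 by (auto simp: lift_def high_def)
    ultimately show "y \<in> children u" by (simp add: children_def)
  qed
  moreover have "inj_on (copy u) (children ([], []))" using copy_inj[OF assms] cl(1) by (auto simp: inj_on_def)
  ultimately show ?thesis using card_children_root by (simp add: card_image)
qed

lemma branch_step:
  assumes "t < 2" "2 \<le> k"
  shows "\<exists>c. (\<forall>v\<in>top_one_dim k \<inter> side t k. (v, c v) \<in> attachments k) \<and>
      top_hooks (Suc k) \<inter> side t (Suc k) = (\<Union>v\<in>top_one_dim k \<inter> side t k. copy (c v) ` (top_hooks k \<inter> side t k))"
    and "\<exists>c d. (\<forall>v\<in>top_one_dim k \<inter> side t k. (v, c v) \<in> attachments k \<and> d v \<in> top_one_dim k \<inter> side t k) \<and>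
      top_one_dim (Suc k) \<inter> side t (Suc k) = (\<lambda>v. copy (c v) (d v)) ` (top_one_dim k \<inter> side t k)"
proof -
  let ?r = "row_bip N t (p - 1)" and ?c = "col_bip N t (p - 1)"
  \<comment> \<open>The row of length \<open>p - 1\<close> uses the copy above the row of length
    \<open>p\<close>, the column likewise the copy above the column.\<close>
  define c where "c v = (if v = ?r then u_row t else u_col t)" for v
  have "4 \<le> p" using power_increasing[OF assms(2), of "2::nat"] by (simp add: p_def)
  then have ne: "?r \<noteq> ?c" by (intro row_ne_col[OF assms(1)]) (auto simp: N_def)
  have one: "top_one_dim k \<inter> side t k = {?r, ?c}"
    unfolding p_def by (rule one_dim_side[OF assms(1) _ assms(2)]) (use p_le_N(3) p_def in simp)
  have "top_one_dim (Suc k) \<inter> side t (Suc k) = {row_bip N t (2 ^ Suc k - 1), col_bip N t (2 ^ Suc k - 1)}"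
    by (rule one_dim_side[OF assms(1)]) (use p_le_N(5) k_pos p_def in simp_all)
  then have oneS: "top_one_dim (Suc k) \<inter> side t (Suc k) = {row_bip N t (2 * p - 1), col_bip N t (2 * p - 1)}"
    by (simp add: p_def)
  show "\<exists>c. (\<forall>v\<in>top_one_dim k \<inter> side t k. (v, c v) \<in> attachments k) \<and>
      top_hooks (Suc k) \<inter> side t (Suc k) = (\<Union>v\<in>top_one_dim k \<inter> side t k. copy (c v) ` (top_hooks k \<inter> side t k))"
    unfolding one hooks_step[OF assms(1)]
    using attachments_straight[OF assms(1)] ne by (intro exI[of _ c]) (simp add: c_def)
  \<comment> \<open>With \<open>d\<close> the identity: in its chosen copy, the row (column) is
    continued by the node corresponding to that same row (column).\<close>
  show "\<exists>c d. (\<forall>v\<in>top_one_dim k \<inter> side t k. (v, c v) \<in> attachments k \<and> d v \<in> top_one_dim k \<inter> side t k) \<and>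
      top_one_dim (Suc k) \<inter> side t (Suc k) = (\<lambda>v. copy (c v) (d v)) ` (top_one_dim k \<inter> side t k)"
    unfolding one oneS
    using attachments_straight[OF assms(1)] ne one_dim_step[OF assms(1)]
    by (intro exI[of _ c] exI[of _ "\<lambda>v. v"]) (simp add: c_def)
qed

lemma attachments_sound:
  "(v, u) \<in> attachments k \<Longrightarrow> odd_bip u \<and> bip_rank u = p \<and> v = parent u"
  unfolding attachments_eq by auto

lemma attached_card:
  "\<forall>v\<in>top_row k. \<not> is_hook v \<longrightarrow> attached k v = {}"
  "\<forall>v\<in>top_row k. is_hook v \<longrightarrow> card (attached k v) = 2"
  using attached_not_hook card_attached by blast+

lemma copies_disjoint:
  "\<forall>(v, u)\<in>attachments k. nodes (M2k k) \<inter> nodes (grown_at k u) = {}"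
  "\<forall>(v, u)\<in>attachments k. \<forall>(v', u')\<in>attachments k.
     (v, u) \<noteq> (v', u') \<longrightarrow> nodes (grown_at k u) \<inter> nodes (grown_at k u') = {}"
proof -
  show "\<forall>(v, u)\<in>attachments k. nodes (M2k k) \<inter> nodes (grown_at k u) = {}"
    using grown_at_disjoint(1) attachments_sound by blast
  have "nodes (grown_at k u) \<inter> nodes (grown_at k u') = {}"
    if "(v, u) \<in> attachments k" "(v', u') \<in> attachments k" "(v, u) \<noteq> (v', u')" for v u v' u'
    using grown_at_disjoint(2)[of u u'] attachments_sound[OF that(1)] attachments_sound[OF that(2)] that(3) by blast
  then show "\<forall>(v, u)\<in>attachments k. \<forall>(v', u')\<in>attachments k.
     (v, u) \<noteq> (v', u') \<longrightarrow> nodes (grown_at k u) \<inter> nodes (grown_at k u') = {}" by fast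
qed

lemma copies_exist:
  assumes "2 \<le> k"
  shows "\<exists>\<phi>.
      (\<forall>(v, u)\<in>attachments k. rooted_iso (\<phi> u) (M2k k) (grown_at k u)) \<and>
      (\<forall>B\<in>{left_branch, right_branch}.
         (\<exists>c. (\<forall>v\<in>top_one_dim k \<inter> B k. (v, c v) \<in> attachments k) \<and>
              top_hooks (k + 1) \<inter> B (k + 1) =
                (\<Union>v\<in>top_one_dim k \<inter> B k. \<phi> (c v) ` (top_hooks k \<inter> B k))) \<and>
         card (top_one_dim k \<inter> B k) = 2 \<and>
         (\<exists>c d. (\<forall>v\<in>top_one_dim k \<inter> B k.
                   (v, c v) \<in> attachments k \<and> d v \<in> top_one_dim k \<inter> B k) \<and>
                top_one_dim (k + 1) \<inter> B (k + 1) =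
                  (\<lambda>v. \<phi> (c v) (d v)) ` (top_one_dim k \<inter> B k)))"
proof -
  have "\<forall>(v, u)\<in>attachments k. rooted_iso (copy u) (M2k k) (grown_at k u)"
    using rooted_iso_copy attachments_sound by blast
  moreover have t: "(0::nat) < 2" "(1::nat) < 2" by simp_all
  moreover have sides: "left_branch = side 0" "right_branch = side 1" by (auto simp: fun_eq_iff side_branch)
  ultimately show ?thesis
    unfolding Suc_eq_plus1[symmetric] sides ball_simps
    by (intro exI[of _ copy] conjI TrueI branch_step[OF t(1) assms] branch_step[OF t(2) assms]
        card_one_dim_side[OF t(1) assms] card_one_dim_side[OF t(2) assms])
qed

end

lemma top_one_dim_sides:
  assumes "1 \<le> j"
  shows "top_one_dim j = (top_one_dim j \<inter> side 0 j) \<union> (top_one_dim j \<inter> side 1 j)"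
proof -
  have "(2::nat) ^ 1 \<le> 2 ^ j" using assms by (intro power_increasing) auto
  then have "x \<in> side 0 j \<or> x \<in> side 1 j" if "x \<in> top_one_dim j" for x
    using that by (intro hook_in_some_side) (auto simp: top_one_dim_def top_row_eq)
  then show ?thesis by blast
qed

lemma card_top_one_dim:
  assumes "2 \<le> j"
  shows "card (top_one_dim j) = 4"
proof -
  have c: "card (top_one_dim j \<inter> side t j) = 2" if "t < 2" for t using card_one_dim_side[OF that assms] .
  have f: "finite (top_one_dim j \<inter> side t j)" if "t < 2" for t using c[OF that] by (intro card_ge_0_finite) simp
  have "card (top_one_dim j) = card (top_one_dim j \<inter> side 0 j) + card (top_one_dim j \<inter> side 1 j)"
    using top_one_dim_sides[of j] assms f[of 0] f[of 1] side_disjoint[of j]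
      card_Un_disjoint[of "top_one_dim j \<inter> side 0 j" "top_one_dim j \<inter> side 1 j"] by auto
  then show ?thesis using c[of 0] c[of 1] by simp
qed

text \<open>The doubling step for \<open>k = 1\<close>, where \<open>p = 2\<close>: rank 1 is the
  top row, consisting of hooks, and rank 2 is where the copies start.\<close>

lemma card_children_small:
  assumes "odd_bip x" "bip_rank x < 3"
  shows "card (children x) = 2"
proof -
  interpret level 1 by unfold_locales simp
  have p: "p = 2" unfolding p_def by simp
  consider "bip_rank x = 0" | "bip_rank x = 1" | "bip_rank x = p" using assms(2) p by linarith
  then show ?thesis
  proof cases
    case 1
    then show ?thesis using bip_rank_0_iff[OF assms(1)] card_children_root by simp
  next
    case 2
    obtain t where t: "t < 2" "x = side_root t" using rank_1_eq[OF assms(1) 2] .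
    have "is_hook x"
    proof -
      have "is_hook_partition [1]" unfolding is_hook_partition_def by (intro exI[of _ 1]) simp
      then show ?thesis by (simp add: t(2) side_root_def)
    qed
    moreover have x: "x \<in> top_row 1" using assms(1) 2 unfolding top_row_p p by simp
    ultimately have "card (attached 1 x) = 2" using card_attached by simp
    moreover have "attached 1 x = children x"
    proof -
      have "y \<in> children x \<Longrightarrow> bip_rank y = 2" for y using children_rank[of y x] 2 by simp
      then show ?thesis unfolding attached_eq[OF x] p by (auto simp: children_def)
    qed
    ultimately show ?thesis by simp
  next
    case 3
    then show ?thesis using card_children_rank_p assms by simp
  qed
qed

text \<open>With \<open>p = 2\<close> an odd hook of three boxes has arm or leg of length 2, so it
  is a row or a column; the bent hook of three boxes has no core.\<close>

lemma hook_rank_3: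
  assumes "odd_bip w" "bip_rank w = 3" "is_hook w"
  shows "one_dimensional w"
proof -
  interpret level 1 by unfold_locales simp
  have p: "p = 2" unfolding p_def by simp
  have f: "fits N w" using fits assms p by simp
  obtain c where c: "c < 2 * N" "2 * N \<le> c + 2 * 3" "beads N w = hook_beads N c 3"
    using is_hook_rank_iff_beads[OF f] assms by auto
  have "straight N c 3"
  proof -
    have "c + 4 < 2 * N \<or> 2 * N \<le> c + 2"
    proof (rule hook_core_cases[of w c])
      show "odd_bip w" "bip_rank w = 2 * p - 1" "beads N w = hook_beads N c (2 * p - 1)" "c < 2 * N"
        "2 * N \<le> c + 2 * (2 * p - 1)" using assms c p by simp_all
    qed (use p in auto)
    then show ?thesis using c by (auto simp: straight_def)
  qed
  then show ?thesis using one_dimensional_iff_beads[OF f] assms c by auto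
qed

text \<open>Parents of rows are rows and parents of columns are columns, in the same component, so
  nothing is identified. With four nodes on either level, \<open>parent\<close> becomes a bijection
  onto the nodes of rank 2.\<close>

lemma inj_on_parent_top_one_dim: "inj_on parent (top_one_dim 2)"
proof (rule inj_onI)
  fix x y assume xy: "x \<in> top_one_dim 2" "y \<in> top_one_dim 2" "parent x = parent y"
  have anc: "ancestor 1 z = ancestor 1 (parent z)" if "z \<in> top_one_dim 2" for z
    using that ancestor_parent[of z 1] by (auto simp: top_one_dim_def top_row_eq)
  have "x \<in> side 0 2 \<or> x \<in> side 1 2" using xy(1) top_one_dim_sides[of 2] by auto
  then have "\<exists>t<2. x \<in> side t 2" by (elim disjE) (rule exI[of _ 0], simp, rule exI[of _ 1], simp)
  then obtain t where t: "t < 2" "x \<in> side t 2" by blast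
  then have "y \<in> side t 2"
    using xy anc[OF xy(1)] anc[OF xy(2)] by (auto simp: side_iff top_one_dim_def top_row_eq)
  then have m: "x \<in> {row_bip 3 t 3, col_bip 3 t 3}" "y \<in> {row_bip 3 t 3, col_bip 3 t 3}"
    using one_dim_side[OF t(1), of 2 3] xy t(2) by auto
  have p: "parent (row_bip 3 t 3) = row_bip 3 t 2" "parent (col_bip 3 t 3) = col_bip 3 t 2"
    using parent_row_bip[OF t(1), of 2 3] parent_col_bip[OF t(1), of 2 3] by (simp_all add: numeral_3_eq_3[symmetric])
  show "x = y" using m xy(3) p row_ne_col[OF t(1), of 2 3] by auto
qed

theorem theorem8:
  "((\<exists>\<phi>. rooted_iso \<phi> (M2k 2) (complete_binary_tree 3) \<and>
          (\<forall>p\<in>nodes (M2k 2). length (\<phi> p) = bip_rank p)) \<and>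
    {p \<in> nodes (M2k 2). bip_rank p = 0} = {([], [])} \<and>
    {p \<in> nodes (M2k 2). bip_rank p = 1} = {([1], []), ([], [1])} \<and>
    (\<forall>p\<in>nodes (M2k 2). bip_rank p < 3 \<longrightarrow> card (up_neighbours (M2k 2) p) = 2) \<and>
    card {p \<in> nodes (M2k 2). bip_rank p = 2} = 4 \<and>
    (\<forall>p\<in>nodes (M2k 2). bip_rank p = 2 \<longrightarrow>
       (\<exists>!q. q \<in> top_row 2 \<and> {p, q} \<in> edges (M2k 2) \<and> one_dimensional q)) \<and>
    card (top_one_dim 2) = 4 \<and>
    card (top_one_dim 2 \<inter> left_branch 2) = 2 \<and>
    card (top_one_dim 2 \<inter> right_branch 2) = 2 \<and>
    left_branch 2 \<inter> right_branch 2 = {} \<and>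
    (\<forall>q\<in>top_one_dim 2. is_hook q) \<and>
    card (top_row 2 - top_one_dim 2) = 4 \<and>
    (\<forall>q\<in>top_row 2 - top_one_dim 2. \<not> is_hook q))
   \<and>
   (\<forall>k\<ge>2.
      \<comment> \<open>(1)\<close>
      (\<forall>v\<in>top_row k. \<not> is_hook v \<longrightarrow> attached k v = {}) \<and>
      (\<forall>v\<in>top_row k. is_hook v \<longrightarrow> card (attached k v) = 2) \<and>
      nodes (M2k (k + 1)) =
        nodes (M2k k) \<union> (\<Union>(v, u)\<in>attachments k. nodes (grown_at k u)) \<and>
      edges (M2k (k + 1)) =
        edges (M2k k) \<union> (\<Union>(v, u)\<in>attachments k. insert {v, u} (edges (grown_at k u))) \<and>
      (\<forall>(v, u)\<in>attachments k. nodes (M2k k) \<inter> nodes (grown_at k u) = {}) \<and>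
      (\<forall>(v, u)\<in>attachments k. \<forall>(v', u')\<in>attachments k.
         (v, u) \<noteq> (v', u') \<longrightarrow> nodes (grown_at k u) \<inter> nodes (grown_at k u') = {}) \<and>
      \<comment> \<open>\<open>\<phi> u\<close> identifies \<open>M2k k\<close> with the copy rooted at \<open>u\<close>\<close>
      (\<exists>\<phi>.
         (\<forall>(v, u)\<in>attachments k. rooted_iso (\<phi> u) (M2k k) (grown_at k u)) \<and>
         (\<forall>B\<in>{left_branch, right_branch}.
            \<comment> \<open>(2)\<close>
            (\<exists>c. (\<forall>v\<in>top_one_dim k \<inter> B k. (v, c v) \<in> attachments k) \<and>
                 top_hooks (k + 1) \<inter> B (k + 1) =
                   (\<Union>v\<in>top_one_dim k \<inter> B k. \<phi> (c v) ` (top_hooks k \<inter> B k))) \<and>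
            \<comment> \<open>(3)\<close>
            card (top_one_dim k \<inter> B k) = 2 \<and>
            (\<exists>c d. (\<forall>v\<in>top_one_dim k \<inter> B k.
                      (v, c v) \<in> attachments k \<and> d v \<in> top_one_dim k \<inter> B k) \<and>
                   top_one_dim (k + 1) \<inter> B (k + 1) =
                     (\<lambda>v. \<phi> (c v) (d v)) ` (top_one_dim k \<inter> B k)))))"
proof -
  have n2: "nodes (M2k 2) = {x. odd_bip x \<and> bip_rank x < 4}" by (simp add: nodes_M2k)
  have t2: "top_row 2 = {x. odd_bip x \<and> bip_rank x = 3}" by (simp add: top_row_eq)
  have sides: "left_branch = side 0" "right_branch = side 1" by (auto simp: fun_eq_iff side_branch)
  obtain \<phi> where \<phi>: "rooted_iso \<phi> (M2k 2) (complete_binary_tree 3)"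
    and len: "\<And>x. x \<in> nodes (M2k 2) \<Longrightarrow> length (\<phi> x) = bip_rank x"
    using complete_binary_tree_iso[of 2] card_children_small by auto
  \<comment> \<open>The tree isomorphism preserves ranks, so the sizes of the rows are numbers of
    binary words.\<close>
  have card_row: "card {x \<in> nodes (M2k 2). bip_rank x = n} = 2 ^ n" if "n \<le> 3" for n
  proof -
    have b: "bij_betw \<phi> (nodes (M2k 2)) {w. length w \<le> 3}"
      using \<phi> by (simp add: rooted_iso_def complete_binary_tree_def)
    have "bij_betw \<phi> {x \<in> nodes (M2k 2). bip_rank x = n} {w. length w = n}"
    proof (rule bij_betw_subset[OF b])
      have "w \<in> \<phi> ` {x \<in> nodes (M2k 2). bip_rank x = n}" if w: "length w = n" for w
      proof -
        have "w \<in> \<phi> ` nodes (M2k 2)" using bij_betw_imp_surj_on[OF b] w \<open>n \<le> 3\<close> by auto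
        then show ?thesis using len w by auto
      qed
      then show "\<phi> ` {x \<in> nodes (M2k 2). bip_rank x = n} = {w. length w = n}" using len by auto
    qed auto
    then have "card {x \<in> nodes (M2k 2). bip_rank x = n} = card {w :: bool list. length w = n}"
      by (rule bij_betw_same_card)
    also have "\<dots> = 2 ^ n" using card_lists_length_eq[of "UNIV :: bool set" n] by simp
    finally show ?thesis .
  qed
  have row0: "{x \<in> nodes (M2k 2). bip_rank x = 0} = {([], [])}"
    using bip_rank_0_iff odd_bip_Nil by (auto simp: n2 bip_rank.simps)
  have row1: "{x \<in> nodes (M2k 2). bip_rank x = 1} = {([1], []), ([], [1])}"
  proof -
    have "x = side_root 0 \<or> x = side_root 1" if x: "odd_bip x" "bip_rank x = 1" for x
    proof -
      obtain t where "t < 2" "x = side_root t" using rank_1_eq[OF x] .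
      then have "t = 0 \<or> t = 1" "x = side_root t" by auto
      then show ?thesis by blast
    qed
    then have "{x \<in> nodes (M2k 2). bip_rank x = 1} = {side_root 0, side_root 1}"
      using odd_side_root beads_side_root(3)[OF _ zero_less_one] by (auto simp: n2)
    then show ?thesis by (simp add: side_root_def)
  qed
  have up: "\<forall>x\<in>nodes (M2k 2). bip_rank x < 3 \<longrightarrow> card (up_neighbours (M2k 2) x) = 2"
    using up_neighbours_M2k[of _ 2] card_children_small by (simp add: n2)
  have row2: "card {x \<in> nodes (M2k 2). bip_rank x = 2} = 4" using card_row[of 2] by simp
  have top: "top_row 2 = {x \<in> nodes (M2k 2). bip_rank x = 3}" by (auto simp: t2 n2)
  have one_sub: "top_one_dim 2 \<subseteq> top_row 2" by (auto simp: top_one_dim_def)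
  have fin: "finite (top_row 2)" using card_row[of 3] top by (intro card_ge_0_finite) simp
  have one4: "card (top_one_dim 2) = 4" using card_top_one_dim by simp
  \<comment> \<open>Injectivity and the equal count 4 give surjectivity, hence the existence half of
    the claim that each node of rank 2 has exactly one one-dimensional neighbour above.\<close>
  have par_im: "parent ` top_one_dim 2 = {x \<in> nodes (M2k 2). bip_rank x = 2}"
  proof (rule card_subset_eq)
    show "finite {x \<in> nodes (M2k 2). bip_rank x = 2}" using card_row[of 2] by (intro card_ge_0_finite) simp
    show "parent ` top_one_dim 2 \<subseteq> {x \<in> nodes (M2k 2). bip_rank x = 2}"
      using one_sub parent by (fastforce simp: t2 n2)
    show "card (parent ` top_one_dim 2) = card {x \<in> nodes (M2k 2). bip_rank x = 2}"
      using card_image[OF inj_on_parent_top_one_dim] one4 card_row[of 2] by simp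
  qed
  have unique: "\<forall>x\<in>nodes (M2k 2). bip_rank x = 2 \<longrightarrow>
      (\<exists>!q. q \<in> top_row 2 \<and> {x, q} \<in> edges (M2k 2) \<and> one_dimensional q)"
  proof (intro ballI impI)
    fix x assume x: "x \<in> nodes (M2k 2)" "bip_rank x = 2"
    have e: "q \<in> top_row 2 \<and> {x, q} \<in> edges (M2k 2) \<and> one_dimensional q \<longleftrightarrow> q \<in> top_one_dim 2 \<and> parent q = x" for q
      using x parent(3)[of x] unfolding edges_M2k_iff by (auto simp: top_one_dim_def t2)
    have "x \<in> parent ` top_one_dim 2" unfolding par_im using x by simp
    then obtain q where "q \<in> top_one_dim 2" "parent q = x" by blast
    then show "\<exists>!q. q \<in> top_row 2 \<and> {x, q} \<in> edges (M2k 2) \<and> one_dimensional q"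
      unfolding e using inj_onD[OF inj_on_parent_top_one_dim] by (intro ex1I[of _ q]) auto
  qed
  have first: "(\<exists>\<phi>. rooted_iso \<phi> (M2k 2) (complete_binary_tree 3) \<and> (\<forall>p\<in>nodes (M2k 2). length (\<phi> p) = bip_rank p))"
    using \<phi> len by blast
  have hooks: "\<forall>q\<in>top_one_dim 2. is_hook q"
    using one_dim_is_hook by (auto simp: top_one_dim_def t2 odd_bip_def)
  have nonhooks: "\<forall>q\<in>top_row 2 - top_one_dim 2. \<not> is_hook q"
    using hook_rank_3 by (auto simp: top_one_dim_def t2)
  have rest: "card (top_row 2 - top_one_dim 2) = 4"
    using card_Diff_subset[OF finite_subset[OF one_sub fin] one_sub] one4 card_row[of 3] top by simp
  have level: "level k" if "2 \<le> k" for k using that by unfold_locales simp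
  have branches: "card (top_one_dim 2 \<inter> left_branch 2) = 2" "card (top_one_dim 2 \<inter> right_branch 2) = 2"
    "left_branch 2 \<inter> right_branch 2 = {}"
    unfolding sides using card_one_dim_side[of 0 2] card_one_dim_side[of 1 2] side_disjoint by auto
  show ?thesis
    by (intro conjI allI impI)
      ((fact first row0 row1 up row2 unique one4 branches hooks rest nonhooks |
        rule level.attached_card[OF level] level.nodes_step[OF level, unfolded Suc_eq_plus1]
          level.edges_step[OF level, unfolded Suc_eq_plus1] level.copies_disjoint[OF level]
          level.copies_exist[OF level], assumption+)+)
qed

end
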